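(* Let $\eta > 0$ and $1 < \sigma < 2^*/2$, and consider the problem \[ \left\{\begin{aligned} - \left[a + S^{-2^*/2} \left(\int_\Omega |\nabla u|^2\, dx\right)^{2^*/2-1} + \eta \left(\int_\Omega |\nabla u|^2\, dx\right)^{\sigma-1}\right] \Delta u & = \lambda u + |u|^{2^*-2}\, u && \text{in } \Omega\\ u & = 0 && \text{on } \partial\Omega . \end{aligned}\right. \] (i) If $a = 0$, then the problem has a nontrivial weak solution for all $\lambda > 0$. (ii) If $a > 0$, then the problem has two nontrivial weak solutions for $\lambda > a\lambda_1$.
   Context: $\Omega$ is a bounded domain in $\mathbb{R}^N$, $N \ge 3$, and $2^* = 2N/(N-2)$. $\lambda_1 > 0$ is the first Dirichlet eigenvalue of $-\Delta$ in $\Omega$. The best Sobolev constant is $S = \inf_{u \in H^1_0(\Omega) \setminus \{0\}} \int_\Omega |\nabla u|^2\, dx \big/ \left(\int_\Omega |u|^{2^*} dx\right)^{2/2^*}$. Writing $h(t) = a + S^{-2^*/2} t^{2^*/2-1} + \eta t^{\sigma-1}$, a (weak) solution is a function $u \in H^1_0(\Omega)$ such that $h\left(\int_\Omega |\nabla u|^2\, dx\right) \int_\Omega \nabla u \cdot \nabla v\, dx = \lambda \int_\Omega uv\, dx + \int_\Omega |u|^{2^*-2} uv\, dx$ for all $v \in H^1_0(\Omega)$; it is nontrivial if $u \neq 0$. "Two nontrivial solutions" means at least two distinct nontrivial solutions. *)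

theory Defs
  imports "HOL-Analysis.Analysis"
begin

text \<open>
  Elements of the function spaces below are represented by functions on the whole space, of which
  only the values on \<open>\<Omega>\<close> matter, and two functions represent the same element iff they agree
  almost everywhere on \<open>\<Omega>\<close>. All integrals are Lebesgue integrals over \<open>\<Omega>\<close>.
\<close>

primrec C_k :: "nat \<Rightarrow> ('a::euclidean_space \<Rightarrow> real) \<Rightarrow> bool" where
  "C_k 0 f \<longleftrightarrow> continuous_on UNIV f"
| "C_k (Suc k) f \<longleftrightarrow> (\<forall>x. f differentiable (at x)) \<and>
     (\<forall>b\<in>Basis. C_k k (\<lambda>x. frechet_derivative f (at x) b))"

definition grad :: "('a::euclidean_space \<Rightarrow> real) \<Rightarrow> 'a \<Rightarrow> 'a" where
  "grad f x = (\<Sum>b\<in>Basis. frechet_derivative f (at x) b *\<^sub>R b)"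

text \<open>\<open>C\<^sub>c\<^sup>\<infinity>(\<Omega>)\<close>, each function being extended by zero outside \<open>\<Omega>\<close>.\<close>

definition test_functions :: "'a::euclidean_space set \<Rightarrow> ('a \<Rightarrow> real) set" where
  "test_functions \<Omega> = {\<phi>. (\<forall>k. C_k k \<phi>) \<and> compact (closure {x. \<phi> x \<noteq> 0}) \<and>
     closure {x. \<phi> x \<noteq> 0} \<subseteq> \<Omega>}"

definition L2_on :: "'a::euclidean_space set \<Rightarrow> ('a \<Rightarrow> 'b::euclidean_space) set" where
  "L2_on \<Omega> = {f \<in> borel_measurable (lebesgue_on \<Omega>).
     integrable (lebesgue_on \<Omega>) (\<lambda>x. (norm (f x))\<^sup>2)}"

definition ae_eq_on ::
  "'a::euclidean_space set \<Rightarrow> ('a \<Rightarrow> real) \<Rightarrow> ('a \<Rightarrow> real) \<Rightarrow> bool" where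
  "ae_eq_on \<Omega> u v \<longleftrightarrow> (AE x in lebesgue_on \<Omega>. u x = v x)"

definition has_weak_grad ::
  "'a::euclidean_space set \<Rightarrow> ('a \<Rightarrow> real) \<Rightarrow> ('a \<Rightarrow> 'a) \<Rightarrow> bool" where
  "has_weak_grad \<Omega> u g \<longleftrightarrow>
     (\<forall>\<phi>\<in>test_functions \<Omega>.
        (LINT x|lebesgue_on \<Omega>. u x *\<^sub>R grad \<phi> x) = - (LINT x|lebesgue_on \<Omega>. \<phi> x *\<^sub>R g x))"

definition H1 :: "'a::euclidean_space set \<Rightarrow> ('a \<Rightarrow> real) set" where
  "H1 \<Omega> = {u \<in> L2_on \<Omega>. \<exists>g\<in>L2_on \<Omega>. has_weak_grad \<Omega> u g}"

text \<open>The weak gradient is determined only up to equality almost everywhere in \<open>\<Omega>\<close>.\<close>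

definition weak_grad :: "'a::euclidean_space set \<Rightarrow> ('a \<Rightarrow> real) \<Rightarrow> 'a \<Rightarrow> 'a" where
  "weak_grad \<Omega> u = (SOME g. g \<in> L2_on \<Omega> \<and> has_weak_grad \<Omega> u g)"

text \<open>The closure of \<open>C\<^sub>c\<^sup>\<infinity>(\<Omega>)\<close> in the norm of \<open>H\<^sup>1(\<Omega>)\<close>.\<close>

definition H10 :: "'a::euclidean_space set \<Rightarrow> ('a \<Rightarrow> real) set" where
  "H10 \<Omega> = {u \<in> H1 \<Omega>. \<exists>\<phi>. (\<forall>k::nat. \<phi> k \<in> test_functions \<Omega>) \<and>
     (\<lambda>k. (LINT x|lebesgue_on \<Omega>. (\<phi> k x - u x)\<^sup>2) +
          (LINT x|lebesgue_on \<Omega>. (norm (grad (\<phi> k) x - weak_grad \<Omega> u x))\<^sup>2)) \<longlonglongrightarrow> 0}"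

definition H10_nonzero :: "'a::euclidean_space set \<Rightarrow> ('a \<Rightarrow> real) set" where
  "H10_nonzero \<Omega> = {u \<in> H10 \<Omega>. \<not> ae_eq_on \<Omega> u (\<lambda>x. 0)}"

definition dirichlet_form ::
  "'a::euclidean_space set \<Rightarrow> ('a \<Rightarrow> real) \<Rightarrow> ('a \<Rightarrow> real) \<Rightarrow> real" where
  "dirichlet_form \<Omega> u v = (LINT x|lebesgue_on \<Omega>. weak_grad \<Omega> u x \<bullet> weak_grad \<Omega> v x)"

definition dirichlet_energy :: "'a::euclidean_space set \<Rightarrow> ('a \<Rightarrow> real) \<Rightarrow> real" where
  "dirichlet_energy \<Omega> u = (LINT x|lebesgue_on \<Omega>. (norm (weak_grad \<Omega> u x))\<^sup>2)"

text \<open>The critical Sobolev exponent \<open>2\<^sup>*\<close> in dimension \<open>N\<close>.\<close>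

definition crit_exp :: "nat \<Rightarrow> real" where
  "crit_exp N = 2 * real N / (real N - 2)"

definition dirichlet_eigenvalue :: "'a::euclidean_space set \<Rightarrow> real \<Rightarrow> bool" where
  "dirichlet_eigenvalue \<Omega> \<mu> \<longleftrightarrow>
     (\<exists>u\<in>H10_nonzero \<Omega>. \<forall>v\<in>H10 \<Omega>.
        dirichlet_form \<Omega> u v = \<mu> * (LINT x|lebesgue_on \<Omega>. u x * v x))"

definition first_dirichlet_eigenvalue :: "'a::euclidean_space set \<Rightarrow> real" where
  "first_dirichlet_eigenvalue \<Omega> = (LEAST \<mu>. dirichlet_eigenvalue \<Omega> \<mu>)"

definition sobolev_const :: "'a::euclidean_space set \<Rightarrow> real" where
  "sobolev_const \<Omega> = (INF u\<in>H10_nonzero \<Omega>.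
     dirichlet_energy \<Omega> u /
       (LINT x|lebesgue_on \<Omega>. \<bar>u x\<bar> powr crit_exp DIM('a)) powr (2 / crit_exp DIM('a)))"

definition kirchhoff_coeff ::
  "'a::euclidean_space set \<Rightarrow> real \<Rightarrow> real \<Rightarrow> real \<Rightarrow> real \<Rightarrow> real" where
  "kirchhoff_coeff \<Omega> a \<eta> \<sigma> t =
     a + sobolev_const \<Omega> powr (- crit_exp DIM('a) / 2) * t powr (crit_exp DIM('a) / 2 - 1)
       + \<eta> * t powr (\<sigma> - 1)"

definition weak_solution ::
  "'a::euclidean_space set \<Rightarrow> real \<Rightarrow> real \<Rightarrow> real \<Rightarrow> real \<Rightarrow> ('a \<Rightarrow> real) \<Rightarrow> bool" where
  "weak_solution \<Omega> a \<eta> \<sigma> \<mu> u \<longleftrightarrow> u \<in> H10 \<Omega> \<and>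
     (\<forall>v\<in>H10 \<Omega>.
        kirchhoff_coeff \<Omega> a \<eta> \<sigma> (dirichlet_energy \<Omega> u) * dirichlet_form \<Omega> u v =
          \<mu> * (LINT x|lebesgue_on \<Omega>. u x * v x)
          + (LINT x|lebesgue_on \<Omega>. \<bar>u x\<bar> powr (crit_exp DIM('a) - 2) * u x * v x))"

definition nontrivial_weak_solution ::
  "'a::euclidean_space set \<Rightarrow> real \<Rightarrow> real \<Rightarrow> real \<Rightarrow> real \<Rightarrow> ('a \<Rightarrow> real) \<Rightarrow> bool" where
  "nontrivial_weak_solution \<Omega> a \<eta> \<sigma> \<mu> u \<longleftrightarrow>
     weak_solution \<Omega> a \<eta> \<sigma> \<mu> u \<and> \<not> ae_eq_on \<Omega> u (\<lambda>x. 0)"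

end

theory Submission
  imports Defs "HOL-Complex_Analysis.Great_Picard"
begin

text \<open>
  Put \<open>p = 2\<^sup>*\<close> and \<open>D(u) = \<integral>\<^sub>\<Omega> |\<nabla>u|\<^sup>2\<close>. Weak solutions are the critical points of the energy
  \<open>E(u) = a/2 D(u) + (S\<^bsup>-p/2\<^esup> D(u)\<^bsup>p/2\<^esup> - \<integral>|u|\<^sup>p)/p + \<eta>/(2\<sigma>) D(u)\<^bsup>\<sigma>\<^esup> - \<lambda>/2 \<integral>u\<^sup>2\<close>.
  By the Sobolev inequality the middle term is nonnegative, so \<open>\<sigma> > 1\<close> makes \<open>E\<close> coercive. That term
  is also weakly lower semicontinuous: along \<open>u\<^sub>n \<rightharpoonup> u\<close> both \<open>D\<close> and \<open>\<integral>|\<cdot>|\<^sup>p\<close> split into the contributions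
  of \<open>u\<close> and of \<open>u\<^sub>n - u\<close> (Brezis-Lieb), the map \<open>t \<mapsto> t\<^bsup>p/2\<^esup>\<close> is superadditive, and the contribution of
  \<open>u\<^sub>n - u\<close> is nonnegative by the Sobolev inequality again. Hence \<open>E\<close> attains its minimum. If \<open>a \<lambda>\<^sub>1 < \<lambda>\<close>,
  which includes the case \<open>a = 0\<close>, then \<open>E\<close> is negative at small multiples of the first eigenfunction, so
  a minimizer \<open>u\<close> is nontrivial, and \<open>-u\<close> is a second solution since \<open>E\<close> is even.

  The Sobolev and Rellich theorems both rest on the estimate
  \<open>\<parallel>u(\<cdot> + h) - u\<parallel>\<^sub>2 \<le> |h| \<parallel>\<nabla>u\<parallel>\<^sub>2\<close>, averaged over \<open>h\<close> in a small cube. On functions with small support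
  this gives the Faber-Krahn inequality, and applying the latter to the truncations of \<open>u\<close> at dyadic levels
  gives the Sobolev inequality.
\<close>

subsection \<open>Smooth functions and bump functions\<close>

text \<open>Three definitions need substance before the variational argument can start.
  \<open>weak_grad\<close> is a choice, so it has to be unique almost everywhere.
  \<open>sobolev_const\<close> is an infimum of reals; if it were 0, then
  \<open>S powr (- p / 2)\<close> would be 0 as well, because \<open>0 powr x = 0\<close>, and the
  Sobolev inequality with this constant would fail. So S > 0 is needed, that is, a Sobolev
  inequality with some constant. \<open>first_dirichlet_eigenvalue\<close> is a
  \<open>LEAST\<close>, which says something only once a least eigenvalue exists, so the Rayleigh
  quotient has to be minimized first. Translations leave the domain. The inequalities are therefore
  proved on the whole space for compactly supported functions and reach \<open>H10\<close> by
  density. The class used there is C^1, because the truncations in the proof of the Sobolev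
  inequality are no smoother. Weak convergence of gradients is never an input: a sequence is first
  extracted in L2, and the convergence of \<open>dirichlet_form\<close> is derived by moving both
  derivatives onto a test function.\<close>

lemma C_k_continuous: "C_k k f \<Longrightarrow> continuous_on UNIV f"
  by (cases k) (auto intro!: continuous_at_imp_continuous_on differentiable_imp_continuous_within)

text \<open>\<open>frechet_derivative\<close> is a choice operator. Here any explicit derivative
  field \<open>F\<close> may be supplied instead, and the closure properties below follow by
  induction on the order.\<close>

lemma C_k_SucI:
  assumes "\<And>x. (f has_derivative F x) (at x)" "\<And>b. b \<in> Basis \<Longrightarrow> C_k k (\<lambda>x. F x b)"
  shows "C_k (Suc k) f"
proof -
  have "frechet_derivative f (at x) = F x" for x
    using frechet_derivative_at[OF assms(1)[of x]] by simp
  then show ?thesis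
    using assms by (auto simp: differentiable_def)
qed

lemma C_k_Suc_has_derivative:
  "C_k (Suc k) f \<Longrightarrow> (f has_derivative frechet_derivative f (at x)) (at x)"
  by (simp add: frechet_derivative_works)

lemma C_k_SucD: "C_k (Suc k) f \<Longrightarrow> C_k k f"
proof (induction k arbitrary: f)
  case 0
  then show ?case
    using C_k_continuous[OF 0] by simp
qed auto

lemma C_k_const: "C_k k (\<lambda>x. c)"
proof (induction k arbitrary: c)
  case (Suc k)
  show ?case
    by (rule C_k_SucI[where F="\<lambda>x h. 0"]) (auto intro: Suc)
qed simp

lemma C_k_add: "C_k k f \<Longrightarrow> C_k k g \<Longrightarrow> C_k k (\<lambda>x. f x + g x)"
proof (induction k arbitrary: f g)
  case 0
  then show ?case by (auto intro: continuous_intros)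
next
  case (Suc k)
  show ?case
  proof (rule C_k_SucI)
    show "((\<lambda>x. f x + g x) has_derivative
      (\<lambda>h. frechet_derivative f (at x) h + frechet_derivative g (at x) h)) (at x)" for x
      by (intro has_derivative_add C_k_Suc_has_derivative[of k] Suc.prems)
  qed (use Suc in auto)
qed

lemma C_k_mult: "C_k k f \<Longrightarrow> C_k k g \<Longrightarrow> C_k k (\<lambda>x. f x * g x)"
proof (induction k arbitrary: f g)
  case 0
  then show ?case by (auto intro: continuous_intros)
next
  case (Suc k)
  show ?case
  proof (rule C_k_SucI)
    show "((\<lambda>x. f x * g x) has_derivative
      (\<lambda>h. f x * frechet_derivative g (at x) h + frechet_derivative f (at x) h * g x)) (at x)" for x
      by (intro has_derivative_mult C_k_Suc_has_derivative[of k] Suc.prems)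
  qed (use Suc.prems C_k_SucD[OF Suc.prems(1)] C_k_SucD[OF Suc.prems(2)] in \<open>auto intro!: C_k_add Suc.IH\<close>)
qed

lemma C_k_cmult: "C_k k f \<Longrightarrow> C_k k (\<lambda>x. c * f x)"
  by (intro C_k_mult C_k_const)

lemma C_k_diff: "C_k k f \<Longrightarrow> C_k k g \<Longrightarrow> C_k k (\<lambda>x. f x - g x)"
  using C_k_add[of k f "\<lambda>x. (-1) * g x"] C_k_cmult[of k g "-1"] by simp

lemma C_k_prod: "finite A \<Longrightarrow> (\<And>i. i \<in> A \<Longrightarrow> C_k k (f i)) \<Longrightarrow> C_k k (\<lambda>x. \<Prod>i\<in>A. f i x)"
  by (induction A rule: finite_induct) (auto intro: C_k_const C_k_mult)

lemma C_k_power: "C_k k f \<Longrightarrow> C_k k (\<lambda>x. f x ^ n)"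
  by (induction n) (auto intro: C_k_const C_k_mult)

text \<open>The factor s^m makes the family closed under differentiation: the derivative of the m-th
  member combines the members m + 1 and m + 2. The member 0 is the classical flat function
  exp(-1/s).\<close>

definition exp_bump :: "nat \<Rightarrow> real \<Rightarrow> real" where
  "exp_bump m s = (if s \<le> 0 then 0 else exp (- 1 / s) / s ^ m)"

text \<open>The term of index m + 2 in the exponential series at 1/s gives exp(-1/s) <= (m + 2)!
  s^(m+2). Dividing by s^m leaves s^2, which makes the difference quotient at 0 vanish.\<close>

lemma exp_bump_le: "\<bar>exp_bump m s\<bar> \<le> fact (m + 2) * s\<^sup>2"
proof (cases "s \<le> 0")
  case False
  then have s: "s > 0" by simp
  have "(1/s) ^ (m+2) / fact (m+2) \<le> exp (1/s)"
  proof -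
    have "(1/s) ^ (m+2) /\<^sub>R fact (m+2) \<le> (\<Sum>n. (1/s) ^ n /\<^sub>R fact n)"
      using sum_le_suminf[OF summable_exp_generic[of "1/s"], of "{m+2}"] s by (simp del: fact_Suc)
    then show ?thesis by (simp add: exp_def divide_inverse mult.commute del: fact_Suc)
  qed
  then have "exp (- 1/s) \<le> fact (m+2) * s ^ (m+2)"
    using s by (simp add: exp_minus field_simps del: fact_Suc)
  then have "exp (- 1/s) / s ^ m \<le> fact (m+2) * s\<^sup>2"
    using s by (simp add: field_simps power_add power2_eq_square del: fact_Suc)
  then show ?thesis using s by (simp add: exp_bump_def)
qed (simp add: exp_bump_def)

lemma exp_bump_has_derivative:
  "(exp_bump m has_real_derivative (- real m * exp_bump (m+1) s + exp_bump (m+2) s)) (at s)"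
proof -
  consider "s < 0" | "s = 0" | "s > 0" by linarith
  then show ?thesis
  proof cases
    case 1
    have "(exp_bump m has_real_derivative 0) (at s)"
      by (rule has_field_derivative_transform_within_open[where f="\<lambda>_. 0" and S="{..<0}"])
        (use 1 in \<open>auto simp: exp_bump_def\<close>)
    then show ?thesis using 1 by (simp add: exp_bump_def)
  next
    case 2
    have "((\<lambda>h. (exp_bump m (0 + h) - exp_bump m 0) / h) \<longlongrightarrow> 0) (at 0)"
    proof (rule Lim_null_comparison)
      show "((\<lambda>h. fact (m+2) * \<bar>h\<bar>) \<longlongrightarrow> (0::real)) (at 0)"
        by (auto intro!: tendsto_eq_intros)
      show "\<forall>\<^sub>F h in at 0. norm ((exp_bump m (0 + h) - exp_bump m 0) / h) \<le> fact (m + 2) * \<bar>h\<bar>"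
      proof (rule eventually_at_topological[THEN iffD2], intro exI[of _ UNIV] conjI ballI impI)
        fix h :: real assume "h \<noteq> 0"
        then show "norm ((exp_bump m (0 + h) - exp_bump m 0) / h) \<le> fact (m + 2) * \<bar>h\<bar>"
          using exp_bump_le[of m h]
          by (simp add: exp_bump_def field_simps power2_eq_square abs_mult del: fact_Suc) 
      qed auto
    qed
    then show ?thesis using 2 by (simp add: DERIV_def exp_bump_def)
  next
    case 3
    have "((\<lambda>s. exp (- 1 / s) / s ^ m) has_real_derivative
        (- real m * exp_bump (m+1) s + exp_bump (m+2) s)) (at s)"
      using 3 apply (auto intro!: derivative_eq_intros simp: exp_bump_def)
      apply (cases m)
      apply (auto simp: field_simps power2_eq_square)
      done
    then show ?thesis
      by (rule has_field_derivative_transform_within_open[where S="{0<..}"])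
        (use 3 in \<open>auto simp: exp_bump_def\<close>)
  qed
qed

text \<open>Induction on the order with m arbitrary. The argument is affine, so derivatives stay in
  the family up to constants.\<close>

lemma C_k_exp_bump: "C_k k (\<lambda>x. exp_bump m (x \<bullet> v + c))"
proof (induction k arbitrary: m)
  case 0
  have "continuous_on UNIV (exp_bump m)"
    using exp_bump_has_derivative[of m] DERIV_isCont continuous_at_imp_continuous_on by blast
  then show ?case
    by (auto intro!: continuous_on_compose2[of UNIV "exp_bump m"] continuous_intros)
next
  case (Suc k)
  show ?case
  proof (rule C_k_SucI)
    fix x :: 'a
    have "((\<lambda>x. x \<bullet> v + c) has_derivative (\<lambda>h. h \<bullet> v)) (at x)"
      by (auto intro!: derivative_eq_intros)
    from has_derivative_compose[OF this exp_bump_has_derivative[unfolded has_field_derivative_def]]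
    show "((\<lambda>x. exp_bump m (x \<bullet> v + c)) has_derivative
      (\<lambda>h. (- real m * exp_bump (m+1) (x \<bullet> v + c) + exp_bump (m+2) (x \<bullet> v + c)) * (h \<bullet> v))) (at x)" .
  next
    fix b :: 'a
    show "C_k k (\<lambda>x. (- real m * exp_bump (m+1) (x \<bullet> v + c) + exp_bump (m+2) (x \<bullet> v + c)) * (b \<bullet> v))"
      by (intro C_k_mult C_k_add C_k_const Suc)
  qed
qed

lemma exp_bump_0: "0 \<le> exp_bump 0 s" "exp_bump 0 s \<le> 1" "exp_bump 0 s = 0 \<longleftrightarrow> s \<le> 0"
  by (auto simp: exp_bump_def)

text \<open>A product over the coordinates rather than a radial function: it is positive exactly on
  an open box, and boxes are what open sets are decomposed into later.\<close>

definition box_bump :: "'a::euclidean_space \<Rightarrow> 'a \<Rightarrow> 'a \<Rightarrow> real" where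
  "box_bump l u x = (\<Prod>b\<in>Basis. exp_bump 0 (x \<bullet> b - l \<bullet> b) * exp_bump 0 (u \<bullet> b - x \<bullet> b))"

lemma C_k_box_bump: "C_k k (box_bump l u)"
proof -
  have "C_k k (\<lambda>x::'a. exp_bump 0 (x \<bullet> b - l \<bullet> b))" for b
    using C_k_exp_bump[of k 0 b "- (l \<bullet> b)"] by simp
  moreover have "C_k k (\<lambda>x::'a. exp_bump 0 (u \<bullet> b - x \<bullet> b))" for b
    using C_k_exp_bump[of k 0 "- b" "u \<bullet> b"] by simp
  ultimately show ?thesis
    unfolding box_bump_def[abs_def] by (intro C_k_prod C_k_mult) auto
qed

lemma box_bump_nonneg: "0 \<le> box_bump l u x"
  by (auto simp: box_bump_def intro!: prod_nonneg mult_nonneg_nonneg exp_bump_0)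

lemma box_bump_le_1: "box_bump l u x \<le> 1"
  by (auto simp: box_bump_def intro!: prod_le_1 mult_nonneg_nonneg mult_le_one exp_bump_0)

lemma box_bump_eq_0: "box_bump l u x = 0 \<longleftrightarrow> x \<notin> box l u"
  by (force simp: box_bump_def prod_zero_iff mem_box exp_bump_0 not_less)

section \<open>Test functions and their closure properties\<close>

lemma test_function_C_k: "\<phi> \<in> test_functions \<Omega> \<Longrightarrow> C_k k \<phi>"
  by (simp add: test_functions_def)

lemma test_functionsI:
  assumes "\<And>k. C_k k \<phi>" "compact K" "K \<subseteq> \<Omega>" "\<And>x. \<phi> x \<noteq> 0 \<Longrightarrow> x \<in> K"
  shows "\<phi> \<in> test_functions \<Omega>"
proof -
  have "closure {x. \<phi> x \<noteq> 0} \<subseteq> K"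
    using assms by (intro closure_minimal compact_imp_closed) auto
  moreover from this have "compact (closure {x. \<phi> x \<noteq> 0})"
    using assms(2) by (metis closed_Int_compact closed_closure inf.absorb_iff1)
  ultimately show ?thesis
    using assms by (auto simp: test_functions_def)
qed

lemma test_functionsE:
  assumes "\<phi> \<in> test_functions \<Omega>"
  obtains K where "compact K" "K \<subseteq> \<Omega>" "\<And>x. x \<notin> K \<Longrightarrow> \<phi> x = 0"
proof (rule that[of "closure {x. \<phi> x \<noteq> 0}"])
  show "\<phi> x = 0" if "x \<notin> closure {x. \<phi> x \<noteq> 0}" for x
    using that closure_subset[of "{x. \<phi> x \<noteq> 0}"] by auto
qed (use assms in \<open>auto simp: test_functions_def\<close>)

lemma test_functions_0: "(\<lambda>x. 0) \<in> test_functions \<Omega>"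
  by (rule test_functionsI[of _ "{}"]) (auto intro: C_k_const)

lemma test_functions_add:
  assumes "\<phi> \<in> test_functions \<Omega>" "\<psi> \<in> test_functions \<Omega>"
  shows "(\<lambda>x. \<phi> x + \<psi> x) \<in> test_functions \<Omega>"
proof -
  from assms obtain K K' where "compact K" "K \<subseteq> \<Omega>" "\<And>x. x \<notin> K \<Longrightarrow> \<phi> x = 0"
    "compact K'" "K' \<subseteq> \<Omega>" "\<And>x. x \<notin> K' \<Longrightarrow> \<psi> x = 0" by (metis test_functionsE)
  then show ?thesis
    by (intro test_functionsI[of _ "K \<union> K'"] C_k_add assms[THEN test_function_C_k] compact_Un) force+
qed

lemma test_functions_mult:
  assumes "\<phi> \<in> test_functions \<Omega>" "\<And>k. C_k k \<psi>"
  shows "(\<lambda>x. \<psi> x * \<phi> x) \<in> test_functions \<Omega>"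
proof -
  from assms obtain K where "compact K" "K \<subseteq> \<Omega>" "\<And>x. x \<notin> K \<Longrightarrow> \<phi> x = 0"
    by (metis test_functionsE)
  then show ?thesis
    by (intro test_functionsI[of _ K] C_k_mult assms(1)[THEN test_function_C_k] assms(2)) force+
qed

lemma test_functions_cmult: "\<phi> \<in> test_functions \<Omega> \<Longrightarrow> (\<lambda>x. c * \<phi> x) \<in> test_functions \<Omega>"
  by (intro test_functions_mult C_k_const)

lemma test_functions_diff:
  "\<phi> \<in> test_functions \<Omega> \<Longrightarrow> \<psi> \<in> test_functions \<Omega> \<Longrightarrow> (\<lambda>x. \<phi> x - \<psi> x) \<in> test_functions \<Omega>"
  using test_functions_add[of \<phi> \<Omega> "\<lambda>x. (-1) * \<psi> x"] test_functions_cmult[of \<psi> \<Omega> "-1"] by simp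

lemma test_functions_has_derivative:
  "\<phi> \<in> test_functions \<Omega> \<Longrightarrow> (\<phi> has_derivative frechet_derivative \<phi> (at x)) (at x)"
  using C_k_Suc_has_derivative[OF test_function_C_k[of \<phi> \<Omega> "Suc 0"]] .

text \<open>Truncation by \<open>smooth_step\<close> leaves only one continuous derivative, so the
  inequalities that use it cannot stay inside \<open>test_functions\<close>. No domain enters, since
  these inequalities live on the whole space.\<close>

definition Cc1 :: "('a::euclidean_space \<Rightarrow> real) set" where
  "Cc1 = {f. C_k 1 f \<and> (\<exists>K. compact K \<and> (\<forall>x. x \<notin> K \<longrightarrow> f x = 0))}"

lemma test_functions_Cc1:
  assumes "\<phi> \<in> test_functions \<Omega>" shows "\<phi> \<in> Cc1"
proof -
  from assms obtain K where "compact K" "\<And>x. x \<notin> K \<Longrightarrow> \<phi> x = 0"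
    by (metis test_functionsE)
  then show ?thesis
    using test_function_C_k[OF assms, of 1] by (auto simp: Cc1_def)
qed

lemma Cc1_has_derivative:
  assumes "f \<in> Cc1" shows "(f has_derivative frechet_derivative f (at x)) (at x)"
  using assms C_k_Suc_has_derivative[of 0 f] by (simp add: Cc1_def)

lemma grad_inner:
  assumes "(f has_derivative F) (at x)"
  shows "grad f x \<bullet> h = F h"
proof -
  interpret bounded_linear F using assms by (rule has_derivative_bounded_linear)
  have "F h = F (\<Sum>b\<in>Basis. (h \<bullet> b) *\<^sub>R b)" by (simp add: euclidean_representation)
  also have "\<dots> = (\<Sum>b\<in>Basis. (h \<bullet> b) * F b)" by (simp add: sum scale)
  also have "\<dots> = grad f x \<bullet> h"
    using frechet_derivative_at[OF assms]
    by (simp add: grad_def inner_sum_left inner_commute[of h] mult.commute)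
  finally show ?thesis by simp
qed

lemma grad_eqI:
  assumes "(f has_derivative (\<lambda>h. v \<bullet> h)) (at x)"
  shows "grad f x = v"
  using grad_inner[OF assms] by (metis inner_commute vector_eq_ldot)

lemma Cc1_has_grad: "f \<in> Cc1 \<Longrightarrow> (f has_derivative (\<lambda>h. grad f x \<bullet> h)) (at x)"
  using Cc1_has_derivative[of f x] grad_inner[OF Cc1_has_derivative[of f x]] by simp

lemma Cc1_continuous: "f \<in> Cc1 \<Longrightarrow> continuous_on UNIV f"
  using C_k_continuous[of 1 f] by (auto simp: Cc1_def)

lemma Cc1_continuous_grad: "f \<in> Cc1 \<Longrightarrow> continuous_on UNIV (grad f)"
  unfolding grad_def[abs_def] by (auto simp: Cc1_def intro!: continuous_intros)

lemma Cc1I: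
  assumes "\<And>x. (f has_derivative (\<lambda>h. F x \<bullet> h)) (at x)" "continuous_on UNIV F"
    "compact K" "\<And>x. x \<notin> K \<Longrightarrow> f x = 0"
  shows "f \<in> Cc1"
proof -
  have "C_k (Suc 0) f"
    by (rule C_k_SucI[OF assms(1)]) (use assms(2) in \<open>auto intro!: continuous_intros\<close>)
  then show ?thesis using assms by (auto simp: Cc1_def)
qed

lemma Cc1_grad_support:
  assumes "f \<in> Cc1" "closed K" "\<And>x. x \<notin> K \<Longrightarrow> f x = 0" "x \<notin> K"
  shows "grad f x = 0"
proof (rule grad_eqI)
  have "(f has_derivative (\<lambda>h. 0)) (at x)"
    by (rule has_derivative_transform_within_open[of "\<lambda>_. 0" _ _ _ "- K"]) (use assms in auto)
  moreover have "(\<lambda>h. 0) = (\<bullet>) (0::'a)" by auto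
  ultimately show "(f has_derivative (\<bullet>) 0) (at x)" by simp
qed

lemma Cc1_add:
  assumes "f \<in> Cc1" "g \<in> Cc1" shows "(\<lambda>x. f x + g x) \<in> Cc1"
    "grad (\<lambda>x. f x + g x) x = grad f x + grad g x"
proof -
  have *: "((\<lambda>x. f x + g x) has_derivative (\<lambda>h. (grad f x + grad g x) \<bullet> h)) (at x)" for x
    using has_derivative_add[OF Cc1_has_grad[OF assms(1), of x] Cc1_has_grad[OF assms(2), of x]]
    by (simp add: inner_add_left)
  from assms obtain K K' where "compact K" "\<And>x. x \<notin> K \<Longrightarrow> f x = 0"
    "compact K'" "\<And>x. x \<notin> K' \<Longrightarrow> g x = 0" by (auto simp: Cc1_def)
  then show "(\<lambda>x. f x + g x) \<in> Cc1"
    by (intro Cc1I[OF *, of "K \<union> K'"] continuous_intros assms[THEN Cc1_continuous_grad]) auto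
  show "grad (\<lambda>x. f x + g x) x = grad f x + grad g x" by (rule grad_eqI[OF *])
qed

lemma Cc1_mult:
  assumes "f \<in> Cc1" "g \<in> Cc1" shows "(\<lambda>x. f x * g x) \<in> Cc1"
    "grad (\<lambda>x. f x * g x) x = f x *\<^sub>R grad g x + g x *\<^sub>R grad f x"
proof -
  have *: "((\<lambda>x. f x * g x) has_derivative (\<lambda>h. (f x *\<^sub>R grad g x + g x *\<^sub>R grad f x) \<bullet> h)) (at x)" for x
    using has_derivative_mult[OF Cc1_has_grad[OF assms(1), of x] Cc1_has_grad[OF assms(2), of x]]
    by (simp add: inner_add_left mult.commute)
  from assms obtain K where "compact K" "\<And>x. x \<notin> K \<Longrightarrow> f x = 0"
    by (auto simp: Cc1_def)
  then show "(\<lambda>x. f x * g x) \<in> Cc1"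
    by (intro Cc1I[OF *, of K] continuous_intros assms[THEN Cc1_continuous_grad] assms[THEN Cc1_continuous]) auto
  show "grad (\<lambda>x. f x * g x) x = f x *\<^sub>R grad g x + g x *\<^sub>R grad f x" by (rule grad_eqI[OF *])
qed

lemma Cc1_cmult:
  assumes "f \<in> Cc1" shows "(\<lambda>x. c * f x) \<in> Cc1" "grad (\<lambda>x. c * f x) x = c *\<^sub>R grad f x"
proof -
  have *: "((\<lambda>x. c * f x) has_derivative (\<lambda>h. (c *\<^sub>R grad f x) \<bullet> h)) (at x)" for x
    using has_derivative_mult_right[OF Cc1_has_grad[OF assms(1), of x], of c] by simp
  from assms obtain K where "compact K" "\<And>x. x \<notin> K \<Longrightarrow> f x = 0" by (auto simp: Cc1_def)
  then show "(\<lambda>x. c * f x) \<in> Cc1"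
    by (intro Cc1I[OF *, of K] continuous_intros assms[THEN Cc1_continuous_grad]) auto
  show "grad (\<lambda>x. c * f x) x = c *\<^sub>R grad f x" by (rule grad_eqI[OF *])
qed

lemma Cc1_diff:
  assumes "f \<in> Cc1" "g \<in> Cc1" shows "(\<lambda>x. f x - g x) \<in> Cc1"
    "grad (\<lambda>x. f x - g x) x = grad f x - grad g x"
  using Cc1_add[OF assms(1) Cc1_cmult(1)[OF assms(2)], where c1="-1"] Cc1_cmult(2)[OF assms(2), where c="-1"]
  by auto

text \<open>Needed for second derivatives: \<open>dirichlet_form_test\<close> applies the definition
  of the weak gradient to a partial derivative of a test function.\<close>

lemma test_functions_partial:
  assumes "\<phi> \<in> test_functions \<Omega>" "b \<in> Basis"
  shows "(\<lambda>x. grad \<phi> x \<bullet> b) \<in> test_functions \<Omega>"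
proof -
  have eq: "(\<lambda>x. grad \<phi> x \<bullet> b) = (\<lambda>x. frechet_derivative \<phi> (at x) b)"
    using grad_inner[OF test_functions_has_derivative[OF assms(1)]] by auto
  from assms(1) obtain K where K: "compact K" "K \<subseteq> \<Omega>" "\<And>x. x \<notin> K \<Longrightarrow> \<phi> x = 0"
    by (metis test_functionsE)
  show ?thesis
  proof (rule test_functionsI[OF _ K(1,2)])
    show "C_k k (\<lambda>x. grad \<phi> x \<bullet> b)" for k
      using test_function_C_k[OF assms(1), of "Suc k"] assms(2) by (simp add: eq)
    show "x \<in> K" if "grad \<phi> x \<bullet> b \<noteq> 0" for x
      using that Cc1_grad_support[OF test_functions_Cc1[OF assms(1)] compact_imp_closed[OF K(1)] K(3)] by force
  qed
qed

subsection \<open>Square-integrable functions\<close>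

text \<open>\<open>L2_on\<close> over an arbitrary measure, since both \<open>lborel\<close> and
  \<open>lebesgue_on \<Omega>\<close> occur below.\<close>

definition sq_integrable :: "'a measure \<Rightarrow> ('a \<Rightarrow> 'b::euclidean_space) set" where
  "sq_integrable M = {f \<in> borel_measurable M. integrable M (\<lambda>x. (norm (f x))\<^sup>2)}"

lemma L2_on_eq: "L2_on \<Omega> = sq_integrable (lebesgue_on \<Omega>)"
  by (simp add: L2_on_def sq_integrable_def)

lemma sq_integrable_measurable [measurable_dest]: "f \<in> sq_integrable M \<Longrightarrow> f \<in> borel_measurable M"
  by (simp add: sq_integrable_def)

lemma sq_integrableD: "f \<in> sq_integrable M \<Longrightarrow> integrable M (\<lambda>x. (norm (f x))\<^sup>2)"
  by (simp add: sq_integrable_def)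

lemma sq_integrable_inner:
  assumes "f \<in> sq_integrable M" "g \<in> sq_integrable M"
  shows "integrable M (\<lambda>x. f x \<bullet> g x)"
proof (rule Bochner_Integration.integrable_bound)
  show "integrable M (\<lambda>x. (norm (f x))\<^sup>2 + (norm (g x))\<^sup>2)"
    using assms by (intro Bochner_Integration.integrable_add sq_integrableD)
  show "(\<lambda>x. f x \<bullet> g x) \<in> borel_measurable M"
    using assms by measurable
  have "\<bar>f x \<bullet> g x\<bar> \<le> (norm (f x))\<^sup>2 + (norm (g x))\<^sup>2" for x
    using Cauchy_Schwarz_ineq2[of "f x" "g x"] sum_squares_bound[of "norm (f x)" "norm (g x)"]
      mult_nonneg_nonneg[of "norm (f x)" "norm (g x)"] by simp
  then show "AE x in M. norm (f x \<bullet> g x) \<le> norm ((norm (f x))\<^sup>2 + (norm (g x))\<^sup>2)"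
    by auto
qed

lemma sq_integrable_mult:
  fixes f g :: "'a \<Rightarrow> real"
  assumes "f \<in> sq_integrable M" "g \<in> sq_integrable M"
  shows "integrable M (\<lambda>x. f x * g x)"
  using sq_integrable_inner[OF assms] by (simp add: mult.commute)

lemma norm_add_sq: "(norm (x + y))\<^sup>2 = (norm x)\<^sup>2 + 2 * (x \<bullet> y) + (norm (y::'a::real_inner))\<^sup>2"
  by (simp add: power2_norm_eq_inner inner_add_left inner_add_right inner_commute)

lemma sq_integrable_add:
  assumes "f \<in> sq_integrable M" "g \<in> sq_integrable M"
  shows "(\<lambda>x. f x + g x) \<in> sq_integrable M"
  using sq_integrable_inner[OF assms] assms sq_integrable_measurable[OF assms(1)] sq_integrable_measurable[OF assms(2)]
  by (auto simp: sq_integrable_def norm_add_sq)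

lemma sq_integrable_scaleR:
  assumes "f \<in> sq_integrable M" shows "(\<lambda>x. c *\<^sub>R f x) \<in> sq_integrable M"
  using assms by (auto simp: sq_integrable_def power_mult_distrib)

lemma sq_integrable_cmult:
  fixes f :: "'a \<Rightarrow> real"
  assumes "f \<in> sq_integrable M" shows "(\<lambda>x. c * f x) \<in> sq_integrable M"
  using sq_integrable_scaleR[OF assms] by simp

lemma sq_integrable_diff:
  assumes "f \<in> sq_integrable M" "g \<in> sq_integrable M"
  shows "(\<lambda>x. f x - g x) \<in> sq_integrable M"
  using sq_integrable_add[OF assms(1) sq_integrable_scaleR[OF assms(2), of "-1"]] by simp

lemma sq_integrable_norm: "f \<in> sq_integrable M \<Longrightarrow> (\<lambda>x. norm (f x)) \<in> sq_integrable M"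
  by (auto simp: sq_integrable_def)

lemma sq_integrable_abs:
  fixes f :: "'a \<Rightarrow> real"
  shows "f \<in> sq_integrable M \<Longrightarrow> (\<lambda>x. \<bar>f x\<bar>) \<in> sq_integrable M"
  using sq_integrable_norm[of f M] by simp

lemma sq_integrable_component:
  assumes "f \<in> sq_integrable M" shows "(\<lambda>x. f x \<bullet> b) \<in> sq_integrable M"
proof -
  have "integrable M (\<lambda>x. (norm (f x \<bullet> b))\<^sup>2)"
  proof (rule Bochner_Integration.integrable_bound)
    show "integrable M (\<lambda>x. (norm b)\<^sup>2 * (norm (f x))\<^sup>2)"
      using assms by (auto intro!: sq_integrableD)
    have "(f x \<bullet> b)\<^sup>2 \<le> (norm b)\<^sup>2 * (norm (f x))\<^sup>2" for x
      using power_mono[OF Cauchy_Schwarz_ineq2[of "f x" b], of 2] by (simp add: power_mult_distrib mult.commute)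
    then show "AE x in M. norm ((norm (f x \<bullet> b))\<^sup>2) \<le> norm ((norm b)\<^sup>2 * (norm (f x))\<^sup>2)"
      by auto
  qed (use assms in measurable)
  then show ?thesis using assms by (auto simp: sq_integrable_def)
qed

text \<open>The minimum of a nonnegative quadratic in t. It yields Cauchy-Schwarz, and with A = 0 it
  forces B = 0, which is how the eigenvalue equation is obtained later.\<close>

lemma discriminant_bound:
  fixes A B C :: real
  assumes "\<And>t. 0 \<le> A + 2 * t * B + t\<^sup>2 * C" "0 \<le> C"
  shows "B\<^sup>2 \<le> A * C"
proof (cases "C = 0")
  case True
  have "B = 0"
  proof (rule ccontr)
    assume "B \<noteq> 0"
    \<comment> \<open>For C = 0 the expression is affine in t, and this t gives it the value A - |A|
      - 1 < 0.\<close>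
    then have "2 * (-(\<bar>A\<bar>+1)/(2*B)) * B = -(\<bar>A\<bar>+1)" by (simp add: field_simps)
    then show False
      using assms(1)[of "-(\<bar>A\<bar>+1)/(2*B)"] True by simp
  qed
  then show ?thesis using True by simp
next
  case False
  then show ?thesis
    using assms(1)[of "-B/C"] assms(2) by (simp add: field_simps power2_eq_square)
qed

lemma integral_norm_add_sq:
  assumes "f \<in> sq_integrable M" "g \<in> sq_integrable M"
  shows "(LINT x|M. (norm (f x + g x))\<^sup>2) =
    (LINT x|M. (norm (f x))\<^sup>2) + 2 * (LINT x|M. f x \<bullet> g x) + (LINT x|M. (norm (g x))\<^sup>2)"
  using sq_integrable_inner[OF assms] assms[THEN sq_integrableD] by (simp add: norm_add_sq)

lemma integral_norm_diff_sq:
  assumes "f \<in> sq_integrable M" "g \<in> sq_integrable M"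
  shows "(LINT x|M. (norm (f x - g x))\<^sup>2) =
    (LINT x|M. (norm (f x))\<^sup>2) - 2 * (LINT x|M. f x \<bullet> g x) + (LINT x|M. (norm (g x))\<^sup>2)"
  using integral_norm_add_sq[OF assms(1) sq_integrable_scaleR[OF assms(2), of "-1"]] by simp

lemma Cauchy_Schwarz_integral:
  assumes "f \<in> sq_integrable M" "g \<in> sq_integrable M"
  shows "(LINT x|M. f x \<bullet> g x)\<^sup>2 \<le> (LINT x|M. (norm (f x))\<^sup>2) * (LINT x|M. (norm (g x))\<^sup>2)"
proof (rule discriminant_bound)
  fix t :: real
  have "0 \<le> (LINT x|M. (norm (f x + t *\<^sub>R g x))\<^sup>2)" by simp
  also have "\<dots> = (LINT x|M. (norm (f x))\<^sup>2) + 2 * t * (LINT x|M. f x \<bullet> g x) + t\<^sup>2 * (LINT x|M. (norm (g x))\<^sup>2)"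
    by (subst integral_norm_add_sq) (use assms in \<open>auto intro: sq_integrable_scaleR simp: power_mult_distrib\<close>)
  finally show "0 \<le> \<dots>" .
qed simp

definition L2_norm :: "'a measure \<Rightarrow> ('a \<Rightarrow> 'b::euclidean_space) \<Rightarrow> real" where
  "L2_norm M f = sqrt (LINT x|M. (norm (f x))\<^sup>2)"

lemma L2_norm_nonneg: "0 \<le> L2_norm M f"
  by (simp add: L2_norm_def)

lemma L2_norm_sq: "(L2_norm M f)\<^sup>2 = (LINT x|M. (norm (f x))\<^sup>2)"
  by (simp add: L2_norm_def)

lemma L2_norm_scaleR: "L2_norm M (\<lambda>x. c *\<^sub>R f x) = \<bar>c\<bar> * L2_norm M f"
  by (simp add: L2_norm_def power_mult_distrib real_sqrt_mult)

lemma abs_integral_inner_le: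
  assumes "f \<in> sq_integrable M" "g \<in> sq_integrable M"
  shows "\<bar>LINT x|M. f x \<bullet> g x\<bar> \<le> L2_norm M f * L2_norm M g"
proof (rule power2_le_imp_le)
  show "\<bar>LINT x|M. f x \<bullet> g x\<bar>\<^sup>2 \<le> (L2_norm M f * L2_norm M g)\<^sup>2"
    using Cauchy_Schwarz_integral[OF assms] by (simp add: power_mult_distrib L2_norm_sq)
qed (simp add: L2_norm_nonneg)

lemma abs_integral_mult_le:
  fixes f g :: "'a \<Rightarrow> real"
  assumes "f \<in> sq_integrable M" "g \<in> sq_integrable M"
  shows "\<bar>LINT x|M. f x * g x\<bar> \<le> L2_norm M f * L2_norm M g"
  using abs_integral_inner_le[OF assms] by (simp add: mult.commute)

lemma L2_norm_triangle:
  assumes "f \<in> sq_integrable M" "g \<in> sq_integrable M"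
  shows "L2_norm M (\<lambda>x. f x + g x) \<le> L2_norm M f + L2_norm M g"
proof (rule power2_le_imp_le)
  show "(L2_norm M (\<lambda>x. f x + g x))\<^sup>2 \<le> (L2_norm M f + L2_norm M g)\<^sup>2"
    using abs_integral_inner_le[OF assms]
    by (simp add: L2_norm_sq integral_norm_add_sq[OF assms] power2_sum)
qed (simp add: L2_norm_nonneg)

lemma L2_norm_diff_commute: "L2_norm M (\<lambda>x. f x - g x) = L2_norm M (\<lambda>x. g x - f x)"
  by (simp add: L2_norm_def norm_minus_commute)

lemma L2_norm_triangle_diff:
  assumes "f \<in> sq_integrable M" "g \<in> sq_integrable M" "h \<in> sq_integrable M"
  shows "L2_norm M (\<lambda>x. f x - h x) \<le> L2_norm M (\<lambda>x. f x - g x) + L2_norm M (\<lambda>x. g x - h x)"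
  using L2_norm_triangle[OF sq_integrable_diff[OF assms(1,2)] sq_integrable_diff[OF assms(2,3)]] by simp

lemma L2_norm_le_add_diff:
  assumes "f \<in> sq_integrable M" "g \<in> sq_integrable M"
  shows "L2_norm M f \<le> L2_norm M g + L2_norm M (\<lambda>x. f x - g x)"
  using L2_norm_triangle[OF assms(2) sq_integrable_diff[OF assms]] by simp

lemma L2_norm_tendsto:
  assumes "\<And>n. f n \<in> sq_integrable M" "g \<in> sq_integrable M"
    "(\<lambda>n. L2_norm M (\<lambda>x. f n x - g x)) \<longlonglongrightarrow> 0"
  shows "(\<lambda>n. L2_norm M (f n)) \<longlonglongrightarrow> L2_norm M g"
proof (rule LIM_zero_cancel, rule Lim_null_comparison[OF _ assms(3)], rule always_eventually, rule allI)
  fix n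
  show "norm (L2_norm M (f n) - L2_norm M g) \<le> L2_norm M (\<lambda>x. f n x - g x)"
    using L2_norm_le_add_diff[OF assms(1,2), of n] L2_norm_le_add_diff[OF assms(2,1), of n]
      L2_norm_diff_commute[of M g "f n"] by auto
qed

lemma L2_inner_tendsto:
  assumes "\<And>n. f n \<in> sq_integrable M" "g \<in> sq_integrable M" "h \<in> sq_integrable M"
    "(\<lambda>n. L2_norm M (\<lambda>x. f n x - g x)) \<longlonglongrightarrow> 0"
  shows "(\<lambda>n. LINT x|M. f n x \<bullet> h x) \<longlonglongrightarrow> (LINT x|M. g x \<bullet> h x)"
proof (rule LIM_zero_cancel, rule Lim_null_comparison)
  show "(\<lambda>n. L2_norm M (\<lambda>x. f n x - g x) * L2_norm M h) \<longlonglongrightarrow> 0"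
    using tendsto_mult_right[OF assms(4), of "L2_norm M h"] by simp
  have "\<bar>(LINT x|M. f n x \<bullet> h x) - (LINT x|M. g x \<bullet> h x)\<bar> \<le> L2_norm M (\<lambda>x. f n x - g x) * L2_norm M h" for n
    using abs_integral_inner_le[OF sq_integrable_diff[OF assms(1,2)] assms(3), of n]
      sq_integrable_inner[OF assms(1,3)] sq_integrable_inner[OF assms(2,3)]
    by (simp add: inner_diff_left)
  then show "\<forall>\<^sub>F n in sequentially. norm ((LINT x|M. f n x \<bullet> h x) - (LINT x|M. g x \<bullet> h x))
      \<le> L2_norm M (\<lambda>x. f n x - g x) * L2_norm M h" by simp
qed

text \<open>Integrability of the limit is part of the conclusion, and the bound is asked only from
  index N on, so that eventual estimates can be used.\<close>

lemma Fatou_bound: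
  fixes f :: "nat \<Rightarrow> 'a \<Rightarrow> real"
  assumes g: "g \<in> borel_measurable M" and f: "\<And>i. integrable M (f i)"
    and nn: "\<And>i x. 0 \<le> f i x" and lim: "AE x in M. (\<lambda>i. f i x) \<longlonglongrightarrow> g x"
    and B: "\<And>i. i \<ge> N \<Longrightarrow> (LINT x|M. f i x) \<le> B"
  shows "integrable M g" "(LINT x|M. g x) \<le> B"
proof -
  have B0: "0 \<le> B"
    using order_trans[OF Bochner_Integration.integral_nonneg B[of N]] nn by simp
  have g0: "AE x in M. 0 \<le> g x"
    using lim by eventually_elim (rule LIMSEQ_le_const, use nn in auto)
  have "(\<integral>\<^sup>+x. ennreal (g x) \<partial>M) = (\<integral>\<^sup>+x. liminf (\<lambda>i. ennreal (f (i + N) x)) \<partial>M)"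
  proof (rule nn_integral_cong_AE, use lim in eventually_elim)
    fix x assume "(\<lambda>i. f i x) \<longlonglongrightarrow> g x"
    then have "(\<lambda>i. ennreal (f (i + N) x)) \<longlonglongrightarrow> ennreal (g x)"
      by (intro tendsto_ennrealI LIMSEQ_ignore_initial_segment)
    from lim_imp_Liminf[OF _ this] show "ennreal (g x) = liminf (\<lambda>i. ennreal (f (i + N) x))" by simp
  qed
  also have "\<dots> \<le> liminf (\<lambda>i. \<integral>\<^sup>+x. ennreal (f (i + N) x) \<partial>M)"
    using f by (intro nn_integral_liminf) auto
  also have "\<dots> \<le> liminf (\<lambda>i::nat. ennreal B)"
    by (intro Liminf_mono always_eventually allI)
      (use f nn B in \<open>auto simp: nn_integral_eq_integral intro!: ennreal_leI\<close>)
  also have "\<dots> = ennreal B" by (simp add: Liminf_const)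
  finally have le: "(\<integral>\<^sup>+x. ennreal (g x) \<partial>M) \<le> ennreal B" .
  show i: "integrable M g"
    using le g g0 by (intro integrableI_nonneg) (auto simp: order_le_less_trans ennreal_less_top)
  show "(LINT x|M. g x) \<le> B"
    using le nn_integral_eq_integral[OF i g0] B0 by simp
qed

text \<open>Cauchy-Schwarz against the constant 1, which is square integrable on a finite
  measure.\<close>

lemma (in finite_measure) sq_integrable_L1:
  assumes "f \<in> sq_integrable M"
  shows "integrable M f" "(LINT x|M. norm (f x)) \<le> sqrt (measure M (space M)) * L2_norm M f"
proof -
  have 1: "(\<lambda>x. 1::real) \<in> sq_integrable M" by (simp add: sq_integrable_def)
  have "integrable M (\<lambda>x. norm (f x))"
    using sq_integrable_mult[OF 1 sq_integrable_norm[OF assms]] by simp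
  then show "integrable M f"
    using assms by (simp add: integrable_norm_iff sq_integrable_measurable)
  show "(LINT x|M. norm (f x)) \<le> sqrt (measure M (space M)) * L2_norm M f"
    using abs_integral_mult_le[OF 1 sq_integrable_norm[OF assms]] by (simp add: L2_norm_def)
qed

text \<open>Riesz-Fischer by way of L1: on a finite measure an L2-Cauchy sequence is L1-Cauchy, so a
  subsequence converges almost everywhere. Fatou with one index fixed then turns the Cauchy estimate
  into an estimate of the distance to the limit.\<close>

lemma (in finite_measure) L2_complete:
  assumes s: "\<And>n. s n \<in> sq_integrable M"
    and cauchy: "\<And>e. e > 0 \<Longrightarrow> \<exists>N. \<forall>i\<ge>N. \<forall>j\<ge>N. L2_norm M (\<lambda>x. s i x - s j x) < e"
  shows "\<exists>u\<in>sq_integrable M. (\<lambda>n. L2_norm M (\<lambda>x. s n x - u x)) \<longlonglongrightarrow> 0"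
proof -
  define c where "c = sqrt (measure M (space M)) + 1"
  \<comment> \<open>The summand 1 keeps c positive when the measure is zero.\<close>
  have c: "c > 0" by (simp add: c_def add_nonneg_pos)
  have "\<exists>N. \<forall>i\<ge>N. \<forall>j\<ge>N. (LINT x|M. norm (s i x - s j x)) < e" if e: "e > 0" for e
  proof -
    from cauchy[of "e/c"] e c obtain N where N: "\<And>i j. i \<ge> N \<Longrightarrow> j \<ge> N \<Longrightarrow> L2_norm M (\<lambda>x. s i x - s j x) < e / c"
      by force
    have "(LINT x|M. norm (s i x - s j x)) < e" if "i \<ge> N" "j \<ge> N" for i j
    proof -
      have "(LINT x|M. norm (s i x - s j x)) \<le> sqrt (measure M (space M)) * L2_norm M (\<lambda>x. s i x - s j x)"
        by (intro sq_integrable_L1 sq_integrable_diff s)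
      also have "\<dots> \<le> c * L2_norm M (\<lambda>x. s i x - s j x)"
        by (intro mult_right_mono L2_norm_nonneg) (simp add: c_def)
      also have "\<dots> < c * (e / c)" using N[OF that] c by (intro mult_strict_left_mono)
      finally show ?thesis using c by simp
    qed
    then show ?thesis by blast
  qed
  from cauchy_L1_AE_cauchy_subseq[OF sq_integrable_L1(1)[OF s] this]
  obtain r where r: "strict_mono r" "AE x in M. Cauchy (\<lambda>i. s (r i) x)" by blast
  define u where "u x = lim (\<lambda>i. s (r i) x)" for x
  have meas[measurable]: "\<And>i. s i \<in> borel_measurable M" using s by (auto dest: sq_integrable_measurable)
  have u[measurable]: "u \<in> borel_measurable M" unfolding u_def[abs_def] by measurable
  have lim: "AE x in M. (\<lambda>i. s (r i) x) \<longlonglongrightarrow> u x"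
    using r(2) by eventually_elim (simp add: u_def Cauchy_convergent_iff convergent_LIMSEQ_iff)
  \<comment> \<open>Only the second index runs along the subsequence; r i >= i keeps it beyond
    N.\<close>
  have key: "integrable M (\<lambda>x. (norm (s n x - u x))\<^sup>2) \<and> (LINT x|M. (norm (s n x - u x))\<^sup>2) \<le> e\<^sup>2"
    if N: "\<And>i j. i \<ge> N \<Longrightarrow> j \<ge> N \<Longrightarrow> L2_norm M (\<lambda>x. s i x - s j x) < e" and n: "n \<ge> N" for n N e
  proof -
    have 1: "AE x in M. (\<lambda>i. (norm (s n x - s (r i) x))\<^sup>2) \<longlonglongrightarrow> (norm (s n x - u x))\<^sup>2"
      using lim by eventually_elim (auto intro!: tendsto_intros)
    have 2: "(LINT x|M. (norm (s n x - s (r i) x))\<^sup>2) \<le> e\<^sup>2" if "i \<ge> N" for i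
    proof -
      have "L2_norm M (\<lambda>x. s n x - s (r i) x) < e"
        using n that seq_suble[OF r(1), of i] by (intro N) auto
      then have "(L2_norm M (\<lambda>x. s n x - s (r i) x))\<^sup>2 \<le> e\<^sup>2"
        by (intro power_mono L2_norm_nonneg) auto
      then show ?thesis by (simp add: L2_norm_sq)
    qed
    have 3: "integrable M (\<lambda>x. (norm (s n x - s (r i) x))\<^sup>2)" for i
      by (intro sq_integrableD sq_integrable_diff s)
    have 4: "(\<lambda>x. (norm (s n x - u x))\<^sup>2) \<in> borel_measurable M" by measurable
    show ?thesis using Fatou_bound[OF 4 3 _ 1 2] by simp
  qed
  obtain N1 where N1: "\<And>i j. i \<ge> N1 \<Longrightarrow> j \<ge> N1 \<Longrightarrow> L2_norm M (\<lambda>x. s i x - s j x) < 1"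
    using cauchy[of 1] by auto
  have "(\<lambda>x. s N1 x - u x) \<in> sq_integrable M"
    using key[OF N1 order_refl] by (simp add: sq_integrable_def)
  from sq_integrable_diff[OF s[of N1] this] have uL: "u \<in> sq_integrable M" by simp
  have "(\<lambda>n. L2_norm M (\<lambda>x. s n x - u x)) \<longlonglongrightarrow> 0"
  proof (rule LIMSEQ_I)
    fix e :: real assume e: "e > 0"
    then obtain N where N: "\<And>i j. i \<ge> N \<Longrightarrow> j \<ge> N \<Longrightarrow> L2_norm M (\<lambda>x. s i x - s j x) < e/2"
      using cauchy[of "e/2"] by auto
    have "L2_norm M (\<lambda>x. s n x - u x) \<le> e/2" if "n \<ge> N" for n
      using key[OF N that] e unfolding L2_norm_def by (intro real_le_lsqrt) auto
    then show "\<exists>no. \<forall>n\<ge>no. norm (L2_norm M (\<lambda>x. s n x - u x) - 0) < e"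
      using e by (intro exI[of _ N]) (force simp: L2_norm_nonneg)
  qed
  with uL show ?thesis by blast
qed

lemma (in finite_measure) L2_AE_subseq:
  assumes s: "\<And>n. s n \<in> sq_integrable M" and u: "u \<in> sq_integrable M"
    and lim: "(\<lambda>n. L2_norm M (\<lambda>x. s n x - u x)) \<longlonglongrightarrow> 0"
  shows "\<exists>r::nat\<Rightarrow>nat. strict_mono r \<and> (AE x in M. (\<lambda>n. s (r n) x) \<longlonglongrightarrow> u x)"
proof -
  have "(\<lambda>n. LINT x|M. norm (s n x - u x)) \<longlonglongrightarrow> 0"
  proof (rule Lim_null_comparison[OF always_eventually], rule allI)
    show "norm (LINT x|M. norm (s n x - u x)) \<le> sqrt (measure M (space M)) * L2_norm M (\<lambda>x. s n x - u x)" for n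
      using sq_integrable_L1(2)[OF sq_integrable_diff[OF s u], of n] by simp
    show "(\<lambda>n. sqrt (measure M (space M)) * L2_norm M (\<lambda>x. s n x - u x)) \<longlonglongrightarrow> 0"
      using tendsto_mult_left[OF lim, of "sqrt (measure M (space M))"] by simp
  qed
  then obtain r where "strict_mono r" "AE x in M. (\<lambda>n. s (r n) x - u x) \<longlonglongrightarrow> 0"
    using tendsto_L1_AE_subseq[where u="\<lambda>n x. s n x - u x"] sq_integrable_L1(1)[OF sq_integrable_diff[OF s u]] by blast
  then show ?thesis by (auto intro!: exI[of _ r] simp: LIM_zero_iff)
qed

section \<open>Compact support and extension by zero\<close>

lemma continuous_support_integrable:
  fixes f :: "'a::euclidean_space \<Rightarrow> 'b::euclidean_space"
  assumes "continuous_on UNIV f" "compact K" "\<And>x. x \<notin> K \<Longrightarrow> f x = 0"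
  shows "integrable lborel f"
proof -
  have "integrable lborel (\<lambda>x. indicator K x *\<^sub>R f x)"
    using assms by (intro borel_integrable_compact) (auto intro: continuous_on_subset)
  moreover have "(\<lambda>x. indicator K x *\<^sub>R f x) = f"
    using assms(3) by (auto simp: indicator_def)
  ultimately show ?thesis by simp
qed

lemma borel_measurable_lebesgue_on:
  "f \<in> borel_measurable borel \<Longrightarrow> f \<in> borel_measurable (lebesgue_on \<Omega>)"
  by (intro measurable_restrict_space1 measurable_completion) simp

text \<open>Integrals over the domain become integrals over the whole space, where translation
  invariance is available.\<close>

lemma lebesgue_on_supported:
  fixes f :: "'a::euclidean_space \<Rightarrow> 'b::euclidean_space"
  assumes "\<Omega> \<in> sets lebesgue" "f \<in> borel_measurable borel" "\<And>x. x \<notin> \<Omega> \<Longrightarrow> f x = 0"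
  shows "(LINT x|lebesgue_on \<Omega>. f x) = (LINT x|lborel. f x)"
    "integrable (lebesgue_on \<Omega>) f \<longleftrightarrow> integrable lborel f"
proof -
  have eq: "(\<lambda>x. indicator \<Omega> x *\<^sub>R f x) = f" using assms(3) by (auto simp: indicator_def)
  show "(LINT x|lebesgue_on \<Omega>. f x) = (LINT x|lborel. f x)"
    using assms by (simp add: integral_restrict_space eq integral_completion)
  show "integrable (lebesgue_on \<Omega>) f \<longleftrightarrow> integrable lborel f"
    using assms by (simp add: integrable_restrict_space eq integrable_completion)
qed

lemma Cc1_integrable:
  assumes "f \<in> Cc1"
  shows "integrable lborel f" "integrable lborel (grad f)" "f \<in> sq_integrable lborel" "grad f \<in> sq_integrable lborel"
    "f \<in> borel_measurable borel" "grad f \<in> borel_measurable borel"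
proof -
  note c = Cc1_continuous[OF assms] Cc1_continuous_grad[OF assms]
  from assms obtain K where K: "compact K" "\<And>x. x \<notin> K \<Longrightarrow> f x = 0" by (auto simp: Cc1_def)
  have K2: "\<And>x. x \<notin> K \<Longrightarrow> grad f x = 0"
    using Cc1_grad_support[OF assms compact_imp_closed[OF K(1)] K(2)] by blast
  show m: "f \<in> borel_measurable borel" "grad f \<in> borel_measurable borel"
    using c by (auto intro: borel_measurable_continuous_onI)
  show "integrable lborel f" "integrable lborel (grad f)"
    using continuous_support_integrable[OF c(1) K] continuous_support_integrable[OF c(2) K(1) K2] by auto
  have "integrable lborel (\<lambda>x. (norm (f x))\<^sup>2)" "integrable lborel (\<lambda>x. (norm (grad f x))\<^sup>2)"
    by (rule continuous_support_integrable[OF _ K(1)]; use K(2) K2 c in \<open>auto intro!: continuous_intros\<close>)+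
  then show "f \<in> sq_integrable lborel" "grad f \<in> sq_integrable lborel"
    using m by (auto simp: sq_integrable_def)
qed

lemma test_functions_outside:
  assumes "\<phi> \<in> test_functions \<Omega>" "x \<notin> \<Omega>"
  shows "\<phi> x = 0" "grad \<phi> x = 0"
proof -
  from assms(1) obtain K where K: "compact K" "K \<subseteq> \<Omega>" "\<And>x. x \<notin> K \<Longrightarrow> \<phi> x = 0"
    by (metis test_functionsE)
  then show "\<phi> x = 0" using assms(2) by auto
  show "grad \<phi> x = 0"
    using Cc1_grad_support[OF test_functions_Cc1[OF assms(1)] compact_imp_closed[OF K(1)] K(3)] K(2) assms(2) by blast
qed

lemma test_functions_L2:
  assumes "\<phi> \<in> test_functions \<Omega>" "\<Omega> \<in> sets lebesgue"
  shows "\<phi> \<in> sq_integrable (lebesgue_on \<Omega>)" "grad \<phi> \<in> sq_integrable (lebesgue_on \<Omega>)"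
    "(LINT x|lebesgue_on \<Omega>. (norm (\<phi> x))\<^sup>2) = (LINT x|lborel. (norm (\<phi> x))\<^sup>2)"
    "(LINT x|lebesgue_on \<Omega>. (norm (grad \<phi> x))\<^sup>2) = (LINT x|lborel. (norm (grad \<phi> x))\<^sup>2)"
proof -
  note [measurable] = Cc1_integrable(5,6)[OF test_functions_Cc1[OF assms(1)]]
  note i = Cc1_integrable(3,4)[OF test_functions_Cc1[OF assms(1)]]
  note o = test_functions_outside[OF assms(1)]
  show "\<phi> \<in> sq_integrable (lebesgue_on \<Omega>)" "grad \<phi> \<in> sq_integrable (lebesgue_on \<Omega>)"
    using lebesgue_on_supported(2)[OF assms(2), of "\<lambda>x. (norm (\<phi> x))\<^sup>2"] o
      lebesgue_on_supported(2)[OF assms(2), of "\<lambda>x. (norm (grad \<phi> x))\<^sup>2"] i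
      Cc1_integrable(5,6)[OF test_functions_Cc1[OF assms(1)], THEN borel_measurable_lebesgue_on]
    by (auto simp: sq_integrable_def)
  show "(LINT x|lebesgue_on \<Omega>. (norm (\<phi> x))\<^sup>2) = (LINT x|lborel. (norm (\<phi> x))\<^sup>2)"
    "(LINT x|lebesgue_on \<Omega>. (norm (grad \<phi> x))\<^sup>2) = (LINT x|lborel. (norm (grad \<phi> x))\<^sup>2)"
    using o by (intro lebesgue_on_supported(1)[OF assms(2)]; measurable; simp)+
qed

subsection \<open>Translations and the Faber-Krahn inequality\<close>

lemma lborel_integral_shift:
  fixes f :: "'a::euclidean_space \<Rightarrow> 'b::euclidean_space"
  assumes [measurable]: "f \<in> borel_measurable borel"
  shows "(LINT x|lborel. f (x + h)) = (LINT x|lborel. f x)"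
proof -
  have "(LINT x|lborel. f x) = (LINT x|distr lborel borel ((+) h). f x)"
    by (simp add: lborel_distr_plus)
  also have "\<dots> = (LINT x|lborel. f (h + x))"
    by (rule integral_distr) auto
  finally show ?thesis by (simp add: add.commute)
qed

lemma lborel_integrable_shift:
  fixes f :: "'a::euclidean_space \<Rightarrow> 'b::euclidean_space"
  assumes "integrable lborel f"
  shows "integrable lborel (\<lambda>x. f (x + h))"
proof -
  have "integrable (distr lborel borel ((+) h)) f"
    using assms by (simp add: lborel_distr_plus)
  then have "integrable lborel (\<lambda>x. f (h + x))"
    by (rule integrable_distr[rotated]) auto
  then show ?thesis by (simp add: add.commute)
qed

lemma lborel_nn_integral_shift:
  fixes f :: "'a::euclidean_space \<Rightarrow> ennreal"
  assumes [measurable]: "f \<in> borel_measurable borel"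
  shows "(\<integral>\<^sup>+x. f (x + h) \<partial>lborel) = (\<integral>\<^sup>+x. f x \<partial>lborel)"
proof -
  have "(\<integral>\<^sup>+x. f x \<partial>lborel) = (\<integral>\<^sup>+x. f x \<partial>distr lborel borel ((+) h))"
    by (simp add: lborel_distr_plus)
  also have "\<dots> = (\<integral>\<^sup>+x. f (h + x) \<partial>lborel)"
    by (rule nn_integral_distr) auto
  finally show ?thesis by (simp add: add.commute)
qed

lemma Cc1_lipschitz:
  assumes "f \<in> Cc1"
  obtains M where "M > 0" "\<And>x y. \<bar>f x - f y\<bar> \<le> M * norm (x - y)"
proof -
  from assms obtain K where K: "compact K" "\<And>x. x \<notin> K \<Longrightarrow> f x = 0" by (auto simp: Cc1_def)
  have "compact (grad f ` K)"
    using Cc1_continuous_grad[OF assms] K(1) by (intro compact_continuous_image) (auto intro: continuous_on_subset)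
  then obtain M where M: "M > 0" "\<And>x. x \<in> K \<Longrightarrow> norm (grad f x) \<le> M"
    using compact_imp_bounded[of "grad f ` K"] by (auto simp: bounded_pos)
  then have M': "norm (grad f x) \<le> M" for x
    using Cc1_grad_support[OF assms compact_imp_closed[OF K(1)] K(2), of x] by (cases "x \<in> K") auto
  have "\<bar>f x - f y\<bar> \<le> M * norm (x - y)" for x y
  proof -
    have "norm (f x - f y) \<le> M * norm (x - y)"
    proof (rule differentiable_bound[of UNIV f "\<lambda>x h. grad f x \<bullet> h"])
      show "onorm ((\<bullet>) (grad f z)) \<le> M" for z
      proof (rule onorm_bound)
        show "norm (grad f z \<bullet> y) \<le> M * norm y" for y
          using order_trans[OF Cauchy_Schwarz_ineq2 mult_right_mono[OF M'[of z] norm_ge_zero[of y]]] by simp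
      qed (use M(1) in simp)
    qed (use Cc1_has_grad[OF assms] in auto)
    then show ?thesis by simp
  qed
  with M(1) show ?thesis by (rule that)
qed

text \<open>Difference quotients have integral zero by translation invariance and converge to the
  partial derivative, dominated through the Lipschitz constant. Integration by parts below rests on
  this.\<close>

lemma Cc1_integral_grad:
  assumes "f \<in> Cc1" shows "(LINT x|lborel. grad f x) = 0"
proof (rule euclidean_eqI)
  fix b :: 'a assume b: "b \<in> Basis"
  obtain M where M: "M > 0" "\<And>x y. \<bar>f x - f y\<bar> \<le> M * norm (x - y)"
    by (rule Cc1_lipschitz[OF assms]) blast
  obtain K where K: "compact K" "\<And>x. x \<notin> K \<Longrightarrow> f x = 0" using assms by (auto simp: Cc1_def)
  then obtain R where R: "\<And>x. x \<in> K \<Longrightarrow> norm x \<le> R" "R > 0"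
    using compact_imp_bounded[of K] by (auto simp: bounded_pos)
  define h :: "nat \<Rightarrow> real" where "h n = 1 / real (Suc n)" for n
  have h: "0 < h n" "h n \<le> 1" for n by (auto simp: h_def)
  have h0: "h \<longlonglongrightarrow> 0" unfolding h_def using LIMSEQ_inverse_real_of_nat by (simp add: inverse_eq_divide)
  note [measurable] = Cc1_integrable(5,6)[OF assms]
  have "(\<lambda>n. LINT x|lborel. (f (x + h n *\<^sub>R b) - f x) / h n) \<longlonglongrightarrow> (LINT x|lborel. grad f x \<bullet> b)"
  proof (rule integral_dominated_convergence)
    \<comment> \<open>Radius R + 1 because the shifts h n are at most 1: a shifted point can lie in
      the ball of radius R only if x is within distance 1 of that ball.\<close>
    show "integrable lborel (\<lambda>x. M * indicator (cball (0::'a) (R + 1)) x)"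
      by (intro integrable_mult_right integrable_real_indicator) (use emeasure_compact_finite[OF compact_cball[of "0::'a" "R + 1"]] in auto)
    show "AE x in lborel. (\<lambda>n. (f (x + h n *\<^sub>R b) - f x) / h n) \<longlonglongrightarrow> grad f x \<bullet> b"
    proof (rule AE_I2)
      fix x
      have "((\<lambda>t. f (x + t *\<^sub>R b)) has_derivative (\<lambda>t. grad f (x + 0 *\<^sub>R b) \<bullet> (t *\<^sub>R b))) (at 0)"
        by (rule has_derivative_compose[OF _ Cc1_has_grad[OF assms]]) (auto intro!: derivative_eq_intros)
      then have "((\<lambda>t. f (x + t *\<^sub>R b)) has_real_derivative (grad f x \<bullet> b)) (at 0)"
        by (simp add: has_field_derivative_def mult.commute[of _ "grad f x \<bullet> b"])
      then have "((\<lambda>t. (f (x + t *\<^sub>R b) - f x) / t) \<longlongrightarrow> grad f x \<bullet> b) (at 0)"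
        by (simp add: DERIV_def)
      then show "(\<lambda>n. (f (x + h n *\<^sub>R b) - f x) / h n) \<longlonglongrightarrow> grad f x \<bullet> b"
        by (rule filterlim_compose) (use h h0 in \<open>auto simp: filterlim_at intro!: always_eventually less_imp_neq[symmetric]\<close>)
    qed
    fix n
    show "AE x in lborel. norm ((f (x + h n *\<^sub>R b) - f x) / h n) \<le> M * indicator (cball 0 (R + 1)) x"
    proof (rule AE_I2)
      fix x
      show "norm ((f (x + h n *\<^sub>R b) - f x) / h n) \<le> M * indicator (cball 0 (R + 1)) x"
      proof (cases "norm x \<le> R + 1")
        case True
        then show ?thesis
          using M(2)[of "x + h n *\<^sub>R b" x] h[of n] b M(1) by (simp add: field_simps)
      next
        case False
        have "norm x \<le> norm (x + h n *\<^sub>R b) + norm (h n *\<^sub>R b)"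
          by (metis add_diff_cancel_right' norm_triangle_ineq4)
        then have "R < norm (x + h n *\<^sub>R b)" using False h[of n] b by simp
        then show ?thesis using False K(2)[of x] K(2)[of "x + h n *\<^sub>R b"] R(1)[of x] R(1)[of "x + h n *\<^sub>R b"] R(2)
          by (cases "x \<in> K"; cases "x + h n *\<^sub>R b \<in> K") (auto simp: indicator_def)
      qed
    qed
  qed measurable
  moreover have "(\<lambda>n. LINT x|lborel. (f (x + h n *\<^sub>R b) - f x) / h n) = (\<lambda>n. 0)"
    using Cc1_integrable(1)[OF assms] lborel_integrable_shift[OF Cc1_integrable(1)[OF assms]]
    by (simp add: lborel_integral_shift)
  ultimately have "(LINT x|lborel. grad f x \<bullet> b) = 0"
    using LIMSEQ_unique[OF _ tendsto_const] by simp
  then show "(LINT x|lborel. grad f x) \<bullet> b = 0 \<bullet> b"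
    using Cc1_integrable(2)[OF assms] by simp
qed

text \<open>Fundamental theorem of calculus on the segment from x to x + h, then Jensen. The bound
  is a nonnegative integral, so that Tonelli applies to it without integrability conditions.\<close>

lemma Cc1_shift_pointwise:
  assumes "f \<in> Cc1"
  shows "ennreal ((f (x + h) - f x)\<^sup>2) \<le> (\<integral>\<^sup>+s. indicator {0..1} s * ennreal ((norm h)\<^sup>2 * (norm (grad f (x + s *\<^sub>R h)))\<^sup>2) \<partial>lborel)"
proof -
  define g where "g s = grad f (x + s *\<^sub>R h) \<bullet> h" for s
  define c where "c = f (x + h) - f x"
  have cont: "continuous_on UNIV g"
    unfolding g_def by (intro continuous_intros continuous_on_compose2[OF Cc1_continuous_grad[OF assms]]) auto
  have "(g has_integral (f (x + 1 *\<^sub>R h) - f (x + 0 *\<^sub>R h))) {0..1}"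
  proof (rule fundamental_theorem_of_calculus)
    fix s :: real assume "s \<in> {0..1}"
    have "((\<lambda>t. f (x + t *\<^sub>R h)) has_derivative (\<lambda>t. grad f (x + s *\<^sub>R h) \<bullet> (t *\<^sub>R h))) (at s)"
      by (rule has_derivative_compose[OF _ Cc1_has_grad[OF assms]]) (auto intro!: derivative_eq_intros)
    then show "((\<lambda>t. f (x + t *\<^sub>R h)) has_vector_derivative g s) (at s within {0..1})"
      by (auto simp: has_vector_derivative_def g_def intro: has_derivative_at_withinI)
  qed simp
  then have gi: "(g has_integral c) {0..1}" by (simp add: c_def)
  define I where "I = integral {0..1} (\<lambda>s. (g s)\<^sup>2)"
  have g2: "((\<lambda>s. (g s)\<^sup>2) has_integral I) {0..1}"
    unfolding I_def by (intro integrable_integral integrable_continuous_interval continuous_intros continuous_on_subset[OF cont]) auto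
  \<comment> \<open>Jensen: c is the mean of g over [0, 1], and nonnegativity of the integral of (g
    - c)^2 reads c^2 <= I.\<close>
  have "((\<lambda>s. (g s)\<^sup>2 - 2 * c * g s + c\<^sup>2) has_integral (I - 2 * c * c + c\<^sup>2 * 1)) {0..1}"
    using has_integral_const_real[of "c\<^sup>2" 0 1]
    by (intro has_integral_add has_integral_diff g2 has_integral_mult_right gi) auto
  moreover have "0 \<le> (g s)\<^sup>2 - 2 * c * g s + c\<^sup>2" for s
    using zero_le_power2[of "g s - c"] by (simp add: power2_diff algebra_simps)
  ultimately have "0 \<le> I - 2 * c * c + c\<^sup>2 * 1" by (rule has_integral_nonneg)
  then have "c\<^sup>2 \<le> I" by (simp add: power2_eq_square)
  then have "ennreal (c\<^sup>2) \<le> ennreal I" by (rule ennreal_leI)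
  also have "\<dots> = (\<integral>\<^sup>+s. indicator {0..1} s * (g s)\<^sup>2 \<partial>lborel)"
    by (rule nn_integral_has_integral_lebesgue[symmetric]) (use g2 in auto)
  also have "\<dots> \<le> (\<integral>\<^sup>+s. indicator {0..1} s * ennreal ((norm h)\<^sup>2 * (norm (grad f (x + s *\<^sub>R h)))\<^sup>2) \<partial>lborel)"
  proof (rule nn_integral_mono)
    fix s
    have "(g s)\<^sup>2 \<le> (norm h)\<^sup>2 * (norm (grad f (x + s *\<^sub>R h)))\<^sup>2"
      using power_mono[OF Cauchy_Schwarz_ineq2[of "grad f (x + s *\<^sub>R h)" h], of 2]
      by (simp add: g_def power_mult_distrib mult.commute)
    then show "ennreal (indicator {0..1} s * (g s)\<^sup>2) \<le> indicator {0..1} s * ennreal ((norm h)\<^sup>2 * (norm (grad f (x + s *\<^sub>R h)))\<^sup>2)"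
      by (auto simp: indicator_def intro: ennreal_leI)
  qed
  finally show ?thesis by (simp add: c_def)
qed

text \<open>After the integrals are exchanged, each s contributes a translate of one and the same
  integral.\<close>

lemma Cc1_shift_L2:
  assumes "f \<in> Cc1"
  shows "(LINT x|lborel. (f (x + h) - f x)\<^sup>2) \<le> (norm h)\<^sup>2 * (LINT x|lborel. (norm (grad f x))\<^sup>2)"
proof -
  note [measurable] = Cc1_integrable(5,6)[OF assms]
  define D where "D = (LINT x|lborel. (norm (grad f x))\<^sup>2)"
  have i: "integrable lborel (\<lambda>x. (norm (grad f x))\<^sup>2)"
    using Cc1_integrable(4)[OF assms] by (rule sq_integrableD)
  have sh: "(\<lambda>x. f (x + h)) \<in> sq_integrable lborel"
    using lborel_integrable_shift[OF sq_integrableD[OF Cc1_integrable(3)[OF assms]]] by (auto simp: sq_integrable_def)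
  have i2: "integrable lborel (\<lambda>x. (f (x + h) - f x)\<^sup>2)"
    using sq_integrableD[OF sq_integrable_diff[OF sh Cc1_integrable(3)[OF assms]]] by simp
  have "ennreal (LINT x|lborel. (f (x + h) - f x)\<^sup>2) = (\<integral>\<^sup>+x. ennreal ((f (x + h) - f x)\<^sup>2) \<partial>lborel)"
    by (rule nn_integral_eq_integral[symmetric]) (use i2 in auto)
  also have "\<dots> \<le> (\<integral>\<^sup>+x. \<integral>\<^sup>+s. indicator {0..1} s * ennreal ((norm h)\<^sup>2 * (norm (grad f (x + s *\<^sub>R h)))\<^sup>2) \<partial>(lborel::real measure) \<partial>lborel)"
    by (intro nn_integral_mono Cc1_shift_pointwise assms)
  also have "\<dots> = (\<integral>\<^sup>+s. \<integral>\<^sup>+x. indicator {0..1} s * ennreal ((norm h)\<^sup>2 * (norm (grad f (x + s *\<^sub>R h)))\<^sup>2) \<partial>lborel \<partial>(lborel::real measure))"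
    by (rule lborel_pair.Fubini'[symmetric]) measurable
  also have "\<dots> = (\<integral>\<^sup>+(s::real). indicator {0..1} s * ennreal ((norm h)\<^sup>2 * D) \<partial>lborel)"
  proof (rule nn_integral_cong)
    fix s :: real
    have "(\<integral>\<^sup>+x. indicator {0..1} s * ennreal ((norm h)\<^sup>2 * (norm (grad f (x + s *\<^sub>R h)))\<^sup>2) \<partial>lborel)
      = indicator {0..1} s * (\<integral>\<^sup>+x. ennreal ((norm h)\<^sup>2 * (norm (grad f (x + s *\<^sub>R h)))\<^sup>2) \<partial>lborel)"
      by (rule nn_integral_cmult) measurable
    also have "(\<integral>\<^sup>+x. ennreal ((norm h)\<^sup>2 * (norm (grad f (x + s *\<^sub>R h)))\<^sup>2) \<partial>lborel)
      = (\<integral>\<^sup>+x. ennreal ((norm h)\<^sup>2 * (norm (grad f x))\<^sup>2) \<partial>lborel)"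
      using lborel_nn_integral_shift[of "\<lambda>x. ennreal ((norm h)\<^sup>2 * (norm (grad f x))\<^sup>2)" "s *\<^sub>R h"] by simp
    also have "\<dots> = ennreal (LINT x|lborel. (norm h)\<^sup>2 * (norm (grad f x))\<^sup>2)"
      by (rule nn_integral_eq_integral) (use i in auto)
    finally show "(\<integral>\<^sup>+x. indicator {0..1} s * ennreal ((norm h)\<^sup>2 * (norm (grad f (x + s *\<^sub>R h)))\<^sup>2) \<partial>lborel)
      = indicator {0..1} s * ennreal ((norm h)\<^sup>2 * D)" by (simp add: D_def)
  qed
  also have "\<dots> = ennreal ((norm h)\<^sup>2 * D)"
    by (simp add: nn_integral_multc)
  finally show ?thesis
    by (subst (asm) ennreal_le_iff) (auto simp: D_def)
qed

text \<open>Expanding the square, the shift estimate bounds I - c h from above, where I is the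
  integral of f^2 and c h correlates f with its translate by h. Integration over a cube turns the c
  h into the correlation of f with its local averages. In the cube |h| <= N r, since the norm is at
  most the sum of the coordinates; hence N^2 r^2.\<close>

lemma Cc1_average_inequality:
  fixes f :: "'a::euclidean_space \<Rightarrow> real" and r :: real
  defines "Q \<equiv> cbox (0::'a) (r *\<^sub>R One)"
  assumes f: "f \<in> Cc1" and r: "r > 0"
  shows "r ^ DIM('a) * (LINT x|lborel. (f x)\<^sup>2) \<le>
      r ^ DIM('a) * (real DIM('a))\<^sup>2 * r\<^sup>2 * (LINT x|lborel. (norm (grad f x))\<^sup>2) / 2
      + (LINT x|lborel. f x * (LINT h|lborel. indicator Q h * f (x + h)))"
proof -
  define F where "F x h = f x * (indicator Q h * f (x + h))" for x h
  define I where "I = (LINT x|lborel. (f x)\<^sup>2)"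
  define D where "D = (LINT x|lborel. (norm (grad f x))\<^sup>2)"
  define c where "c h = (LINT x|lborel. f x * f (x + h))" for h
  note [measurable] = Cc1_integrable(5,6)[OF f]
  obtain K where K: "compact K" "\<And>x. x \<notin> K \<Longrightarrow> f x = 0" using f by (auto simp: Cc1_def)
  have intF: "integrable (lborel \<Otimes>\<^sub>M lborel) (\<lambda>(x, h). F x h)"
  proof -
    have "integrable lborel (\<lambda>z. indicator (K \<times> Q) z *\<^sub>R (f (fst z) * f (fst z + snd z)))"
      by (intro borel_integrable_compact compact_Times K continuous_intros continuous_on_compose2[OF Cc1_continuous[OF f]])
        (auto simp: Q_def)
    moreover have "(\<lambda>z. indicator (K \<times> Q) z *\<^sub>R (f (fst z) * f (fst z + snd z))) = (\<lambda>(x, h). F x h)"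
      using K(2) by (auto simp: F_def indicator_def fun_eq_iff)
    ultimately show ?thesis by (simp add: lborel_prod)
  qed
  have Fub: "(LINT h|lborel. LINT x|lborel. F x h) = (LINT x|lborel. LINT h|lborel. F x h)"
    by (rule lborel_pair.Fubini_integral[OF intF])
  have Fx: "(LINT x|lborel. F x h) = indicator Q h * c h" for h
    by (simp add: F_def c_def indicator_def)
  have intc: "integrable lborel (\<lambda>h. indicator Q h * c h)"
    using lborel_pair.integrable_snd[OF intF] by (simp add: Fx)
  have sh: "(\<lambda>x. f (x + h)) \<in> sq_integrable lborel" for h
    using lborel_integrable_shift[OF sq_integrableD[OF Cc1_integrable(3)[OF f]]] by (auto simp: sq_integrable_def)
  have ineq: "I \<le> (real DIM('a))\<^sup>2 * r\<^sup>2 * D / 2 + c h" if h: "h \<in> Q" for h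
  proof -
    have "norm h \<le> (\<Sum>b\<in>Basis. \<bar>h \<bullet> b\<bar>)" by (rule norm_le_l1)
    also have "\<dots> \<le> (\<Sum>b\<in>(Basis::'a set). r)"
      using h by (intro sum_mono) (auto simp: Q_def mem_box)
    finally have "norm h \<le> real DIM('a) * r" by simp
    then have "(norm h)\<^sup>2 \<le> (real DIM('a) * r)\<^sup>2" by (intro power_mono) auto
    then have "(norm h)\<^sup>2 * D \<le> (real DIM('a))\<^sup>2 * r\<^sup>2 * D"
      by (intro mult_right_mono) (auto simp: D_def power_mult_distrib)
    moreover have "(LINT x|lborel. (f (x + h) - f x)\<^sup>2) = 2 * I - 2 * c h"
      using integral_norm_diff_sq[OF sh[of h] Cc1_integrable(3)[OF f]]
        lborel_integral_shift[of "\<lambda>x. (f x)\<^sup>2" h]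
      by (simp add: I_def c_def mult.commute)
    ultimately show ?thesis using Cc1_shift_L2[OF f, of h] by (simp add: D_def)
  qed
  have Qm: "measure lborel Q = r ^ DIM('a)" "emeasure lborel Q < \<infinity>"
    using r by (auto simp: Q_def measure_lborel_cbox_eq emeasure_lborel_cbox_finite)
  have Qi: "integrable lborel (indicator Q :: 'a \<Rightarrow> real)"
    using Qm(2) by (intro integrable_real_indicator) (auto simp: Q_def)
  have "r ^ DIM('a) * I = (LINT h|lborel. indicator Q h * I)"
    using Qm Qi by (simp add: Q_def)
  also have "\<dots> \<le> (LINT h|lborel. indicator Q h * ((real DIM('a))\<^sup>2 * r\<^sup>2 * D / 2) + indicator Q h * c h)"
  proof (rule integral_mono)
    show "integrable lborel (\<lambda>h. indicator Q h * ((real DIM('a))\<^sup>2 * r\<^sup>2 * D / 2) + indicator Q h * c h)"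
      by (intro Bochner_Integration.integrable_add integrable_mult_left Qi intc)
    show "indicator Q h * I \<le> indicator Q h * ((real DIM('a))\<^sup>2 * r\<^sup>2 * D / 2) + indicator Q h * c h" for h
      using ineq by (auto simp: indicator_def)
  qed (intro integrable_mult_left Qi)
  also have "\<dots> = r ^ DIM('a) * ((real DIM('a))\<^sup>2 * r\<^sup>2 * D / 2) + (LINT h|lborel. indicator Q h * c h)"
    using Qm Qi intc by (subst Bochner_Integration.integral_add) (auto simp: Q_def intro!: integrable_mult_left)
  also have "(LINT h|lborel. indicator Q h * c h) = (LINT x|lborel. f x * (LINT h|lborel. indicator Q h * f (x + h)))"
    using Fub by (simp add: Fx) (simp add: F_def)
  finally show ?thesis by (simp add: I_def D_def mult.assoc)
qed

text \<open>The correlation term of \<open>Cc1_average_inequality\<close> is at most the square of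
  the L1 norm of f, which Cauchy-Schwarz bounds by V times the integral of f^2. The cube has volume
  2 V, so this is half of the left side and can be absorbed.\<close>

lemma Faber_Krahn:
  fixes f :: "'a::euclidean_space \<Rightarrow> real"
  assumes f: "f \<in> Cc1" and V: "measure lborel {x. f x \<noteq> 0} \<le> V" "V > 0"
  shows "(LINT x|lborel. (f x)\<^sup>2) \<le>
    (real DIM('a))\<^sup>2 * (2 * V) powr (2 / DIM('a)) * (LINT x|lborel. (norm (grad f x))\<^sup>2)"
proof -
  define A where "A = {x. f x \<noteq> 0}"
  define N where "N = DIM('a)"
  have N: "N > 0" by (simp add: N_def)
  define r where "r = (2 * V) powr (1 / N)"
  have r: "r > 0" using V by (simp add: r_def)
  have rN: "r ^ N = 2 * V"
    using V N by (simp add: r_def powr_realpow[symmetric] powr_powr)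
  have r2: "r\<^sup>2 = (2 * V) powr (2 / N)"
    using V by (simp add: r_def powr_realpow[symmetric] powr_powr)
  define I where "I = (LINT x|lborel. (f x)\<^sup>2)"
  define D where "D = (LINT x|lborel. (norm (grad f x))\<^sup>2)"
  note [measurable] = Cc1_integrable(5,6)[OF f]
  obtain K where K: "compact K" "\<And>x. x \<notin> K \<Longrightarrow> f x = 0" using f by (auto simp: Cc1_def)
  have A[measurable]: "A \<in> sets borel" unfolding A_def by measurable
  have "emeasure lborel A \<le> emeasure lborel K"
    using K by (intro emeasure_mono) (auto simp: A_def intro: borel_compact)
  then have Af: "emeasure lborel A < \<infinity>"
    using emeasure_compact_finite[OF K(1)] by (rule le_less_trans)
  have ind: "(indicator A :: 'a \<Rightarrow> real) \<in> sq_integrable lborel"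
  proof -
    have "(\<lambda>x. (norm (indicator A x :: real))\<^sup>2) = indicator A" by (auto simp: indicator_def)
    then show ?thesis using Af by (auto simp: sq_integrable_def)
  qed
  have ai: "integrable lborel (\<lambda>x. \<bar>f x\<bar>)" using Cc1_integrable(1)[OF f] by (rule integrable_abs)
  define J where "J = (LINT x|lborel. \<bar>f x\<bar>)"
  have J0: "J \<ge> 0" by (simp add: J_def)
  have "J\<^sup>2 \<le> V * I"
  proof -
    have "(\<lambda>x. \<bar>f x\<bar> * indicator A x) = (\<lambda>x. \<bar>f x\<bar>)" by (auto simp: A_def indicator_def)
    then have "J\<^sup>2 \<le> I * (LINT x|lborel. (indicator A x)\<^sup>2)"
      using Cauchy_Schwarz_integral[OF ind sq_integrable_abs[OF Cc1_integrable(3)[OF f]]]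
      by (simp add: J_def I_def mult.commute)
    also have "(\<lambda>x. (indicator A x)\<^sup>2) = (indicator A :: 'a \<Rightarrow> real)" by (auto simp: indicator_def)
    finally have "J\<^sup>2 \<le> I * measure lborel A" by simp
    also have "\<dots> \<le> I * V" using V by (intro mult_left_mono) (auto simp: A_def I_def)
    finally show ?thesis by (simp add: mult.commute)
  qed
  define Q where "Q = cbox (0::'a) (r *\<^sub>R One)"
  define a where "a x = (LINT h|lborel. indicator Q h * f (x + h))" for x
  have aJ: "\<bar>a x\<bar> \<le> J" for x
  proof -
    have sh: "integrable lborel (\<lambda>h. \<bar>f (h + x)\<bar>)" by (rule lborel_integrable_shift[OF ai])
    have "\<bar>a x\<bar> \<le> (LINT h|lborel. \<bar>indicator Q h * f (x + h)\<bar>)" unfolding a_def by (rule integral_abs_bound)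
    also have "\<dots> \<le> (LINT h|lborel. \<bar>f (h + x)\<bar>)"
      by (rule integral_mono_AE') (use sh in \<open>auto simp: indicator_def add.commute\<close>)
    also have "\<dots> = J" unfolding J_def by (rule lborel_integral_shift) measurable
    finally show ?thesis .
  qed
  have "(LINT x|lborel. f x * a x) \<le> (LINT x|lborel. \<bar>f x\<bar> * J)"
  proof (rule integral_mono_AE')
    show "AE x in lborel. f x * a x \<le> \<bar>f x\<bar> * J"
    proof (rule AE_I2)
      fix x
      have "f x * a x \<le> \<bar>f x\<bar> * \<bar>a x\<bar>" using abs_ge_self[of "f x * a x"] by (simp add: abs_mult)
      also have "\<dots> \<le> \<bar>f x\<bar> * J" using aJ by (intro mult_left_mono) auto
      finally show "f x * a x \<le> \<bar>f x\<bar> * J" .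
    qed
  qed (use ai J0 in auto)
  also have "\<dots> = J\<^sup>2" using ai by (simp add: J_def power2_eq_square)
  finally have "2 * V * I \<le> 2 * V * (real N)\<^sup>2 * r\<^sup>2 * D / 2 + V * I"
    using Cc1_average_inequality[OF f r] \<open>J\<^sup>2 \<le> V * I\<close>
    by (simp add: I_def D_def a_def Q_def N_def[symmetric] rN)
  then have "V * I \<le> V * ((real N)\<^sup>2 * r\<^sup>2 * D)" by (simp add: algebra_simps)
  then have "I \<le> (real N)\<^sup>2 * r\<^sup>2 * D" using V by simp
  then show ?thesis by (simp add: I_def D_def r2 N_def)
qed

subsection \<open>The Sobolev inequality for smooth functions\<close>

definition pos_sq :: "real \<Rightarrow> real" where "pos_sq s = (max 0 s)\<^sup>2"

lemma pos_sq_has_derivative: "(pos_sq has_real_derivative 2 * max 0 s) (at s)"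
proof -
  consider "s < 0" | "s = 0" | "s > 0" by linarith
  then show ?thesis
  proof cases
    case 1
    have "(pos_sq has_real_derivative 0) (at s)"
      by (rule has_field_derivative_transform_within_open[of "\<lambda>_. 0" 0 s "{..<0}"]) (use 1 in \<open>auto simp: pos_sq_def\<close>)
    then show ?thesis using 1 by simp
  next
    case 2
    have "((\<lambda>h. (pos_sq (0 + h) - pos_sq 0) / h) \<longlongrightarrow> 0) (at 0)"
    proof (rule Lim_null_comparison)
      show "((\<lambda>h. \<bar>h\<bar>) \<longlongrightarrow> (0::real)) (at 0)" by (auto intro!: tendsto_eq_intros)
      show "\<forall>\<^sub>F h in at 0. norm ((pos_sq (0 + h) - pos_sq 0) / h) \<le> \<bar>h\<bar>"
      proof (rule always_eventually, rule allI)
        fix h :: real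
        show "norm ((pos_sq (0 + h) - pos_sq 0) / h) \<le> \<bar>h\<bar>"
          by (cases "h \<le> 0") (simp_all add: pos_sq_def power2_eq_square)
      qed
    qed
    then show ?thesis using 2 by (simp add: DERIV_def)
  next
    case 3
    have "((\<lambda>s. s\<^sup>2) has_real_derivative 2 * s) (at s)" by (auto intro!: derivative_eq_intros)
    then have "(pos_sq has_real_derivative 2 * s) (at s)"
      by (rule has_field_derivative_transform_within_open[of _ _ _ "{0<..}"]) (use 3 in \<open>auto simp: pos_sq_def\<close>)
    then show ?thesis using 3 by simp
  qed
qed

text \<open>A second difference of \<^const>\<open>pos_sq\<close>: constant outside \<open>[1, 2]\<close>, and its derivative is a tent.\<close>

definition smooth_step :: "real \<Rightarrow> real" where
  "smooth_step s = pos_sq (s - 1) - 2 * pos_sq (s - 3/2) + pos_sq (s - 2)"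

definition smooth_step' :: "real \<Rightarrow> real" where
  "smooth_step' s = 2 * max 0 (s - 1) - 4 * max 0 (s - 3/2) + 2 * max 0 (s - 2)"

lemma smooth_step_has_derivative: "(smooth_step has_real_derivative smooth_step' s) (at s)"
  unfolding smooth_step_def[abs_def] smooth_step'_def
  by (auto intro!: derivative_eq_intros DERIV_chain2[OF pos_sq_has_derivative])

lemma smooth_step_eq_0: "smooth_step s = 0 \<longleftrightarrow> s \<le> 1"
proof -
  have "s \<le> 1 \<Longrightarrow> smooth_step s = 0" by (simp add: smooth_step_def pos_sq_def)
  moreover have "smooth_step s > 0" if "1 < s" "s \<le> 3/2"
  proof -
    have "max 0 (s - 1) = s - 1" "max 0 (s - 3/2) = 0" "max 0 (s - 2) = 0" using that by auto
    then show ?thesis using that by (simp add: smooth_step_def pos_sq_def)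
  qed
  moreover have "smooth_step s > 0" if "3/2 < s" "s \<le> 2"
  proof -
    have "(s - 1)\<^sup>2 - 2 * (s - 3/2)\<^sup>2 = 1/2 - (2 - s)\<^sup>2" by (simp add: power2_eq_square algebra_simps)
    moreover have "(2 - s)\<^sup>2 \<le> (1/2)\<^sup>2" using that by (intro power_mono) auto
    moreover have "(1/2)\<^sup>2 < (1/2::real)" by (simp add: power2_eq_square)
    ultimately have "2 * (s - 3/2)\<^sup>2 < (s - 1)\<^sup>2" by linarith
    moreover have "max 0 (s - 1) = s - 1" "max 0 (s - 3/2) = s - 3/2" "max 0 (s - 2) = 0" using that by auto
    ultimately show ?thesis by (simp add: smooth_step_def pos_sq_def)
  qed
  moreover have "smooth_step s = 1/2" if "2 < s"
    using that by (simp add: smooth_step_def pos_sq_def max_def power2_eq_square algebra_simps)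
  \<comment> \<open>Positive on each of the three pieces beyond 1, zero up to 1; hence the
    equivalence.\<close>
  ultimately show ?thesis by (metis less_eq_real_def linorder_not_less zero_less_divide_1_iff zero_less_numeral less_numeral_extra(3))
qed

lemma smooth_step_eq_half: "s \<ge> 2 \<Longrightarrow> smooth_step s = 1/2"
  by (simp add: smooth_step_def pos_sq_def max_def power2_eq_square algebra_simps)

lemma smooth_step'_bounds: "\<bar>smooth_step' s\<bar> \<le> 1" "s \<le> 1 \<or> s > 2 \<Longrightarrow> smooth_step' s = 0"
  by (auto simp: smooth_step'_def max_def)

lemma Cc1_truncate:
  assumes "u \<in> Cc1" "t > 0"
  shows "(\<lambda>x. t * smooth_step (u x / t)) \<in> Cc1"
    "grad (\<lambda>x. t * smooth_step (u x / t)) x = smooth_step' (u x / t) *\<^sub>R grad u x"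
proof -
  have *: "((\<lambda>x. t * smooth_step (u x / t)) has_derivative (\<lambda>h. (smooth_step' (u x / t) *\<^sub>R grad u x) \<bullet> h)) (at x)" for x
  proof -
    have "((\<lambda>x. u x / t) has_derivative (\<lambda>h. (grad u x \<bullet> h) / t)) (at x)"
      using has_derivative_mult_left[OF Cc1_has_grad[OF assms(1), of x], of "1/t"] by simp
    from has_derivative_mult_right[OF has_derivative_compose[OF this smooth_step_has_derivative[unfolded has_field_derivative_def]], of t]
    show ?thesis using assms(2) by simp
  qed
  obtain K where K: "compact K" "\<And>x. x \<notin> K \<Longrightarrow> u x = 0" using assms by (auto simp: Cc1_def)
  show "(\<lambda>x. t * smooth_step (u x / t)) \<in> Cc1"
  proof (rule Cc1I[OF * _ K(1)])
    show "continuous_on UNIV (\<lambda>x. smooth_step' (u x / t) *\<^sub>R grad u x)"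
      unfolding smooth_step'_def using assms(2)
      by (intro continuous_intros Cc1_continuous[OF assms(1)] Cc1_continuous_grad[OF assms(1)]) auto
  qed (use K(2) smooth_step_eq_0[of 0] in auto)
  show "grad (\<lambda>x. t * smooth_step (u x / t)) x = smooth_step' (u x / t) *\<^sub>R grad u x"
    by (rule grad_eqI[OF *])
qed

lemma Cc1_superlevel_finite:
  assumes "u \<in> Cc1" "t \<ge> 0"
  shows "emeasure lborel {x. t < u x} < \<infinity>" "{x. t < u x} \<in> sets borel"
proof -
  note [measurable] = Cc1_integrable(5)[OF assms(1)]
  obtain K where K: "compact K" "\<And>x. x \<notin> K \<Longrightarrow> u x = 0" using assms by (auto simp: Cc1_def)
  show m: "{x. t < u x} \<in> sets borel" by measurable
  have "emeasure lborel {x. t < u x} \<le> emeasure lborel K"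
    using K assms(2) by (intro emeasure_mono) (force intro: borel_compact)+
  then show "emeasure lborel {x. t < u x} < \<infinity>"
    using emeasure_compact_finite[OF K(1)] by (rule le_less_trans)
qed

text \<open>Faber-Krahn for the truncation t \<open>smooth_step\<close> (u / t): it vanishes off {u
  > t}, equals t/2 where u >= 2 t, and its gradient is at most that of u in the shell t < u <= 2 t
  and zero elsewhere. The factor 4 undoes the square in the plateau height t/2.\<close>

lemma level_set_bound:
  fixes u :: "'a::euclidean_space \<Rightarrow> real"
  assumes u: "u \<in> Cc1" and t: "t > 0"
  shows "t\<^sup>2 * measure lborel {x. 2 * t < u x} \<le>
    4 * (real DIM('a))\<^sup>2 * (2 * measure lborel {x. t < u x}) powr (2 / DIM('a)) *
      (LINT x|lborel. indicator {x. t < u x \<and> u x \<le> 2 * t} x * (norm (grad u x))\<^sup>2)"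
\<comment> \<open>\<open>Faber_Krahn\<close> asks for V > 0, so the null case is separate.\<close>
proof (cases "measure lborel {x. t < u x} = 0")
  case True
  note s = Cc1_superlevel_finite[OF u]
  have "measure lborel {x. 2 * t < u x} \<le> measure lborel {x. t < u x}"
    using t s[of t] s[of "2 * t"] by (intro measure_mono_fmeasurable) (auto simp: fmeasurable_def)
  then have "measure lborel {x. 2 * t < u x} = 0" using True measure_nonneg[of lborel "{x. 2 * t < u x}"] by linarith
  then show ?thesis using True by simp
next
  case False
  define f where "f x = t * smooth_step (u x / t)" for x
  have fC: "f \<in> Cc1" unfolding f_def by (rule Cc1_truncate(1)[OF u t])
  have gf: "grad f x = smooth_step' (u x / t) *\<^sub>R grad u x" for x unfolding f_def by (rule Cc1_truncate(2)[OF u t])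
  note s = Cc1_superlevel_finite[OF u]
  note [measurable] = Cc1_integrable(5,6)[OF u]
  have supp: "{x. f x \<noteq> 0} = {x. t < u x}" using t by (auto simp: f_def smooth_step_eq_0)
  define V where "V = measure lborel {x. t < u x}"
  have V: "V > 0" using False measure_nonneg[of lborel "{x. t < u x}"] by (simp add: V_def less_le)
  have FK: "(LINT x|lborel. (f x)\<^sup>2) \<le>
    (real DIM('a))\<^sup>2 * (2 * V) powr (2 / DIM('a)) * (LINT x|lborel. (norm (grad f x))\<^sup>2)"
    using V by (intro Faber_Krahn fC) (auto simp: supp V_def)
  have i: "integrable lborel (\<lambda>x. (norm (grad u x))\<^sup>2)"
    using Cc1_integrable(4)[OF u] by (rule sq_integrableD)
  have ii: "integrable lborel (\<lambda>x. indicator {x. t < u x \<and> u x \<le> 2 * t} x * (norm (grad u x))\<^sup>2)"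
    by (rule Bochner_Integration.integrable_bound[OF i]) (auto simp: indicator_def)
  have "(LINT x|lborel. (norm (grad f x))\<^sup>2) \<le> (LINT x|lborel. indicator {x. t < u x \<and> u x \<le> 2 * t} x * (norm (grad u x))\<^sup>2)"
  proof (rule integral_mono[OF _ ii])
    show "integrable lborel (\<lambda>x. (norm (grad f x))\<^sup>2)"
      using Cc1_integrable(4)[OF fC] by (rule sq_integrableD)
    fix x
    show "(norm (grad f x))\<^sup>2 \<le> indicator {x. t < u x \<and> u x \<le> 2 * t} x * (norm (grad u x))\<^sup>2"
    proof (cases "t < u x \<and> u x \<le> 2 * t")
      case True
      have "(smooth_step' (u x / t))\<^sup>2 \<le> 1" using smooth_step'_bounds(1)[of "u x / t"] abs_square_le_1 by blast
      then show ?thesis using True by (simp add: gf power_mult_distrib mult_left_le_one_le)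
    next
      case False
      then have "smooth_step' (u x / t) = 0" using t by (intro smooth_step'_bounds(2)) (auto simp: field_simps)
      then show ?thesis by (simp add: gf)
    qed
  qed
  then have le: "(LINT x|lborel. (f x)\<^sup>2) \<le> (real DIM('a))\<^sup>2 * (2 * V) powr (2 / DIM('a)) *
      (LINT x|lborel. indicator {x. t < u x \<and> u x \<le> 2 * t} x * (norm (grad u x))\<^sup>2)"
    using FK by (elim order_trans) (intro mult_left_mono; simp)
  have "t\<^sup>2 / 4 * measure lborel {x. 2 * t < u x} = (LINT x|lborel. t\<^sup>2 / 4 * indicator {x. 2 * t < u x} x)"
    using s[of "2 * t"] t by simp
  also have "\<dots> \<le> (LINT x|lborel. (f x)\<^sup>2)"
  proof (rule integral_mono)
    show "integrable lborel (\<lambda>x. t\<^sup>2 / 4 * indicator {x. 2 * t < u x} x)"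
      using s[of "2 * t"] t by (intro integrable_mult_right integrable_real_indicator) auto
    show "integrable lborel (\<lambda>x. (f x)\<^sup>2)" using sq_integrableD[OF Cc1_integrable(3)[OF fC]] by simp
    show "t\<^sup>2 / 4 * indicator {x. 2 * t < u x} x \<le> (f x)\<^sup>2" for x
    proof (cases "2 * t < u x")
      case True
      then have "2 \<le> u x / t" using t by (simp add: field_simps)
      then show ?thesis using True by (simp add: f_def smooth_step_eq_half power_divide)
    qed simp
  qed
  finally have "t\<^sup>2 / 4 * measure lborel {x. 2 * t < u x} \<le> \<dots>" .
  from order_trans[OF this le] show ?thesis by (simp add: V_def)
qed

text \<open>A value between 2 \<epsilon> 2^k and 4 \<epsilon> 2^k is dominated by the k-th summand
  alone. Values up to 2 \<epsilon> fall under the first term, which disappears as \<epsilon> tends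
  to 0.\<close>

lemma dyadic_pointwise:
  fixes y \<epsilon> p :: real
  assumes "\<epsilon> > 0" "p > 0" "y \<le> 2 * \<epsilon> * 2 ^ K"
  shows "(max 0 y) powr p \<le> (2 * \<epsilon>) powr p * indicator {0<..} y +
     (\<Sum>k<K. (4 * (\<epsilon> * 2 ^ k)) powr p * indicator {2 * (\<epsilon> * 2 ^ k)<..} y)"
  using assms(3)
proof (induction K)
  case 0
  then show ?case using assms by (cases "y > 0") (auto intro: powr_mono2)
next
  case (Suc K)
  show ?case
  proof (cases "y \<le> 2 * \<epsilon> * 2 ^ K")
    case True
    have "0 \<le> (4 * (\<epsilon> * 2 ^ K)) powr p * indicator {2 * (\<epsilon> * 2 ^ K)<..} y" by simp
    then show ?thesis using Suc.IH[OF True] unfolding sum.lessThan_Suc by linarith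
  next
    case False
    have y0: "y > 0" using False assms(1) by (smt (verit) mult_pos_pos zero_less_power)
    have "(max 0 y) powr p \<le> (4 * (\<epsilon> * 2 ^ K)) powr p"
      using Suc.prems y0 assms by (intro powr_mono2) auto
    also have "\<dots> = (4 * (\<epsilon> * 2 ^ K)) powr p * indicator {2 * (\<epsilon> * 2 ^ K)<..} y"
      using False by (simp add: mult_ac)
    finally have "(max 0 y) powr p \<le> \<dots>" .
    moreover have "0 \<le> (2 * \<epsilon>) powr p * indicator {0<..} y" by simp
    moreover have "0 \<le> (\<Sum>k<K. (4 * (\<epsilon> * 2 ^ k)) powr p * indicator {2 * (\<epsilon> * 2 ^ k)<..} y)"
      by (intro sum_nonneg) simp
    ultimately show ?thesis unfolding sum.lessThan_Suc by linarith
  qed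
qed

text \<open>Because the shells are disjoint, the gradient energies collected on all of them add up
  to at most the whole Dirichlet energy.\<close>

lemma dyadic_indicator_sum:
  fixes y \<epsilon> :: real
  assumes "\<epsilon> > 0"
  shows "(\<Sum>k<K. indicator {\<epsilon> * 2 ^ k <.. 2 * (\<epsilon> * 2 ^ k)} y) = (indicator {\<epsilon> <.. \<epsilon> * 2 ^ K} y :: real)"
proof (induction K)
  case (Suc K)
  define c where "c = \<epsilon> * 2 ^ K"
  have c: "\<epsilon> \<le> c" "\<epsilon> * 2 ^ Suc K = 2 * c" using assms by (auto simp: c_def)
  have "(\<Sum>k<Suc K. indicator {\<epsilon> * 2 ^ k <.. 2 * (\<epsilon> * 2 ^ k)} y) =
    (indicator {\<epsilon> <.. c} y + indicator {c <.. 2 * c} y :: real)"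
    unfolding sum.lessThan_Suc Suc.IH by (simp add: c_def)
  also have "\<dots> = indicator {\<epsilon> <.. 2 * c} y" using c(1) assms by (auto simp: indicator_def)
  finally show ?case by (simp only: c(2))
qed simp

text \<open>With \<theta> = 2/N the second identity reads p \<theta> = p - 2, the scaling relation
  that closes the recursion over levels. The third yields the exponent p/2 of the energy in the
  Sobolev inequality.\<close>

lemma crit_exp_props:
  assumes "N \<ge> 3"
  shows "crit_exp N > 2" "crit_exp N * (2 / N) = crit_exp N - 2" "1 + 2 / (real N - 2) = crit_exp N / 2"
  using assms by (auto simp: crit_exp_def field_simps)

text \<open>Put b(t) = t^p |{u > t}|, and let e(t) be the energy in the shell t < u <= 2 t. The
  level set bound becomes b(2 t) <= C b(t)^\<theta> e(t). The supremum W of b is finite because u is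
  bounded, so W <= C W^\<theta> D bounds W^\<theta> by a power of C D. This is used for the factor
  b(t)^\<theta> only; the energies e(t) are kept and summed over the disjoint dyadic shells.\<close>

lemma Sobolev_pos_part:
  assumes N: "DIM('a::euclidean_space) \<ge> 3"
  shows "\<exists>C>0. \<forall>u\<in>(Cc1 :: ('a \<Rightarrow> real) set).
    (LINT x|lborel. (max 0 (u x)) powr crit_exp DIM('a)) \<le>
      C * (LINT x|lborel. (norm (grad u x))\<^sup>2) powr (crit_exp DIM('a) / 2)"
proof -
  define N where "N = real DIM('a)"
  have N3: "N \<ge> 3" using N by (simp add: N_def)
  define p where "p = crit_exp DIM('a)"
  define \<theta> where "\<theta> = 2 / N"
  have \<theta>: "0 < \<theta>" "\<theta> < 1" using N3 by (auto simp: \<theta>_def)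
  have p: "p > 2" "p * \<theta> = p - 2" "1 + 2 / (N - 2) = p / 2"
    using crit_exp_props[OF N] by (auto simp: p_def \<theta>_def N_def)
  have \<theta>': "\<theta> / (1 - \<theta>) = 2 / (N - 2)" using N3 by (simp add: \<theta>_def field_simps)
  \<comment> \<open>2^p comes from (2 t)^p in b (2 t), the rest from \<open>level_set_bound\<close>,
    with the 2 inside its power split off.\<close>
  define C where "C = 2 powr p * (4 * N\<^sup>2 * 2 powr \<theta>)"
  have C: "C > 0" using N3 by (simp add: C_def)
  have main: "(LINT x|lborel. (max 0 (u x)) powr p) \<le> 2 powr p * C * C powr (2 / (N - 2)) *
      (LINT x|lborel. (norm (grad u x))\<^sup>2) powr (p / 2)" if u: "u \<in> Cc1" for u :: "'a \<Rightarrow> real"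
  proof -
    define D where "D = (LINT x|lborel. (norm (grad u x))\<^sup>2)"
    have D0: "D \<ge> 0" by (simp add: D_def)
    define a where "a t = measure lborel {x. t < u x}" for t
    define e where "e t = (LINT x|lborel. indicator {x. t < u x \<and> u x \<le> 2 * t} x * (norm (grad u x))\<^sup>2)" for t
    define b where "b t = t powr p * a t" for t
    have a0: "a t \<ge> 0" for t by (simp add: a_def)
    have b0: "b t \<ge> 0" for t by (simp add: b_def a0)
    note [measurable] = Cc1_integrable(5,6)[OF u]
    note s = Cc1_superlevel_finite[OF u]
    have i: "integrable lborel (\<lambda>x. (norm (grad u x))\<^sup>2)"
      using Cc1_integrable(4)[OF u] by (rule sq_integrableD)
    have ie: "integrable lborel (\<lambda>x. indicator {x. t < u x \<and> u x \<le> 2 * t} x * (norm (grad u x))\<^sup>2)" for t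
      by (rule Bochner_Integration.integrable_bound[OF i]) (auto simp: indicator_def)
    have e0: "e t \<ge> 0" for t unfolding e_def by (intro Bochner_Integration.integral_nonneg) auto
    have eD: "e t \<le> D" for t unfolding e_def D_def
      by (intro integral_mono ie i) (auto simp: indicator_def)
    obtain K where K: "compact K" "\<And>x. x \<notin> K \<Longrightarrow> u x = 0" using u by (auto simp: Cc1_def)
    have "compact (u ` K)" using Cc1_continuous[OF u] K(1) by (intro compact_continuous_image) (auto intro: continuous_on_subset)
    then obtain m where m: "m > 0" "\<And>x. x \<in> K \<Longrightarrow> \<bar>u x\<bar> \<le> m"
      using compact_imp_bounded[of "u ` K"] by (auto simp: bounded_pos)
    then have um: "u x \<le> m" for x using K(2)[of x] by (cases "x \<in> K") force+
    have amono: "a t \<le> a t'" if "0 \<le> t'" "t' \<le> t" for t t'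
      unfolding a_def using that s[of t] s[of t'] by (intro measure_mono_fmeasurable) (auto simp: fmeasurable_def)
    \<comment> \<open>Multiplication by t^(p-2) turns t^2 into t^p on the left; on the right t^(p-2)
      = (t^p)^\<theta> completes a t to b t.\<close>
    have step: "b (2 * t) \<le> C * b t powr \<theta> * e t" if t: "t > 0" for t
    proof -
      have "t\<^sup>2 * a (2 * t) \<le> 4 * N\<^sup>2 * (2 * a t) powr \<theta> * e t"
        using level_set_bound[OF u t] by (simp add: a_def e_def \<theta>_def N_def)
      then have "t powr (p - 2) * 2 powr p * (t\<^sup>2 * a (2 * t)) \<le> t powr (p - 2) * 2 powr p * (4 * N\<^sup>2 * (2 * a t) powr \<theta> * e t)"
        by (intro mult_left_mono) auto
      moreover have "t powr (p - 2) * t\<^sup>2 = t powr p"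
        using t by (simp add: powr_diff powr_numeral)
      then have "b (2 * t) = t powr (p - 2) * 2 powr p * (t\<^sup>2 * a (2 * t))"
        using t by (simp add: b_def powr_mult mult_ac)
      moreover have "t powr (p - 2) = (t powr p) powr \<theta>" by (simp add: powr_powr p)
      then have "C * b t powr \<theta> * e t = t powr (p - 2) * 2 powr p * (4 * N\<^sup>2 * (2 * a t) powr \<theta> * e t)"
        using t a0[of t] by (simp add: b_def C_def powr_mult mult_ac)
      ultimately show ?thesis by linarith
    qed
    \<comment> \<open>This bound depends on u through m and the support. It only makes the supremum
      W finite and does not enter the constant.\<close>
    have bbound: "b t \<le> m powr p * a 0" if "t > 0" for t
    proof (cases "t < m")
      case True
      then show ?thesis unfolding b_def using that amono[of 0 t] p by (intro mult_mono powr_mono2 a0) auto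
    next
      case False
      then have "{x. t < u x} = {}" using um by (auto simp: not_less intro: order_trans)
      then show ?thesis using a0 by (simp add: b_def a_def)
    qed
    define W where "W = (SUP t\<in>{0<..}. b t)"
    have bdd: "bdd_above (b ` {0<..})" using bbound by (auto intro!: bdd_aboveI2)
    have bW: "b t \<le> W" if "t > 0" for t unfolding W_def using that by (intro cSUP_upper bdd) auto
    have W0: "W \<ge> 0" using bW[of 1] b0[of 1] by simp
    have step2: "b (2 * t) \<le> C * W powr \<theta> * e t" if "t > 0" for t
      using step[OF that] bW[OF that] b0[of t] C e0[of t] \<theta>
      by (elim order_trans) (intro mult_right_mono mult_left_mono powr_mono2; simp)
    have "W \<le> C * W powr \<theta> * D"
      unfolding W_def
    proof (rule cSUP_least)
      fix t :: real assume "t \<in> {0<..}"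
      then have "b t \<le> C * W powr \<theta> * e (t/2)" using step2[of "t/2"] by simp
      also have "\<dots> \<le> C * W powr \<theta> * D" using C by (intro mult_left_mono eD) auto
      finally show "b t \<le> C * (SUP t\<in>{0<..}. b t) powr \<theta> * D" by (simp add: W_def)
    qed auto
    \<comment> \<open>For W > 0 division gives W^(1-\<theta>) <= C D, and the power \<theta> / (1 -
      \<theta>) = 2 / (N - 2) of this is the claim.\<close>
    have WZ: "W powr \<theta> \<le> (C * D) powr (2 / (N - 2))"
    proof (cases "W = 0")
      case False
      then have Wp: "W > 0" using W0 by simp
      have "W powr (1 - \<theta>) * W powr \<theta> \<le> (C * D) * W powr \<theta>"
        using \<open>W \<le> C * W powr \<theta> * D\<close> Wp by (simp add: powr_add[symmetric] mult_ac)
      then have "W powr (1 - \<theta>) \<le> C * D" using Wp by simp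
      then have "(W powr (1 - \<theta>)) powr (\<theta> / (1 - \<theta>)) \<le> (C * D) powr (\<theta> / (1 - \<theta>))"
        using \<theta> by (intro powr_mono2) auto
      then show ?thesis using \<theta> by (simp add: powr_powr \<theta>'[symmetric])
    qed simp
    define Z where "Z = (C * D) powr (2 / (N - 2))"
    have Z0: "Z \<ge> 0" by (simp add: Z_def)
    have eps: "(LINT x|lborel. (max 0 (u x)) powr p) \<le> (2 * \<epsilon>) powr p * a 0 + 2 powr p * C * Z * D" if \<epsilon>: "\<epsilon> > 0" for \<epsilon>
    proof -
      obtain k where k: "m / (2 * \<epsilon>) < 2 ^ k" using real_arch_pow[of 2 "m / (2 * \<epsilon>)"] by auto
      have uk: "u x \<le> 2 * \<epsilon> * 2 ^ k" for x
        using um[of x] k \<epsilon> by (simp add: field_simps)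
      define g where "g x = (2 * \<epsilon>) powr p * indicator {x. 0 < u x} x +
        (\<Sum>j<k. (4 * (\<epsilon> * 2 ^ j)) powr p * indicator {x. 2 * (\<epsilon> * 2 ^ j) < u x} x)" for x
      have ind: "integrable lborel (indicator {x. t < u x} :: 'a \<Rightarrow> real)" if "t \<ge> 0" for t
        using s[OF that] by (intro integrable_real_indicator) auto
      have gi: "integrable lborel g"
        unfolding g_def using \<epsilon> by (intro Bochner_Integration.integrable_add integrable_mult_right Bochner_Integration.integrable_sum ind) auto
      have "(LINT x|lborel. (max 0 (u x)) powr p) \<le> (LINT x|lborel. g x)"
      proof (rule integral_mono_AE'[OF gi])
        show "AE x in lborel. (max 0 (u x)) powr p \<le> g x"
        proof (rule AE_I2)
          fix x
          show "(max 0 (u x)) powr p \<le> g x"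
            using dyadic_pointwise[OF \<epsilon> _ uk[of x], of p] p by (simp add: g_def indicator_def)
        qed
      qed (auto simp: g_def intro!: AE_I2 add_nonneg_nonneg sum_nonneg)
      also have "\<dots> = (2 * \<epsilon>) powr p * a 0 + (\<Sum>j<k. (4 * (\<epsilon> * 2 ^ j)) powr p * a (2 * (\<epsilon> * 2 ^ j)))"
      proof -
        have "(LINT x|lborel. (\<Sum>j<k. (4 * (\<epsilon> * 2 ^ j)) powr p * indicator {x. 2 * (\<epsilon> * 2 ^ j) < u x} x)) =
          (\<Sum>j<k. (4 * (\<epsilon> * 2 ^ j)) powr p * a (2 * (\<epsilon> * 2 ^ j)))"
          using \<epsilon> s(2) by (subst Bochner_Integration.integral_sum) (auto simp: a_def intro!: integrable_mult_right ind)
        moreover have i1: "integrable lborel (\<lambda>x. (2 * \<epsilon>) powr p * indicator {x. 0 < u x} x)"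
          by (intro integrable_mult_right ind) simp
        moreover have i2: "integrable lborel (\<lambda>x. \<Sum>j<k. (4 * (\<epsilon> * 2 ^ j)) powr p * indicator {x. 2 * (\<epsilon> * 2 ^ j) < u x} x)"
          using \<epsilon> by (intro integrable_mult_right ind Bochner_Integration.integrable_sum) simp
        ultimately show ?thesis
          unfolding g_def Bochner_Integration.integral_add[OF i1 i2] using s(2)[of 0] by (simp add: a_def)
      qed
      \<comment> \<open>One use of the recursion per level: the factor from b is bounded uniformly
        by Z, so only the shell energies still depend on j.\<close>
      also have "(\<Sum>j<k. (4 * (\<epsilon> * 2 ^ j)) powr p * a (2 * (\<epsilon> * 2 ^ j))) \<le> (\<Sum>j<k. 2 powr p * (C * Z * e (\<epsilon> * 2 ^ j)))"
      proof (rule sum_mono)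
        fix j assume "j \<in> {..<k}"
        define t where "t = \<epsilon> * 2 ^ j"
        have t: "t > 0" using \<epsilon> by (simp add: t_def)
        have "(4 * t) powr p = 2 powr p * (2 * t) powr p"
          using t powr_mult[of 2 "2 * t" p] by simp
        then have "(4 * t) powr p * a (2 * t) = 2 powr p * b (2 * t)" by (simp add: b_def)
        also have "\<dots> \<le> 2 powr p * (C * W powr \<theta> * e t)" using step2[OF t] by simp
        also have "\<dots> \<le> 2 powr p * (C * Z * e t)"
          using WZ C e0[of t] by (intro mult_left_mono mult_right_mono) (auto simp: Z_def)
        finally show "(4 * (\<epsilon> * 2 ^ j)) powr p * a (2 * (\<epsilon> * 2 ^ j)) \<le> 2 powr p * (C * Z * e (\<epsilon> * 2 ^ j))"
          by (simp add: t_def)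
      qed
      also have "\<dots> = 2 powr p * C * Z * (\<Sum>j<k. e (\<epsilon> * 2 ^ j))" by (simp add: sum_distrib_left mult_ac)
      also have "(\<Sum>j<k. e (\<epsilon> * 2 ^ j)) \<le> D"
      proof -
        have "(\<Sum>j<k. e (\<epsilon> * 2 ^ j)) = (LINT x|lborel. (\<Sum>j<k. indicator {x. \<epsilon> * 2 ^ j < u x \<and> u x \<le> 2 * (\<epsilon> * 2 ^ j)} x * (norm (grad u x))\<^sup>2))"
          unfolding e_def by (rule Bochner_Integration.integral_sum[symmetric]) (rule ie)
        also have "\<dots> \<le> D" unfolding D_def
        proof (rule integral_mono)
          show "integrable lborel (\<lambda>x. \<Sum>j<k. indicator {x. \<epsilon> * 2 ^ j < u x \<and> u x \<le> 2 * (\<epsilon> * 2 ^ j)} x * (norm (grad u x))\<^sup>2)"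
            by (intro Bochner_Integration.integrable_sum ie)
          fix x
          have "(\<Sum>j<k. indicator {x. \<epsilon> * 2 ^ j < u x \<and> u x \<le> 2 * (\<epsilon> * 2 ^ j)} x * (norm (grad u x))\<^sup>2) =
            (\<Sum>j<k. indicator {\<epsilon> * 2 ^ j <.. 2 * (\<epsilon> * 2 ^ j)} (u x)) * (norm (grad u x))\<^sup>2"
            by (simp add: sum_distrib_right indicator_def)
          also have "\<dots> \<le> (norm (grad u x))\<^sup>2" unfolding dyadic_indicator_sum[OF \<epsilon>] by (auto simp: indicator_def)
          finally show "(\<Sum>j<k. indicator {x. \<epsilon> * 2 ^ j < u x \<and> u x \<le> 2 * (\<epsilon> * 2 ^ j)} x * (norm (grad u x))\<^sup>2) \<le> (norm (grad u x))\<^sup>2" .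
        qed (rule i)
        finally show ?thesis .
      qed
      finally show ?thesis using C Z0 by (auto simp: mult_left_mono)
    qed
    have "(LINT x|lborel. (max 0 (u x)) powr p) \<le> 2 powr p * C * Z * D"
    proof (rule tendsto_lowerbound)
      have ge: "\<forall>\<^sub>F \<epsilon> in at_right 0. 0 \<le> 2 * (\<epsilon>::real)"
        by (rule eventually_mono[OF eventually_at_right_less]) auto
      have "((\<lambda>\<epsilon>. (2 * \<epsilon>) powr p) \<longlongrightarrow> 0 powr p) (at_right 0)"
        by (rule tendsto_powr2[OF _ tendsto_const ge]) (use p in \<open>auto intro!: tendsto_eq_intros\<close>)
      then have "((\<lambda>\<epsilon>. (2 * \<epsilon>) powr p) \<longlongrightarrow> 0) (at_right 0)" by simp
      then show "((\<lambda>\<epsilon>. (2 * \<epsilon>) powr p * a 0 + 2 powr p * C * Z * D) \<longlongrightarrow> 2 powr p * C * Z * D) (at_right 0)"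
        using tendsto_add[OF tendsto_mult_right[of _ 0 _ "a 0"] tendsto_const] by simp
      show "\<forall>\<^sub>F \<epsilon> in at_right 0. (LINT x|lborel. (max 0 (u x)) powr p) \<le> (2 * \<epsilon>) powr p * a 0 + 2 powr p * C * Z * D"
        using eps eventually_at_right_less by (auto intro: eventually_mono)
    qed simp
    \<comment> \<open>Z contributes D^(2/(N-2)); with the remaining D the exponent becomes 1 +
      2/(N-2) = p/2.\<close>
    also have "Z * D = C powr (2 / (N - 2)) * D powr (p / 2)"
    proof (cases "D = 0")
      case False
      then show ?thesis using D0 C unfolding Z_def p(3)[symmetric]
        by (simp add: powr_mult powr_add mult_ac)
    qed (use p in simp)
    then have "2 powr p * C * Z * D = 2 powr p * C * C powr (2 / (N - 2)) * D powr (p / 2)"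
      by (simp add: mult_ac)
    finally show ?thesis by (simp add: D_def)
  qed
  show ?thesis
    by (rule exI[of _ "2 powr p * C * C powr (2 / (N - 2))"]) (use main C in \<open>auto simp: p_def\<close>)
qed

text \<open>The estimate of the positive part applied to u and to - u; |u|^p is the sum of the two
  p-th powers, so the constant doubles.\<close>

lemma Sobolev_Cc1:
  assumes N: "DIM('a::euclidean_space) \<ge> 3"
  shows "\<exists>C>0. \<forall>u\<in>(Cc1 :: ('a \<Rightarrow> real) set).
    integrable lborel (\<lambda>x. \<bar>u x\<bar> powr crit_exp DIM('a)) \<and>
    (LINT x|lborel. \<bar>u x\<bar> powr crit_exp DIM('a)) \<le>
      C * (LINT x|lborel. (norm (grad u x))\<^sup>2) powr (crit_exp DIM('a) / 2)"
proof -
  define p where "p = crit_exp DIM('a)"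
  have p: "p > 2" using crit_exp_props(1)[OF N] by (simp add: p_def)
  obtain C where C: "C > 0" "\<And>u::'a\<Rightarrow>real. u \<in> Cc1 \<Longrightarrow> (LINT x|lborel. (max 0 (u x)) powr p) \<le>
      C * (LINT x|lborel. (norm (grad u x))\<^sup>2) powr (p / 2)"
    using Sobolev_pos_part[OF N] by (auto simp: p_def)
  have "integrable lborel (\<lambda>x. \<bar>u x\<bar> powr p) \<and> (LINT x|lborel. \<bar>u x\<bar> powr p) \<le>
      (2 * C) * (LINT x|lborel. (norm (grad u x))\<^sup>2) powr (p / 2)" if u: "u \<in> Cc1" for u :: "'a \<Rightarrow> real"
  proof -
    obtain K where K: "compact K" "\<And>x. x \<notin> K \<Longrightarrow> u x = 0" using u by (auto simp: Cc1_def)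
    note c = Cc1_continuous[OF u]
    have mu: "(\<lambda>x. - u x) \<in> Cc1" "\<And>x. grad (\<lambda>x. - u x) x = - grad u x"
      using Cc1_cmult[OF u, of "-1"] by simp_all
    have i: "integrable lborel (\<lambda>x. max 0 (u x) powr p)" "integrable lborel (\<lambda>x. max 0 (- u x) powr p)"
      by (rule continuous_support_integrable[OF _ K(1)]; use K(2) c p in \<open>auto intro!: continuous_intros continuous_on_powr'\<close>)+
    have eq: "(\<lambda>x. \<bar>u x\<bar> powr p) = (\<lambda>x. max 0 (u x) powr p + max 0 (- u x) powr p)"
      by (auto simp: max_def fun_eq_iff)
    show ?thesis
      unfolding eq using C(2)[OF u] C(2)[OF mu(1)] i by (simp add: mu(2))
  qed
  then show ?thesis using C(1) by (intro exI[of _ "2 * C"]) (auto simp: p_def)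
qed

subsection \<open>Weak gradients\<close>

lemma sq_integrable_scaleR_fun:
  fixes f :: "'a \<Rightarrow> real" and g :: "'a \<Rightarrow> 'b::euclidean_space"
  assumes "f \<in> sq_integrable M" "g \<in> sq_integrable M"
  shows "integrable M (\<lambda>x. f x *\<^sub>R g x)"
proof (rule Bochner_Integration.integrable_bound)
  show "integrable M (\<lambda>x. f x * norm (g x))"
    by (intro sq_integrable_mult sq_integrable_norm assms)
  show "(\<lambda>x. f x *\<^sub>R g x) \<in> borel_measurable M" using assms by measurable
qed (auto simp: abs_mult)

locale bounded_domain =
  fixes \<Omega> :: "'a::euclidean_space set"
  assumes dim: "DIM('a) \<ge> 3" and open_dom: "open \<Omega>" and bounded_dom: "bounded \<Omega>"
    and nonempty_dom: "\<Omega> \<noteq> {}"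
begin

abbreviation "L\<Omega> \<equiv> lebesgue_on \<Omega>"

lemma dom_sets: "\<Omega> \<in> sets lebesgue"
  using open_dom by (simp add: borel_open)

lemma space_dom [simp]: "space L\<Omega> = \<Omega>"
  by (simp add: space_restrict_space)

lemma finite_dom: "emeasure lebesgue \<Omega> < \<infinity>"
  using emeasure_bounded_finite[OF bounded_dom] open_dom by (simp add: borel_open)

sublocale finite_measure L\<Omega>
  by (rule finite_measureI) (use finite_dom dom_sets in \<open>auto simp: emeasure_restrict_space\<close>)

text \<open>Up to a null set, \<open>U\<close> is a countable union of open boxes whose closures lie in \<open>U\<close>. With bumps
  \<open>b\<^sub>i\<close> on these boxes the test functions \<open>1 - \<Prod>\<^sub>i\<^sub><\<^sub>n (1 - b\<^sub>i)\<^sup>n\<close> tend to the indicator of \<open>U\<close>.\<close>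

lemma open_integral_zero:
  fixes g :: "'a \<Rightarrow> real"
  assumes g: "integrable L\<Omega> g" and zero: "\<And>\<phi>. \<phi> \<in> test_functions \<Omega> \<Longrightarrow> (LINT x|L\<Omega>. \<phi> x * g x) = 0"
    and U: "open U" "U \<subseteq> \<Omega>"
  shows "(LINT x|L\<Omega>. indicator U x * g x) = 0"
proof -
  obtain \<D> where \<D>: "countable \<D>" "\<D> \<subseteq> Pow U" "\<And>X. X \<in> \<D> \<Longrightarrow> \<exists>a b. X = cbox a b" "\<Union>\<D> = U"
    by (rule open_countable_Union_open_cbox[OF U(1)]) blast
  \<comment> \<open>The inserted empty set makes the family nonempty, so that it can be enumerated.
    It is itself a degenerate box, so every \<open>B i\<close> has corners.\<close>
  define B where "B = from_nat_into (insert {} \<D>)"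
  have B: "range B = insert {} \<D>" unfolding B_def using \<D>(1) by (intro range_from_nat_into) auto
  have "\<exists>a b. B i = cbox a b" for i
  proof -
    have "B i \<in> insert {} \<D>" using B by blast
    moreover have "cbox One (0::'a) = {}"
      unfolding box_eq_empty using SOME_Basis by (intro bexI[of _ "SOME b. b \<in> Basis"]) auto
    ultimately show ?thesis using \<D>(3) by blast
  qed
  then obtain l u where lu: "\<And>i. B i = cbox (l i) (u i)" by metis
  have "(\<Union>i. cbox (l i) (u i)) = \<Union>(range B)" by (simp flip: lu)
  then have BU: "(\<Union>i. cbox (l i) (u i)) = U" using B \<D>(4) by simp
  define \<phi> where "\<phi> n x = 1 - (\<Prod>i<n. (1 - box_bump (l i) (u i) x) ^ n)" for n :: nat and x
  have test: "\<phi> n \<in> test_functions \<Omega>" for n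
  proof (rule test_functionsI)
    show "C_k k (\<phi> n)" for k
      unfolding \<phi>_def by (intro C_k_diff C_k_const C_k_prod C_k_power C_k_box_bump) auto
    show "compact (\<Union>i<n. cbox (l i) (u i))" by (intro compact_UN) auto
    show "(\<Union>i<n. cbox (l i) (u i)) \<subseteq> \<Omega>" using BU U(2) by blast
    fix x assume "\<phi> n x \<noteq> 0"
    then have "(\<Prod>i<n. (1 - box_bump (l i) (u i) x) ^ n) \<noteq> 1" by (simp add: \<phi>_def)
    then obtain i where "i \<in> {..<n}" "(1 - box_bump (l i) (u i) x) ^ n \<noteq> 1"
      by (rule prod.not_neutral_contains_not_neutral)
    then have "i < n" "box_bump (l i) (u i) x \<noteq> 0" by auto
    then show "x \<in> (\<Union>i<n. cbox (l i) (u i))" using box_subset_cbox by (auto simp: box_bump_eq_0)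
  qed
  have bd: "0 \<le> (\<Prod>i<n. (1 - box_bump (l i) (u i) x) ^ n)" "(\<Prod>i<n. (1 - box_bump (l i) (u i) x) ^ n) \<le> 1" for n x
    using box_bump_le_1[of "l _" "u _" x] box_bump_nonneg[of "l _" "u _" x]
    by (auto intro!: prod_nonneg prod_le_1 power_le_one)
  define N where "N = (\<Union>i. cbox (l i) (u i) - box (l i) (u i))"
  have "N \<in> null_sets lebesgue"
    unfolding N_def by (intro null_sets_UN) (use negligible_frontier_interval in \<open>auto simp: negligible_iff_null_sets\<close>)
  then have "AE x in lebesgue. x \<notin> N" by (rule AE_not_in)
  then have AEN: "AE x in L\<Omega>. x \<notin> N"
    by (subst AE_restrict_space_iff) (use dom_sets in auto)
  have "(\<lambda>n. LINT x|L\<Omega>. \<phi> n x * g x) \<longlonglongrightarrow> (LINT x|L\<Omega>. indicator U x * g x)"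
  proof (rule integral_dominated_convergence[where w="\<lambda>x. \<bar>g x\<bar>"])
    show "(\<lambda>x. indicator U x * g x) \<in> borel_measurable L\<Omega>"
    proof (intro borel_measurable_times borel_measurable_indicator borel_measurable_integrable[OF g])
      have "U \<in> sets lebesgue" using U(1) by (simp add: borel_open)
      then show "U \<in> sets L\<Omega>" using U(2) dom_sets by (simp add: sets_restrict_space_iff)
    qed
    show "(\<lambda>x. \<phi> n x * g x) \<in> borel_measurable L\<Omega>" for n
      using g test_functions_L2(1)[OF test[of n] dom_sets] by (auto dest: sq_integrable_measurable)
    show "AE x in L\<Omega>. (\<lambda>n. \<phi> n x * g x) \<longlonglongrightarrow> indicator U x * g x"
      using AEN
    proof eventually_elim
      fix x assume x: "x \<notin> N"
      have "(\<lambda>n. \<phi> n x) \<longlonglongrightarrow> indicator U x"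
      proof (cases "x \<in> U")
        case True
        then obtain j where "x \<in> cbox (l j) (u j)" using BU by blast
        then have j: "x \<in> box (l j) (u j)" using x by (auto simp: N_def)
        define c where "c = 1 - box_bump (l j) (u j) x"
        have c: "0 \<le> c" "c < 1"
          using box_bump_le_1[of "l j" "u j" x] box_bump_nonneg[of "l j" "u j" x] j box_bump_eq_0[of "l j" "u j" x]
          by (auto simp: c_def)
        \<comment> \<open>The single factor of index j tends to 0 like c^n, and the others lie in
          [0, 1].\<close>
        have "(\<lambda>n. \<Prod>i<n. (1 - box_bump (l i) (u i) x) ^ n) \<longlonglongrightarrow> 0"
        proof (rule Lim_null_comparison)
          show "(\<lambda>n. c ^ n) \<longlonglongrightarrow> 0" using c by (intro LIMSEQ_power_zero) auto
          show "\<forall>\<^sub>F n in sequentially. norm (\<Prod>i<n. (1 - box_bump (l i) (u i) x) ^ n) \<le> c ^ n"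
            using eventually_gt_at_top[of j]
          proof eventually_elim
            fix n assume n: "j < n"
            have "(\<Prod>i<n. (1 - box_bump (l i) (u i) x) ^ n) = c ^ n * (\<Prod>i\<in>{..<n}-{j}. (1 - box_bump (l i) (u i) x) ^ n)"
              using n by (subst prod.remove[of _ j]) (auto simp: c_def)
            also have "\<dots> \<le> c ^ n * 1"
              using c box_bump_le_1[of "l _" "u _" x] box_bump_nonneg[of "l _" "u _" x]
              by (intro mult_left_mono prod_le_1) (auto intro: power_le_one)
            finally show "norm (\<Prod>i<n. (1 - box_bump (l i) (u i) x) ^ n) \<le> c ^ n"
              using bd(1)[where n=n and x=x] by simp
          qed
        qed
        from tendsto_diff[OF tendsto_const[of 1] this] show ?thesis using True by (simp add: \<phi>_def)
      next
        case False
        then have "box_bump (l i) (u i) x = 0" for i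
          using BU box_subset_cbox by (auto simp: box_bump_eq_0)
        then show ?thesis using False by (simp add: \<phi>_def)
      qed
      then show "(\<lambda>n. \<phi> n x * g x) \<longlonglongrightarrow> indicator U x * g x" by (intro tendsto_intros)
    qed
    show "AE x in L\<Omega>. norm (\<phi> n x * g x) \<le> \<bar>g x\<bar>" for n
      using bd[where n=n] by (auto simp: \<phi>_def abs_mult intro!: mult_left_le_one_le)
  qed (use g in auto)
  then show ?thesis using zero[OF test] LIMSEQ_unique[OF _ tendsto_const] by simp
qed

text \<open>Outer regularity: the set E where g > 0 lies in an open T with |T - E| < e. The integral
  of g over T \<inter> \<Omega> vanishes by \<open>open_integral_zero\<close>, so the integral over
  E is minus that over the remainder F, hence at most sqrt e times the L2 norm of g. As e tends to
  0, the integral of g over E vanishes.\<close>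

lemma fundamental_lemma_pos:
  fixes g :: "'a \<Rightarrow> real"
  assumes g: "g \<in> sq_integrable L\<Omega>" and zero: "\<And>\<phi>. \<phi> \<in> test_functions \<Omega> \<Longrightarrow> (LINT x|L\<Omega>. \<phi> x * g x) = 0"
  shows "AE x in L\<Omega>. g x \<le> 0"
proof -
  define E where "E = {x \<in> \<Omega>. g x > 0}"
  note [measurable] = sq_integrable_measurable[OF g]
  have gi: "integrable L\<Omega> g" by (rule sq_integrable_L1(1)[OF g])
  have EL: "E \<in> sets L\<Omega>"
    using measurable_sets[of g L\<Omega> borel "{0<..}"] sq_integrable_measurable[OF g]
    by (simp add: E_def vimage_def Int_def conj_commute)
  then have E: "E \<in> sets lebesgue" using dom_sets by (simp add: sets_restrict_space_iff)
  have iE: "integrable L\<Omega> (\<lambda>x. indicator E x * g x)"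
    using integrable_mult_indicator[OF EL gi] by simp
  have le: "(LINT x|L\<Omega>. indicator E x * g x) \<le> sqrt e * L2_norm L\<Omega> g" if e: "e > 0" for e
  proof -
    obtain T where T: "open T" "E \<subseteq> T" "T - E \<in> lmeasurable" "emeasure lebesgue (T - E) < ennreal e"
      using sets_lebesgue_outer_open[OF E e] by blast
    define F where "F = (T \<inter> \<Omega>) - E"
    have "T \<in> sets lebesgue" using T(1) by (simp add: borel_open)
    then have "F \<in> sets lebesgue" unfolding F_def using E dom_sets by blast
    then have FL: "F \<in> sets L\<Omega>"
      using dom_sets by (auto simp: F_def sets_restrict_space_iff)
    have "F \<inter> \<Omega> = F" by (auto simp: F_def)
    have Fm: "measure L\<Omega> F \<le> e"
    proof -
      have "measure L\<Omega> F = measure lebesgue F"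
        using FL dom_sets by (intro measure_restrict_space) (auto simp: F_def)
      also have "\<dots> \<le> measure lebesgue (T - E)"
        using T(3) FL dom_sets by (intro measure_mono_fmeasurable) (auto simp: F_def sets_restrict_space_iff)
      also have "\<dots> \<le> e" using T(4) e by (simp add: measure_def enn2real_leI less_imp_le)
      finally show ?thesis .
    qed
    have iF: "integrable L\<Omega> (\<lambda>x. indicator F x * g x)"
      using integrable_mult_indicator[OF FL gi] by simp
    have "(LINT x|L\<Omega>. indicator (T \<inter> \<Omega>) x * g x) = (LINT x|L\<Omega>. indicator E x * g x + indicator F x * g x)"
      using T(2) by (intro Bochner_Integration.integral_cong) (auto simp: F_def E_def indicator_def)
    then have "(LINT x|L\<Omega>. indicator E x * g x) = - (LINT x|L\<Omega>. indicator F x * g x)"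
      using open_integral_zero[OF gi zero, of "T \<inter> \<Omega>"] T(1) open_dom iE iF by (simp add: open_Int)
    also have "\<dots> \<le> L2_norm L\<Omega> (indicator F :: 'a \<Rightarrow> real) * L2_norm L\<Omega> g"
    proof -
      have "(\<lambda>x. (norm (indicator F x :: real))\<^sup>2) = indicator F" by (auto simp: indicator_def)
      then have "(indicator F :: 'a \<Rightarrow> real) \<in> sq_integrable L\<Omega>"
        using FL by (auto simp: sq_integrable_def emeasure_eq_measure)
      from abs_integral_mult_le[OF this g] show ?thesis by simp
    qed
    also have "L2_norm L\<Omega> (indicator F :: 'a \<Rightarrow> real) \<le> sqrt e"
    proof -
      have "(\<lambda>x. (norm (indicator F x :: real))\<^sup>2) = indicator F" by (auto simp: indicator_def)
      then have "L2_norm L\<Omega> (indicator F :: 'a \<Rightarrow> real) = sqrt (measure L\<Omega> F)"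
        using FL \<open>F \<inter> \<Omega> = F\<close> by (simp add: L2_norm_def)
      then show ?thesis using Fm by simp
    qed
    finally show ?thesis by (simp add: mult_right_mono L2_norm_nonneg)
  qed
  have "(LINT x|L\<Omega>. indicator E x * g x) \<le> 0"
  proof (rule tendsto_lowerbound)
    show "((\<lambda>e. sqrt e * L2_norm L\<Omega> g) \<longlongrightarrow> 0) (at_right 0)" by (auto intro!: tendsto_eq_intros)
    show "\<forall>\<^sub>F e in at_right 0. (LINT x|L\<Omega>. indicator E x * g x) \<le> sqrt e * L2_norm L\<Omega> g"
      using le eventually_at_right_less by (auto intro: eventually_mono)
  qed simp
  moreover have nn: "0 \<le> indicator E x * g x" for x by (auto simp: indicator_def E_def)
  ultimately have "(LINT x|L\<Omega>. indicator E x * g x) = 0"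
    by (intro antisym Bochner_Integration.integral_nonneg) auto
  then have "AE x in L\<Omega>. indicator E x * g x = 0"
    using integral_nonneg_eq_0_iff_AE[OF iE] nn by auto
  then show ?thesis
    using AE_space by eventually_elim (auto simp: E_def indicator_def not_less split: if_splits)
qed

lemma fundamental_lemma:
  fixes g :: "'a \<Rightarrow> real"
  assumes g: "g \<in> sq_integrable L\<Omega>" and zero: "\<And>\<phi>. \<phi> \<in> test_functions \<Omega> \<Longrightarrow> (LINT x|L\<Omega>. \<phi> x * g x) = 0"
  shows "AE x in L\<Omega>. g x = 0"
proof -
  have "AE x in L\<Omega>. - g x \<le> 0"
    using sq_integrable_cmult[OF g, of "-1"] zero by (intro fundamental_lemma_pos) auto
  moreover have "AE x in L\<Omega>. g x \<le> 0"
    by (rule fundamental_lemma_pos[OF g zero])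
  ultimately show ?thesis by eventually_elim auto
qed

text \<open>\<open>fundamental_lemma\<close> for each component. It makes the particular choice in
  \<open>weak_grad\<close> irrelevant under integrals.\<close>

lemma weak_grad_unique:
  assumes g: "g \<in> L2_on \<Omega>" "g' \<in> L2_on \<Omega>" and w: "has_weak_grad \<Omega> u g" "has_weak_grad \<Omega> u g'"
  shows "AE x in L\<Omega>. g x = g' x"
proof -
  have "AE x in L\<Omega>. (g x - g' x) \<bullet> b = 0" if b: "b \<in> Basis" for b
  proof (rule fundamental_lemma)
    show "(\<lambda>x. (g x - g' x) \<bullet> b) \<in> sq_integrable L\<Omega>"
      using g by (intro sq_integrable_component sq_integrable_diff) (auto simp: L2_on_eq)
    fix \<phi> assume \<phi>: "\<phi> \<in> test_functions \<Omega>"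
    have "(LINT x|L\<Omega>. \<phi> x *\<^sub>R g x) = (LINT x|L\<Omega>. \<phi> x *\<^sub>R g' x)"
      using w \<phi> unfolding has_weak_grad_def by (metis neg_equal_iff_equal)
    moreover have i: "integrable L\<Omega> (\<lambda>x. \<phi> x *\<^sub>R g x)" "integrable L\<Omega> (\<lambda>x. \<phi> x *\<^sub>R g' x)"
      using g test_functions_L2(1)[OF \<phi> dom_sets] by (auto intro!: sq_integrable_scaleR_fun simp: L2_on_eq)
    ultimately have "(LINT x|L\<Omega>. \<phi> x *\<^sub>R g x - \<phi> x *\<^sub>R g' x) \<bullet> b = 0" by simp
    then have "(LINT x|L\<Omega>. (\<phi> x *\<^sub>R g x - \<phi> x *\<^sub>R g' x) \<bullet> b) = 0"
      using i by (subst integral_inner_left) auto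
    then show "(LINT x|L\<Omega>. \<phi> x * ((g x - g' x) \<bullet> b)) = 0"
      by (simp add: inner_diff_left right_diff_distrib)
  qed
  then have "AE x in L\<Omega>. \<forall>b\<in>Basis. (g x - g' x) \<bullet> b = 0"
    by (intro AE_ball_countable[THEN iffD2]) (auto intro: countable_finite)
  then show ?thesis
  proof eventually_elim
    case (elim x)
    show ?case by (rule euclidean_eqI) (use elim in \<open>simp add: inner_diff_left\<close>)
  qed
qed

section \<open>Approximation by test functions and the space \<open>H10\<close>\<close>

lemma H1_weak_grad:
  assumes "u \<in> H1 \<Omega>"
  shows "weak_grad \<Omega> u \<in> sq_integrable L\<Omega>" "has_weak_grad \<Omega> u (weak_grad \<Omega> u)"
proof -
  have "\<exists>g. g \<in> L2_on \<Omega> \<and> has_weak_grad \<Omega> u g" using assms by (auto simp: H1_def)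
  from someI_ex[OF this] show "weak_grad \<Omega> u \<in> sq_integrable L\<Omega>" "has_weak_grad \<Omega> u (weak_grad \<Omega> u)"
    by (auto simp: weak_grad_def L2_on_eq)
qed

text \<open>The product of two test functions is a test function, and the integral of its gradient
  is zero.\<close>

lemma integral_by_parts:
  assumes "\<phi> \<in> test_functions \<Omega>" "\<psi> \<in> test_functions \<Omega>"
  shows "(LINT x|L\<Omega>. \<phi> x *\<^sub>R grad \<psi> x) = - (LINT x|L\<Omega>. \<psi> x *\<^sub>R grad \<phi> x)"
proof -
  note c = assms[THEN test_functions_Cc1]
  have t: "(\<lambda>x. \<phi> x * \<psi> x) \<in> test_functions \<Omega>"
    by (intro test_functions_mult assms test_function_C_k[OF assms(1)])
  have "(LINT x|L\<Omega>. grad (\<lambda>x. \<phi> x * \<psi> x) x) = (LINT x|lborel. grad (\<lambda>x. \<phi> x * \<psi> x) x)"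
    by (intro lebesgue_on_supported dom_sets Cc1_integrable Cc1_mult c test_functions_outside(2)[OF t])
  also have "\<dots> = 0" by (intro Cc1_integral_grad Cc1_mult c)
  finally have "(LINT x|L\<Omega>. \<phi> x *\<^sub>R grad \<psi> x + \<psi> x *\<^sub>R grad \<phi> x) = 0"
    by (simp add: Cc1_mult(2)[OF c])
  then show ?thesis
    using sq_integrable_scaleR_fun[OF test_functions_L2(1)[OF assms(1) dom_sets] test_functions_L2(2)[OF assms(2) dom_sets]]
      sq_integrable_scaleR_fun[OF test_functions_L2(1)[OF assms(2) dom_sets] test_functions_L2(2)[OF assms(1) dom_sets]]
    by (simp add: add_eq_0_iff)
qed

lemma L2_scaleR_tendsto:
  fixes f :: "nat \<Rightarrow> 'a \<Rightarrow> real" and G :: "nat \<Rightarrow> 'a \<Rightarrow> 'a"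
  shows "\<lbrakk>\<And>n. f n \<in> sq_integrable L\<Omega>; u \<in> sq_integrable L\<Omega>; H \<in> sq_integrable L\<Omega>;
      (\<lambda>n. L2_norm L\<Omega> (\<lambda>x. f n x - u x)) \<longlonglongrightarrow> 0\<rbrakk> \<Longrightarrow>
      (\<lambda>n. LINT x|L\<Omega>. f n x *\<^sub>R H x) \<longlonglongrightarrow> (LINT x|L\<Omega>. u x *\<^sub>R H x)"
    "\<lbrakk>\<And>n. G n \<in> sq_integrable L\<Omega>; H \<in> sq_integrable L\<Omega>; u \<in> sq_integrable L\<Omega>;
      (\<lambda>n. L2_norm L\<Omega> (\<lambda>x. G n x - H x)) \<longlonglongrightarrow> 0\<rbrakk> \<Longrightarrow>
      (\<lambda>n. LINT x|L\<Omega>. u x *\<^sub>R G n x) \<longlonglongrightarrow> (LINT x|L\<Omega>. u x *\<^sub>R H x)"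
proof -
  have comp: "(\<lambda>n. I n) \<longlonglongrightarrow> J" if "\<And>b. b \<in> Basis \<Longrightarrow> (\<lambda>n. I n \<bullet> b) \<longlonglongrightarrow> J \<bullet> b"
    for I :: "nat \<Rightarrow> 'a" and J
    using that tendsto_componentwise_iff[of I J sequentially] by blast
  have bnd: "norm (LINT x|L\<Omega>. v x *\<^sub>R K x) \<le> L2_norm L\<Omega> v * L2_norm L\<Omega> K"
    if "v \<in> sq_integrable L\<Omega>" "K \<in> sq_integrable L\<Omega>" for v :: "'a \<Rightarrow> real" and K :: "'a \<Rightarrow> 'a"
  proof -
    have "norm (LINT x|L\<Omega>. v x *\<^sub>R K x) \<le> (LINT x|L\<Omega>. norm (v x *\<^sub>R K x))" by (rule integral_norm_bound)
    also have "\<dots> = (LINT x|L\<Omega>. \<bar>v x\<bar> * norm (K x))" by simp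
    also have "\<dots> \<le> L2_norm L\<Omega> v * L2_norm L\<Omega> K"
      using abs_integral_mult_le[OF sq_integrable_abs[OF that(1)] sq_integrable_norm[OF that(2)]]
      by (simp add: L2_norm_def)
    finally show ?thesis .
  qed
  show "(\<lambda>n. LINT x|L\<Omega>. f n x *\<^sub>R H x) \<longlonglongrightarrow> (LINT x|L\<Omega>. u x *\<^sub>R H x)"
    if "\<And>n. f n \<in> sq_integrable L\<Omega>" "u \<in> sq_integrable L\<Omega>" "H \<in> sq_integrable L\<Omega>"
      "(\<lambda>n. L2_norm L\<Omega> (\<lambda>x. f n x - u x)) \<longlonglongrightarrow> 0"
  proof (rule LIM_zero_cancel, rule Lim_null_comparison[OF always_eventually], rule allI)
    fix n
    show "norm ((LINT x|L\<Omega>. f n x *\<^sub>R H x) - (LINT x|L\<Omega>. u x *\<^sub>R H x)) \<le> L2_norm L\<Omega> (\<lambda>x. f n x - u x) * L2_norm L\<Omega> H"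
      using bnd[OF sq_integrable_diff[OF that(1,2)] that(3), of n]
        sq_integrable_scaleR_fun[OF that(1,3), of n] sq_integrable_scaleR_fun[OF that(2,3)]
      by (simp add: scaleR_diff_left)
    show "(\<lambda>n. L2_norm L\<Omega> (\<lambda>x. f n x - u x) * L2_norm L\<Omega> H) \<longlonglongrightarrow> 0"
      using tendsto_mult_right[OF that(4), of "L2_norm L\<Omega> H"] by simp
  qed
  show "(\<lambda>n. LINT x|L\<Omega>. u x *\<^sub>R G n x) \<longlonglongrightarrow> (LINT x|L\<Omega>. u x *\<^sub>R H x)"
    if "\<And>n. G n \<in> sq_integrable L\<Omega>" "H \<in> sq_integrable L\<Omega>" "u \<in> sq_integrable L\<Omega>"
      "(\<lambda>n. L2_norm L\<Omega> (\<lambda>x. G n x - H x)) \<longlonglongrightarrow> 0"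
  proof (rule LIM_zero_cancel, rule Lim_null_comparison[OF always_eventually], rule allI)
    fix n
    show "norm ((LINT x|L\<Omega>. u x *\<^sub>R G n x) - (LINT x|L\<Omega>. u x *\<^sub>R H x)) \<le> L2_norm L\<Omega> u * L2_norm L\<Omega> (\<lambda>x. G n x - H x)"
      using bnd[OF that(3) sq_integrable_diff[OF that(1,2)], of n]
        sq_integrable_scaleR_fun[OF that(3,1), of n] sq_integrable_scaleR_fun[OF that(3,2)]
      by (simp add: scaleR_diff_right)
    show "(\<lambda>n. L2_norm L\<Omega> u * L2_norm L\<Omega> (\<lambda>x. G n x - H x)) \<longlonglongrightarrow> 0"
      using tendsto_mult_left[OF that(4), of "L2_norm L\<Omega> u"] by simp
  qed
qed

text \<open>The limit \<open>G\<close> of the gradients is a parameter here, whereas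
  \<open>H10\<close> speaks of the chosen \<open>weak_grad\<close>. \<open>H10I\<close> and
  \<open>H10E\<close> convert between the two, so that a gradient may be exhibited as a
  limit.\<close>

definition approximates :: "(nat \<Rightarrow> 'a \<Rightarrow> real) \<Rightarrow> ('a \<Rightarrow> real) \<Rightarrow> ('a \<Rightarrow> 'a) \<Rightarrow> bool" where
  "approximates \<phi> u G \<longleftrightarrow> (\<forall>n. \<phi> n \<in> test_functions \<Omega>) \<and> u \<in> sq_integrable L\<Omega> \<and> G \<in> sq_integrable L\<Omega> \<and>
     (\<lambda>n. L2_norm L\<Omega> (\<lambda>x. \<phi> n x - u x)) \<longlonglongrightarrow> 0 \<and>
     (\<lambda>n. L2_norm L\<Omega> (\<lambda>x. grad (\<phi> n) x - G x)) \<longlonglongrightarrow> 0"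

text \<open>Both sides of the integration by parts formula for the approximants are continuous in
  L2, so the formula passes to the limit.\<close>

lemma approximates_weak_grad:
  assumes "approximates \<phi> u G" shows "has_weak_grad \<Omega> u G"
  unfolding has_weak_grad_def
proof
  fix \<psi> assume \<psi>: "\<psi> \<in> test_functions \<Omega>"
  note a = assms[unfolded approximates_def]
  note p = test_functions_L2(1,2)[OF _ dom_sets]
  have "(\<lambda>n. LINT x|L\<Omega>. \<phi> n x *\<^sub>R grad \<psi> x) \<longlonglongrightarrow> (LINT x|L\<Omega>. u x *\<^sub>R grad \<psi> x)"
    using a p \<psi> by (intro L2_scaleR_tendsto(1)) auto
  moreover have "(\<lambda>n. LINT x|L\<Omega>. \<psi> x *\<^sub>R grad (\<phi> n) x) \<longlonglongrightarrow> (LINT x|L\<Omega>. \<psi> x *\<^sub>R G x)"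
    using a p \<psi> by (intro L2_scaleR_tendsto(2)) auto
  then have "(\<lambda>n. LINT x|L\<Omega>. \<phi> n x *\<^sub>R grad \<psi> x) \<longlonglongrightarrow> - (LINT x|L\<Omega>. \<psi> x *\<^sub>R G x)"
    using a \<psi> by (subst integral_by_parts) (auto intro: tendsto_minus)
  ultimately show "(LINT x|L\<Omega>. u x *\<^sub>R grad \<psi> x) = - (LINT x|L\<Omega>. \<psi> x *\<^sub>R G x)"
    by (rule LIMSEQ_unique)
qed

lemma L2_norm_cong_AE:
  assumes "AE x in M. f x = g x" "f \<in> borel_measurable M" "g \<in> borel_measurable M"
  shows "L2_norm M f = L2_norm M g"
  unfolding L2_norm_def by (intro arg_cong[where f=sqrt] integral_cong_AE) (use assms in auto)

lemma H10I:
  assumes "approximates \<phi> u G"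
  shows "u \<in> H10 \<Omega>" "AE x in L\<Omega>. weak_grad \<Omega> u x = G x"
proof -
  note a = assms[unfolded approximates_def]
  have H1: "u \<in> H1 \<Omega>"
    using a approximates_weak_grad[OF assms] by (auto simp: H1_def L2_on_eq)
  show AE: "AE x in L\<Omega>. weak_grad \<Omega> u x = G x"
    using H1_weak_grad[OF H1] a by (intro weak_grad_unique[OF _ _ _ approximates_weak_grad[OF assms]]) (auto simp: L2_on_eq)
  have m: "weak_grad \<Omega> u \<in> borel_measurable L\<Omega>" using H1_weak_grad(1)[OF H1] by (rule sq_integrable_measurable)
  have "L2_norm L\<Omega> (\<lambda>x. grad (\<phi> n) x - weak_grad \<Omega> u x) = L2_norm L\<Omega> (\<lambda>x. grad (\<phi> n) x - G x)" for n
    using AE a m test_functions_L2(2)[OF _ dom_sets, of "\<phi> n"]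
    by (intro L2_norm_cong_AE) (auto dest: sq_integrable_measurable)
  then have "(\<lambda>n. L2_norm L\<Omega> (\<lambda>x. grad (\<phi> n) x - weak_grad \<Omega> u x)) \<longlonglongrightarrow> 0" using a by simp
  then have "(\<lambda>n. (L2_norm L\<Omega> (\<lambda>x. \<phi> n x - u x))\<^sup>2 + (L2_norm L\<Omega> (\<lambda>x. grad (\<phi> n) x - weak_grad \<Omega> u x))\<^sup>2) \<longlonglongrightarrow> 0\<^sup>2 + 0\<^sup>2"
    using a by (intro tendsto_intros) auto
  then show "u \<in> H10 \<Omega>"
    using H1 a by (auto simp: H10_def L2_norm_sq intro!: exI[of _ \<phi>])
qed

lemma H10E:
  assumes "u \<in> H10 \<Omega>"
  obtains \<phi> where "approximates \<phi> u (weak_grad \<Omega> u)"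
proof -
  from assms obtain \<phi> where u: "u \<in> H1 \<Omega>" and \<phi>: "\<And>n::nat. \<phi> n \<in> test_functions \<Omega>" and
    lim: "(\<lambda>k. (LINT x|L\<Omega>. (\<phi> k x - u x)\<^sup>2) + (LINT x|L\<Omega>. (norm (grad (\<phi> k) x - weak_grad \<Omega> u x))\<^sup>2)) \<longlonglongrightarrow> 0"
    by (auto simp: H10_def)
  have "(\<lambda>k. (LINT x|L\<Omega>. (\<phi> k x - u x)\<^sup>2)) \<longlonglongrightarrow> 0"
    by (rule tendsto_sandwich[OF _ _ tendsto_const lim]) (auto intro!: always_eventually)
  then have 1: "(\<lambda>n. L2_norm L\<Omega> (\<lambda>x. \<phi> n x - u x)) \<longlonglongrightarrow> 0"
    unfolding L2_norm_def by (auto intro!: tendsto_eq_intros)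
  have "(\<lambda>k. (LINT x|L\<Omega>. (norm (grad (\<phi> k) x - weak_grad \<Omega> u x))\<^sup>2)) \<longlonglongrightarrow> 0"
    by (rule tendsto_sandwich[OF _ _ tendsto_const lim]) (auto intro!: always_eventually)
  then have 2: "(\<lambda>n. L2_norm L\<Omega> (\<lambda>x. grad (\<phi> n) x - weak_grad \<Omega> u x)) \<longlonglongrightarrow> 0"
    unfolding L2_norm_def by (auto intro!: tendsto_eq_intros)
  show ?thesis
    using that[of \<phi>] 1 2 \<phi> u H1_weak_grad(1)[OF u] by (auto simp: approximates_def H1_def L2_on_eq)
qed

lemma H10_L2:
  assumes "u \<in> H10 \<Omega>" shows "u \<in> sq_integrable L\<Omega>" "weak_grad \<Omega> u \<in> sq_integrable L\<Omega>"
  using assms H1_weak_grad(1) by (auto simp: H10_def H1_def L2_on_eq)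

lemma test_approximates: "\<phi> \<in> test_functions \<Omega> \<Longrightarrow> approximates (\<lambda>n. \<phi>) \<phi> (grad \<phi>)"
  using test_functions_L2[OF _ dom_sets, of \<phi>] by (auto simp: approximates_def L2_norm_def)

lemma test_H10:
  assumes "\<phi> \<in> test_functions \<Omega>"
  shows "\<phi> \<in> H10 \<Omega>" "AE x in L\<Omega>. weak_grad \<Omega> \<phi> x = grad \<phi> x"
  using H10I[OF test_approximates[OF assms]] by auto

text \<open>Linear combinations of approximating sequences. The gradient identity holds almost
  everywhere only, because each \<open>weak_grad\<close> is chosen separately.\<close>

lemma H10_add_scale:
  assumes "u \<in> H10 \<Omega>" "v \<in> H10 \<Omega>"
  shows "(\<lambda>x. u x + c * v x) \<in> H10 \<Omega>"
    "AE x in L\<Omega>. weak_grad \<Omega> (\<lambda>x. u x + c * v x) x = weak_grad \<Omega> u x + c *\<^sub>R weak_grad \<Omega> v x"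
proof -
  obtain \<phi> \<psi> where a: "approximates \<phi> u (weak_grad \<Omega> u)" "approximates \<psi> v (weak_grad \<Omega> v)"
    using assms by (metis H10E)
  note a' = a[unfolded approximates_def]
  have t: "\<phi> n \<in> test_functions \<Omega>" "\<psi> n \<in> test_functions \<Omega>" for n using a' by auto
  note L = test_functions_L2(1,2)[OF t(1) dom_sets] test_functions_L2(1,2)[OF t(2) dom_sets]
  have lim0: "(\<lambda>n. a n + \<bar>c\<bar> * b n) \<longlonglongrightarrow> 0" if "a \<longlonglongrightarrow> 0" "b \<longlonglongrightarrow> 0" for a b :: "nat \<Rightarrow> real"
    using that by (auto intro!: tendsto_eq_intros)
  have "approximates (\<lambda>n x. \<phi> n x + c * \<psi> n x) (\<lambda>x. u x + c * v x) (\<lambda>x. weak_grad \<Omega> u x + c *\<^sub>R weak_grad \<Omega> v x)"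
    unfolding approximates_def
  proof (intro conjI allI)
    show "(\<lambda>x. \<phi> n x + c * \<psi> n x) \<in> test_functions \<Omega>" for n
      by (intro test_functions_add test_functions_cmult t)
    show "(\<lambda>x. u x + c * v x) \<in> sq_integrable L\<Omega>"
      using a' by (intro sq_integrable_add sq_integrable_cmult) auto
    show "(\<lambda>x. weak_grad \<Omega> u x + c *\<^sub>R weak_grad \<Omega> v x) \<in> sq_integrable L\<Omega>"
      using a' by (intro sq_integrable_add sq_integrable_scaleR) auto
    show "(\<lambda>n. L2_norm L\<Omega> (\<lambda>x. \<phi> n x + c * \<psi> n x - (u x + c * v x))) \<longlonglongrightarrow> 0"
    proof (rule Lim_null_comparison[OF always_eventually lim0], rule allI)
      fix n
      have "L2_norm L\<Omega> (\<lambda>x. (\<phi> n x - u x) + c *\<^sub>R (\<psi> n x - v x)) \<le> L2_norm L\<Omega> (\<lambda>x. \<phi> n x - u x) + L2_norm L\<Omega> (\<lambda>x. c *\<^sub>R (\<psi> n x - v x))"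
        using a' by (intro L2_norm_triangle sq_integrable_diff sq_integrable_scaleR L) auto
      then show "norm (L2_norm L\<Omega> (\<lambda>x. \<phi> n x + c * \<psi> n x - (u x + c * v x))) \<le>
        L2_norm L\<Omega> (\<lambda>x. \<phi> n x - u x) + \<bar>c\<bar> * L2_norm L\<Omega> (\<lambda>x. \<psi> n x - v x)"
        unfolding L2_norm_scaleR by (simp add: L2_norm_nonneg algebra_simps)
    qed (use a' in auto)
    show "(\<lambda>n. L2_norm L\<Omega> (\<lambda>x. grad (\<lambda>x. \<phi> n x + c * \<psi> n x) x - (weak_grad \<Omega> u x + c *\<^sub>R weak_grad \<Omega> v x))) \<longlonglongrightarrow> 0"
    proof (rule Lim_null_comparison[OF always_eventually lim0], rule allI)
      fix n
      have g: "grad (\<lambda>x. \<phi> n x + c * \<psi> n x) x = grad (\<phi> n) x + c *\<^sub>R grad (\<psi> n) x" for x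
        using Cc1_add(2)[OF test_functions_Cc1[OF t(1)] Cc1_cmult(1)[OF test_functions_Cc1[OF t(2)]]]
          Cc1_cmult(2)[OF test_functions_Cc1[OF t(2)]] by simp
      have "L2_norm L\<Omega> (\<lambda>x. (grad (\<phi> n) x - weak_grad \<Omega> u x) + c *\<^sub>R (grad (\<psi> n) x - weak_grad \<Omega> v x)) \<le>
         L2_norm L\<Omega> (\<lambda>x. grad (\<phi> n) x - weak_grad \<Omega> u x) + L2_norm L\<Omega> (\<lambda>x. c *\<^sub>R (grad (\<psi> n) x - weak_grad \<Omega> v x))"
        using a' by (intro L2_norm_triangle sq_integrable_diff sq_integrable_scaleR L) auto
      then show "norm (L2_norm L\<Omega> (\<lambda>x. grad (\<lambda>x. \<phi> n x + c * \<psi> n x) x - (weak_grad \<Omega> u x + c *\<^sub>R weak_grad \<Omega> v x))) \<le>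
        L2_norm L\<Omega> (\<lambda>x. grad (\<phi> n) x - weak_grad \<Omega> u x) + \<bar>c\<bar> * L2_norm L\<Omega> (\<lambda>x. grad (\<psi> n) x - weak_grad \<Omega> v x)"
        unfolding L2_norm_scaleR by (simp add: L2_norm_nonneg algebra_simps g)
    qed (use a' in auto)
  qed
  from H10I[OF this] show "(\<lambda>x. u x + c * v x) \<in> H10 \<Omega>"
    "AE x in L\<Omega>. weak_grad \<Omega> (\<lambda>x. u x + c * v x) x = weak_grad \<Omega> u x + c *\<^sub>R weak_grad \<Omega> v x" by auto
qed

end

subsection \<open>The Sobolev and Poincare inequalities\<close>

locale sobolev_domain = bounded_domain \<Omega> for \<Omega> :: "'a::euclidean_space set" +
  fixes p :: real
  assumes p_eq: "p = crit_exp DIM('a)"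
begin

lemma p_gt_2: "p > 2"
  using crit_exp_props(1)[OF dim] by (simp add: p_eq)

section \<open>The Dirichlet form on \<open>H10\<close>\<close>

definition grad_norm :: "('a \<Rightarrow> real) \<Rightarrow> real" where
  "grad_norm u = L2_norm L\<Omega> (weak_grad \<Omega> u)"

lemma grad_norm_nonneg: "0 \<le> grad_norm u"
  by (simp add: grad_norm_def L2_norm_nonneg)

lemma dirichlet_energy_eq: "dirichlet_energy \<Omega> u = (grad_norm u)\<^sup>2"
  by (simp add: dirichlet_energy_def grad_norm_def L2_norm_sq)

lemma dirichlet_energy_form: "dirichlet_energy \<Omega> u = dirichlet_form \<Omega> u u"
  by (simp add: dirichlet_energy_def dirichlet_form_def power2_norm_eq_inner)

lemma dirichlet_energy_nonneg: "0 \<le> dirichlet_energy \<Omega> u"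
  by (simp add: dirichlet_energy_eq)

lemma dirichlet_form_commute: "dirichlet_form \<Omega> u v = dirichlet_form \<Omega> v u"
  by (simp add: dirichlet_form_def inner_commute)

lemma abs_dirichlet_form_le:
  assumes "u \<in> H10 \<Omega>" "v \<in> H10 \<Omega>"
  shows "\<bar>dirichlet_form \<Omega> u v\<bar> \<le> grad_norm u * grad_norm v"
  unfolding dirichlet_form_def grad_norm_def by (intro abs_integral_inner_le H10_L2 assms)

lemma dirichlet_form_add_scale:
  assumes "u \<in> H10 \<Omega>" "v \<in> H10 \<Omega>" "w \<in> H10 \<Omega>"
  shows "dirichlet_form \<Omega> (\<lambda>x. u x + c * v x) w = dirichlet_form \<Omega> u w + c * dirichlet_form \<Omega> v w"
proof -
  note L = assms[THEN H10_L2(2)]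
  note [measurable] = L[THEN sq_integrable_measurable] H10_L2(2)[OF H10_add_scale(1)[OF assms(1,2)], THEN sq_integrable_measurable]
  have "dirichlet_form \<Omega> (\<lambda>x. u x + c * v x) w =
    (LINT x|L\<Omega>. (weak_grad \<Omega> u x + c *\<^sub>R weak_grad \<Omega> v x) \<bullet> weak_grad \<Omega> w x)"
    unfolding dirichlet_form_def
    by (rule integral_cong_AE) (use H10_add_scale(2)[OF assms(1,2), of c] in \<open>measurable; auto\<close>)+
  also have "\<dots> = dirichlet_form \<Omega> u w + c * dirichlet_form \<Omega> v w"
    unfolding dirichlet_form_def using sq_integrable_inner[OF L(1,3)] sq_integrable_inner[OF L(2,3)]
    by (simp add: inner_add_left)
  finally show ?thesis .
qed

lemma dirichlet_energy_add_scale: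
  assumes "u \<in> H10 \<Omega>" "v \<in> H10 \<Omega>"
  shows "dirichlet_energy \<Omega> (\<lambda>x. u x + c * v x) =
    dirichlet_energy \<Omega> u + 2 * c * dirichlet_form \<Omega> u v + c\<^sup>2 * dirichlet_energy \<Omega> v"
proof -
  note h = H10_add_scale(1)[OF assms, of c]
  have "dirichlet_energy \<Omega> (\<lambda>x. u x + c * v x) =
    dirichlet_form \<Omega> u (\<lambda>x. u x + c * v x) + c * dirichlet_form \<Omega> v (\<lambda>x. u x + c * v x)"
    unfolding dirichlet_energy_form by (rule dirichlet_form_add_scale[OF assms h])
  also have "dirichlet_form \<Omega> u (\<lambda>x. u x + c * v x) = dirichlet_form \<Omega> u u + c * dirichlet_form \<Omega> v u"
    by (subst dirichlet_form_commute) (rule dirichlet_form_add_scale[OF assms assms(1)])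
  also have "dirichlet_form \<Omega> v (\<lambda>x. u x + c * v x) = dirichlet_form \<Omega> u v + c * dirichlet_form \<Omega> v v"
    by (subst dirichlet_form_commute) (rule dirichlet_form_add_scale[OF assms assms(2)])
  finally show ?thesis
    using dirichlet_form_commute[of u v] by (simp add: dirichlet_energy_form power2_eq_square algebra_simps)
qed

lemma H10_zero: "(\<lambda>x. 0) \<in> H10 \<Omega>"
  by (rule test_H10[OF test_functions_0])

lemma H10_scale: "u \<in> H10 \<Omega> \<Longrightarrow> (\<lambda>x. c * u x) \<in> H10 \<Omega>"
  using H10_add_scale(1)[OF H10_zero, of u c] by simp

lemma H10_diff: "u \<in> H10 \<Omega> \<Longrightarrow> v \<in> H10 \<Omega> \<Longrightarrow> (\<lambda>x. u x - v x) \<in> H10 \<Omega>"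
  using H10_add_scale(1)[of u v "-1"] by simp

lemma dirichlet_energy_zero: "dirichlet_energy \<Omega> (\<lambda>x. 0) = 0"
  \<comment> \<open>The gradient chosen for 0 is known only almost everywhere. With E the energy and
    B the form at 0, the scale factors 1 and -1 give E = 2 E + 2 B and E = 2 E - 2 B; hence E =
    0.\<close>
  using dirichlet_energy_add_scale[OF H10_zero H10_zero, of 1] dirichlet_energy_add_scale[OF H10_zero H10_zero, of "-1"]
  by simp

lemma dirichlet_form_zero: "v \<in> H10 \<Omega> \<Longrightarrow> dirichlet_form \<Omega> (\<lambda>x. 0) v = 0"
  using dirichlet_form_add_scale[OF H10_zero H10_zero, of v 1] by simp

lemma dirichlet_energy_scale:
  "u \<in> H10 \<Omega> \<Longrightarrow> dirichlet_energy \<Omega> (\<lambda>x. c * u x) = c\<^sup>2 * dirichlet_energy \<Omega> u"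
  using dirichlet_energy_add_scale[OF H10_zero, of u c] by (simp add: dirichlet_energy_zero dirichlet_form_zero)

lemma grad_norm_triangle:
  assumes "u \<in> H10 \<Omega>" "v \<in> H10 \<Omega>"
  shows "grad_norm (\<lambda>x. u x - v x) \<le> grad_norm u + grad_norm v"
proof (rule power2_le_imp_le)
  show "(grad_norm (\<lambda>x. u x - v x))\<^sup>2 \<le> (grad_norm u + grad_norm v)\<^sup>2"
    using dirichlet_energy_add_scale[OF assms, of "-1"] abs_dirichlet_form_le[OF assms]
    by (simp add: dirichlet_energy_eq power2_sum)
qed (simp add: grad_norm_nonneg)

lemma grad_norm_test:
  assumes "\<phi> \<in> test_functions \<Omega>"
  shows "grad_norm \<phi> = L2_norm L\<Omega> (grad \<phi>)"
  unfolding grad_norm_def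
  using test_H10(2)[OF assms] H10_L2(2)[OF test_H10(1)[OF assms]] test_functions_L2(2)[OF assms dom_sets]
  by (intro L2_norm_cong_AE) (auto dest: sq_integrable_measurable)

lemma grad_norm_test_diff:
  assumes "\<phi> \<in> test_functions \<Omega>" "v \<in> H10 \<Omega>"
  shows "grad_norm (\<lambda>x. \<phi> x - v x) = L2_norm L\<Omega> (\<lambda>x. grad \<phi> x - weak_grad \<Omega> v x)"
  unfolding grad_norm_def
proof (rule L2_norm_cong_AE)
  show "AE x in L\<Omega>. weak_grad \<Omega> (\<lambda>x. \<phi> x - v x) x = grad \<phi> x - weak_grad \<Omega> v x"
    using H10_add_scale(2)[OF test_H10(1)[OF assms(1)] assms(2), of "-1"] test_H10(2)[OF assms(1)]
    by eventually_elim simp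
qed (use H10_L2(2)[OF H10_diff[OF test_H10(1)[OF assms(1)] assms(2)]] H10_L2(2)[OF assms(2)]
    test_functions_L2(2)[OF assms(1) dom_sets] in \<open>auto dest: sq_integrable_measurable\<close>)

lemma H10_approx:
  assumes "u \<in> H10 \<Omega>" "e > 0"
  obtains \<phi> where "\<phi> \<in> test_functions \<Omega>" "L2_norm L\<Omega> (\<lambda>x. \<phi> x - u x) < e" "grad_norm (\<lambda>x. \<phi> x - u x) < e"
proof -
  obtain \<phi> where "approximates \<phi> u (weak_grad \<Omega> u)" using H10E[OF assms(1)] .
  then have a: "\<And>n. \<phi> n \<in> test_functions \<Omega>" "(\<lambda>n. L2_norm L\<Omega> (\<lambda>x. \<phi> n x - u x)) \<longlonglongrightarrow> 0"
    "(\<lambda>n. L2_norm L\<Omega> (\<lambda>x. grad (\<phi> n) x - weak_grad \<Omega> u x)) \<longlonglongrightarrow> 0" by (auto simp: approximates_def)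
  have "\<forall>\<^sub>F n in sequentially. L2_norm L\<Omega> (\<lambda>x. \<phi> n x - u x) < e \<and> L2_norm L\<Omega> (\<lambda>x. grad (\<phi> n) x - weak_grad \<Omega> u x) < e"
    using order_tendstoD(2)[OF a(2) assms(2)] order_tendstoD(2)[OF a(3) assms(2)] by eventually_elim auto
  then obtain n where "L2_norm L\<Omega> (\<lambda>x. \<phi> n x - u x) < e" "L2_norm L\<Omega> (\<lambda>x. grad (\<phi> n) x - weak_grad \<Omega> u x) < e"
    by (auto simp: eventually_sequentially)
  then show ?thesis using that[OF a(1)[of n]] grad_norm_test_diff[OF a(1)[of n] assms(1)] by simp
qed

text \<open>The Faber-Krahn constant for V = |\<Omega>| + 1; the summand 1 supplies the positivity
  of V.\<close>

definition poincare_const :: real where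
  "poincare_const = (real DIM('a))\<^sup>2 * (2 * (measure lebesgue \<Omega> + 1)) powr (2 / DIM('a))"

lemma poincare_const_pos: "poincare_const > 0"
proof -
  have "2 * (measure lebesgue \<Omega> + 1) > 0"
    by (rule mult_pos_pos[OF zero_less_numeral add_nonneg_pos[OF measure_nonneg zero_less_one]])
  then have "2 * (measure lebesgue \<Omega> + 1) \<noteq> 0" by (rule less_imp_neq[symmetric])
  then show ?thesis unfolding poincare_const_def
    by (intro mult_pos_pos powr_gt_zero[THEN iffD2]) simp_all
qed

lemma Poincare_test:
  assumes "\<phi> \<in> test_functions \<Omega>"
  shows "(L2_norm L\<Omega> \<phi>)\<^sup>2 \<le> poincare_const * (L2_norm L\<Omega> (grad \<phi>))\<^sup>2"
proof -
  note c = test_functions_Cc1[OF assms]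
  note [measurable] = Cc1_integrable(5)[OF c]
  have s: "{x. \<phi> x \<noteq> 0} \<in> sets borel" by measurable
  have "{x. \<phi> x \<noteq> 0} \<subseteq> \<Omega>" using test_functions_outside(1)[OF assms] by blast
  then have "measure lebesgue {x. \<phi> x \<noteq> 0} \<le> measure lebesgue \<Omega>"
    using s finite_dom dom_sets by (intro measure_mono_fmeasurable) (auto simp: fmeasurable_def)
  then have "measure lborel {x. \<phi> x \<noteq> 0} \<le> measure lebesgue \<Omega> + 1" using s by simp
  from Faber_Krahn[OF c this] show ?thesis
    using test_functions_L2(3,4)[OF assms dom_sets]
    by (simp add: L2_norm_sq poincare_const_def add_nonneg_pos)
qed

lemma approximates_tendsto:
  assumes "approximates \<phi> u G"
  shows "(\<lambda>n. L2_norm L\<Omega> (\<phi> n)) \<longlonglongrightarrow> L2_norm L\<Omega> u"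
    "(\<lambda>n. L2_norm L\<Omega> (grad (\<phi> n))) \<longlonglongrightarrow> L2_norm L\<Omega> G"
  using assms test_functions_L2(1,2)[OF _ dom_sets] by (auto simp: approximates_def intro!: L2_norm_tendsto)

lemma Poincare:
  assumes "u \<in> H10 \<Omega>"
  shows "(LINT x|L\<Omega>. (u x)\<^sup>2) \<le> poincare_const * dirichlet_energy \<Omega> u"
proof -
  obtain \<phi> where a: "approximates \<phi> u (weak_grad \<Omega> u)" using H10E[OF assms] .
  have "(L2_norm L\<Omega> u)\<^sup>2 \<le> poincare_const * (L2_norm L\<Omega> (weak_grad \<Omega> u))\<^sup>2"
  proof (rule LIMSEQ_le)
    show "(\<lambda>n. (L2_norm L\<Omega> (\<phi> n))\<^sup>2) \<longlonglongrightarrow> (L2_norm L\<Omega> u)\<^sup>2"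
      by (intro tendsto_intros approximates_tendsto[OF a])
    show "(\<lambda>n. poincare_const * (L2_norm L\<Omega> (grad (\<phi> n)))\<^sup>2) \<longlonglongrightarrow> poincare_const * (L2_norm L\<Omega> (weak_grad \<Omega> u))\<^sup>2"
      by (intro tendsto_intros approximates_tendsto[OF a])
  qed (use a Poincare_test in \<open>auto simp: approximates_def\<close>)
  then show ?thesis by (simp add: L2_norm_sq dirichlet_energy_def)
qed

lemma powr_abs_measurable:
  fixes u :: "'b \<Rightarrow> real"
  assumes [measurable]: "u \<in> borel_measurable M"
  shows "(\<lambda>x. \<bar>u x\<bar> powr q) \<in> borel_measurable M"
  by measurable

text \<open>For the approximating test functions the inequality is known on the whole space. Fatou
  along an almost everywhere convergent subsequence carries it over and also yields the
  integrability of |u|^p, which membership in \<open>H10\<close> does not state.\<close>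

lemma Sobolev_H10:
  "\<exists>C>0. \<forall>u\<in>H10 \<Omega>. integrable L\<Omega> (\<lambda>x. \<bar>u x\<bar> powr p) \<and>
    (LINT x|L\<Omega>. \<bar>u x\<bar> powr p) \<le> C * dirichlet_energy \<Omega> u powr (p / 2)"
proof -
  obtain C where C: "C > 0" "\<And>u::'a\<Rightarrow>real. u \<in> Cc1 \<Longrightarrow> integrable lborel (\<lambda>x. \<bar>u x\<bar> powr p) \<and>
    (LINT x|lborel. \<bar>u x\<bar> powr p) \<le> C * (LINT x|lborel. (norm (grad u x))\<^sup>2) powr (p / 2)"
    using Sobolev_Cc1[OF dim] by (auto simp: p_eq)
  have "integrable L\<Omega> (\<lambda>x. \<bar>u x\<bar> powr p) \<and>
    (LINT x|L\<Omega>. \<bar>u x\<bar> powr p) \<le> C * dirichlet_energy \<Omega> u powr (p / 2)" if u: "u \<in> H10 \<Omega>" for u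
  proof -
    obtain \<phi> where a: "approximates \<phi> u (weak_grad \<Omega> u)" using H10E[OF u] .
    then have t: "\<phi> n \<in> test_functions \<Omega>" for n by (simp add: approximates_def)
    have uL: "u \<in> sq_integrable L\<Omega>" by (rule H10_L2(1)[OF u])
    have "\<exists>r::nat\<Rightarrow>nat. strict_mono r \<and> (AE x in L\<Omega>. (\<lambda>n. \<phi> (r n) x) \<longlonglongrightarrow> u x)"
      using a t by (intro L2_AE_subseq uL test_functions_L2[OF t dom_sets]) (simp add: approximates_def)
    then obtain r where r: "strict_mono r" "AE x in L\<Omega>. (\<lambda>n. \<phi> (r n) x) \<longlonglongrightarrow> u x" by blast
    have phi: "integrable L\<Omega> (\<lambda>x. \<bar>\<phi> n x\<bar> powr p)"
      "(LINT x|L\<Omega>. \<bar>\<phi> n x\<bar> powr p) \<le> C * ((L2_norm L\<Omega> (grad (\<phi> n)))\<^sup>2) powr (p / 2)" for n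
    proof -
      note c = test_functions_Cc1[OF t[of n]]
      have m: "(\<lambda>x. \<bar>\<phi> n x\<bar> powr p) \<in> borel_measurable borel"
        by (rule powr_abs_measurable[OF Cc1_integrable(5)[OF c]])
      have z: "\<bar>\<phi> n x\<bar> powr p = 0" if "x \<notin> \<Omega>" for x
        using test_functions_outside(1)[OF t[of n] that] by simp
      show "integrable L\<Omega> (\<lambda>x. \<bar>\<phi> n x\<bar> powr p)"
        using C(2)[OF c] lebesgue_on_supported(2)[OF dom_sets m z] by simp
      show "(LINT x|L\<Omega>. \<bar>\<phi> n x\<bar> powr p) \<le> C * ((L2_norm L\<Omega> (grad (\<phi> n)))\<^sup>2) powr (p / 2)"
        using C(2)[OF c] lebesgue_on_supported(1)[OF dom_sets m z] test_functions_L2(4)[OF t[of n] dom_sets]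
        by (simp add: L2_norm_sq)
    qed
    have lim: "(\<lambda>n. C * ((L2_norm L\<Omega> (grad (\<phi> (r n))))\<^sup>2) powr (p / 2)) \<longlonglongrightarrow> C * dirichlet_energy \<Omega> u powr (p / 2)"
    proof -
      have "(\<lambda>n. C * ((L2_norm L\<Omega> (grad (\<phi> n)))\<^sup>2) powr (p / 2)) \<longlonglongrightarrow> C * ((L2_norm L\<Omega> (weak_grad \<Omega> u))\<^sup>2) powr (p / 2)"
        using p_gt_2 by (intro tendsto_mult tendsto_const tendsto_powr2 tendsto_power approximates_tendsto[OF a]) auto
      from LIMSEQ_subseq_LIMSEQ[OF this r(1)] show ?thesis
        by (simp add: o_def dirichlet_energy_def L2_norm_sq)
    qed
    have lp: "AE x in L\<Omega>. (\<lambda>n. \<bar>\<phi> (r n) x\<bar> powr p) \<longlonglongrightarrow> \<bar>u x\<bar> powr p"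
      using r(2) by eventually_elim (use p_gt_2 in \<open>auto intro!: tendsto_powr2 tendsto_rabs\<close>)
    have m: "(\<lambda>x. \<bar>u x\<bar> powr p) \<in> borel_measurable L\<Omega>"
      by (rule powr_abs_measurable[OF sq_integrable_measurable[OF uL]])
    \<comment> \<open>\<open>Fatou_bound\<close> wants one bound for a whole tail, while the right
      sides merely converge; hence the slack e, removed at the end.\<close>
    have key: "integrable L\<Omega> (\<lambda>x. \<bar>u x\<bar> powr p) \<and> (LINT x|L\<Omega>. \<bar>u x\<bar> powr p) \<le> C * dirichlet_energy \<Omega> u powr (p / 2) + e"
      if e: "e > 0" for e
    proof -
      obtain N where N: "\<And>n. n \<ge> N \<Longrightarrow> C * ((L2_norm L\<Omega> (grad (\<phi> (r n))))\<^sup>2) powr (p / 2) < C * dirichlet_energy \<Omega> u powr (p / 2) + e"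
        using order_tendstoD(2)[OF lim, of "C * dirichlet_energy \<Omega> u powr (p / 2) + e"] e
        by (auto simp: eventually_sequentially)
      have B: "(LINT x|L\<Omega>. \<bar>\<phi> (r n) x\<bar> powr p) \<le> C * dirichlet_energy \<Omega> u powr (p / 2) + e" if "n \<ge> N" for n
        using N[OF that] phi(2)[of "r n"] by linarith
      show ?thesis
        using Fatou_bound[OF m phi(1) _ lp B] by simp
    qed
    show ?thesis
      using key[of 1] key by (auto intro: field_le_epsilon)
  qed
  then show ?thesis using C(1) by blast
qed

lemma H10_powr_integrable: "u \<in> H10 \<Omega> \<Longrightarrow> integrable L\<Omega> (\<lambda>x. \<bar>u x\<bar> powr p)"
  using Sobolev_H10 by blast

lemma ae_eq_zero_iff:
  assumes "u \<in> H10 \<Omega>"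
  shows "ae_eq_on \<Omega> u (\<lambda>x. 0) \<longleftrightarrow> (LINT x|L\<Omega>. (u x)\<^sup>2) = 0"
    "ae_eq_on \<Omega> u (\<lambda>x. 0) \<longleftrightarrow> (LINT x|L\<Omega>. \<bar>u x\<bar> powr p) = 0"
proof -
  have "integrable L\<Omega> (\<lambda>x. (u x)\<^sup>2)" using sq_integrableD[OF H10_L2(1)[OF assms]] by simp
  from integral_nonneg_eq_0_iff_AE[OF this] show "ae_eq_on \<Omega> u (\<lambda>x. 0) \<longleftrightarrow> (LINT x|L\<Omega>. (u x)\<^sup>2) = 0"
    by (simp add: ae_eq_on_def)
  from integral_nonneg_eq_0_iff_AE[OF H10_powr_integrable[OF assms]]
  show "ae_eq_on \<Omega> u (\<lambda>x. 0) \<longleftrightarrow> (LINT x|L\<Omega>. \<bar>u x\<bar> powr p) = 0"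
    by (simp add: ae_eq_on_def)
qed

text \<open>A bump on a small cube. It makes the sets nonempty over which
  \<open>sobolev_const\<close> and the Rayleigh quotient take an infimum.\<close>

lemma H10_nonzero_test:
  obtains \<phi> where "\<phi> \<in> test_functions \<Omega>" "\<not> ae_eq_on \<Omega> \<phi> (\<lambda>x. 0)"
proof -
  obtain z where z: "z \<in> \<Omega>" using nonempty_dom by blast
  obtain e where e: "e > 0" "cball z e \<subseteq> \<Omega>" using open_contains_cball[of \<Omega>] open_dom z by blast
  \<comment> \<open>The cube of half side e / N lies in the ball of radius e, since the norm is at
    most the sum of the N absolute coordinates.\<close>
  define d where "d = e / real DIM('a)"
  have d: "d > 0" using e by (simp add: d_def)
  define l u where "l = z - d *\<^sub>R One" and "u = z + d *\<^sub>R One"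
  have sub: "cbox l u \<subseteq> \<Omega>"
  proof
    fix x assume x: "x \<in> cbox l u"
    have "norm (x - z) \<le> (\<Sum>b\<in>Basis. \<bar>(x - z) \<bullet> b\<bar>)" by (rule norm_le_l1)
    also have "\<dots> \<le> (\<Sum>b\<in>(Basis::'a set). d)"
      using x by (intro sum_mono) (auto simp: l_def u_def mem_box algebra_simps abs_le_iff)
    finally have "norm (x - z) \<le> e" by (simp add: d_def)
    then show "x \<in> \<Omega>" using e(2) by (auto simp: dist_norm norm_minus_commute)
  qed
  have t: "box_bump l u \<in> test_functions \<Omega>"
    by (rule test_functionsI[OF C_k_box_bump compact_cbox sub])
      (use box_subset_cbox in \<open>auto simp: box_bump_eq_0\<close>)
  have "\<not> ae_eq_on \<Omega> (box_bump l u) (\<lambda>x. 0)"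
  proof
    assume "ae_eq_on \<Omega> (box_bump l u) (\<lambda>x. 0)"
    then have "AE x in L\<Omega>. x \<notin> box l u" by (simp add: ae_eq_on_def box_bump_eq_0)
    then have "AE x in lebesgue. x \<in> \<Omega> \<longrightarrow> x \<notin> box l u"
      using dom_sets by (subst (asm) AE_restrict_space_iff) auto
    then have "AE x in lebesgue. x \<notin> box l u"
      by eventually_elim (use sub box_subset_cbox in blast)
    then have "negligible (box l u)"
      using AE_iff_null_sets[of "box l u" lebesgue] by (simp add: negligible_iff_null_sets)
    then have "box l u = {}" using negligible_interval(2) by blast
    then show False using d by (auto simp: box_eq_empty l_def u_def inner_diff_left inner_add_left)
  qed
  with t show ?thesis by (rule that)
qed

definition S :: real where "S = sobolev_const \<Omega>"

text \<open>The infimum gives S P^(2/p) <= D, with P the integral of |u|^p and D the Dirichlet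
  energy. Raising this to the power p/2 and dividing by S^(p/2) uses S > 0, and that positivity is
  what \<open>Sobolev_H10\<close> contributes.\<close>

lemma Sobolev_S:
  assumes u: "u \<in> H10 \<Omega>"
  shows "(LINT x|L\<Omega>. \<bar>u x\<bar> powr p) \<le> S powr (- p / 2) * dirichlet_energy \<Omega> u powr (p / 2)"
proof -
  define R where "R u = dirichlet_energy \<Omega> u / (LINT x|L\<Omega>. \<bar>u x\<bar> powr p) powr (2 / p)" for u
  obtain C where C: "C > 0" "\<And>u. u \<in> H10 \<Omega> \<Longrightarrow> (LINT x|L\<Omega>. \<bar>u x\<bar> powr p) \<le> C * dirichlet_energy \<Omega> u powr (p / 2)"
    using Sobolev_H10 by auto
  have pos: "(LINT x|L\<Omega>. \<bar>u x\<bar> powr p) > 0" if "u \<in> H10_nonzero \<Omega>" for u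
  proof -
    have "(LINT x|L\<Omega>. \<bar>u x\<bar> powr p) \<ge> 0" by (intro Bochner_Integration.integral_nonneg) auto
    moreover have "(LINT x|L\<Omega>. \<bar>u x\<bar> powr p) \<noteq> 0"
      using that ae_eq_zero_iff(2)[of u] by (auto simp: H10_nonzero_def)
    ultimately show ?thesis by linarith
  qed
  have lower: "C powr (- 2 / p) \<le> R u" if u: "u \<in> H10_nonzero \<Omega>" for u
  proof -
    define P where "P = (LINT x|L\<Omega>. \<bar>u x\<bar> powr p)"
    have P: "P > 0" using pos[OF u] by (simp add: P_def)
    have "P \<le> C * dirichlet_energy \<Omega> u powr (p / 2)" using C(2) u by (auto simp: P_def H10_nonzero_def)
    then have "P powr (2 / p) \<le> (C * dirichlet_energy \<Omega> u powr (p / 2)) powr (2 / p)"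
      using P p_gt_2 by (intro powr_mono2) auto
    also have "\<dots> = C powr (2 / p) * dirichlet_energy \<Omega> u"
      using C(1) p_gt_2 dirichlet_energy_nonneg[of u] by (simp add: powr_mult powr_powr)
    finally have "C powr (- 2 / p) * P powr (2 / p) \<le> C powr (- 2 / p) * (C powr (2 / p) * dirichlet_energy \<Omega> u)"
      by (intro mult_left_mono) auto
    also have "\<dots> = dirichlet_energy \<Omega> u" using C(1) by (simp add: powr_minus mult.assoc[symmetric] flip: powr_add)
    finally show ?thesis using P by (simp add: R_def P_def[symmetric] field_simps)
  qed
  have Seq: "S = (INF u\<in>H10_nonzero \<Omega>. R u)" by (simp add: S_def sobolev_const_def R_def p_eq)
  obtain \<phi> where "\<phi> \<in> test_functions \<Omega>" "\<not> ae_eq_on \<Omega> \<phi> (\<lambda>x. 0)" using H10_nonzero_test .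
  then have ne: "H10_nonzero \<Omega> \<noteq> {}" using test_H10(1) by (auto simp: H10_nonzero_def)
  have "C powr (- 2 / p) \<le> S" unfolding Seq by (rule cINF_greatest[OF ne lower])
  then have Sp: "S > 0" using C(1) by (smt (verit) powr_gt_zero)
  show ?thesis
  proof (cases "ae_eq_on \<Omega> u (\<lambda>x. 0)")
    case True
    then show ?thesis using ae_eq_zero_iff(2)[OF u] by simp
  next
    case False
    then have nz: "u \<in> H10_nonzero \<Omega>" using u by (simp add: H10_nonzero_def)
    define P where "P = (LINT x|L\<Omega>. \<bar>u x\<bar> powr p)"
    have P: "P > 0" using pos[OF nz] by (simp add: P_def)
    have "S \<le> R u" unfolding Seq by (rule cINF_lower[OF bdd_belowI2[OF lower] nz])
    then have "S * P powr (2 / p) \<le> dirichlet_energy \<Omega> u" using P by (simp add: R_def P_def field_simps)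
    then have "(S * P powr (2 / p)) powr (p / 2) \<le> dirichlet_energy \<Omega> u powr (p / 2)"
      using Sp p_gt_2 by (intro powr_mono2) auto
    then have "S powr (p / 2) * P \<le> dirichlet_energy \<Omega> u powr (p / 2)"
      using Sp P p_gt_2 by (simp add: powr_mult powr_powr)
    then have "S powr (- p / 2) * (S powr (p / 2) * P) \<le> S powr (- p / 2) * dirichlet_energy \<Omega> u powr (p / 2)"
      by (intro mult_left_mono) auto
    moreover have "S powr (- p / 2) * (S powr (p / 2) * P) = P"
      using Sp by (simp add: mult.assoc[symmetric] flip: powr_add)
    ultimately show ?thesis unfolding P_def by linarith
  qed
qed

end

subsection \<open>Compactness\<close>

text \<open>Left without the factor r^(-N), so that it is literally the inner integral of
  \<open>Cc1_average_inequality\<close>.\<close>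

definition box_avg :: "real \<Rightarrow> ('a::euclidean_space \<Rightarrow> real) \<Rightarrow> 'a \<Rightarrow> real" where
  "box_avg r f x = (LINT h|lborel. indicator (cbox 0 (r *\<^sub>R One)) h * f (x + h))"

lemma measure_cube: "r > 0 \<Longrightarrow> measure lborel (cbox (0::'a::euclidean_space) (r *\<^sub>R One)) = r ^ DIM('a)"
  by (simp add: measure_lborel_cbox_eq)

lemma cube_sq_integrable:
  "(indicator (cbox (0::'a::euclidean_space) (r *\<^sub>R One)) :: 'a \<Rightarrow> real) \<in> sq_integrable lborel"
  "r > 0 \<Longrightarrow> L2_norm lborel (indicator (cbox (0::'a::euclidean_space) (r *\<^sub>R One)) :: 'a \<Rightarrow> real) = sqrt (r ^ DIM('a))"
proof -
  have eq: "(\<lambda>x. (norm (indicator (cbox (0::'a) (r *\<^sub>R One)) x :: real))\<^sup>2) = indicator (cbox 0 (r *\<^sub>R One))"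
    by (auto simp: indicator_def)
  show "(indicator (cbox (0::'a::euclidean_space) (r *\<^sub>R One)) :: 'a \<Rightarrow> real) \<in> sq_integrable lborel"
    unfolding sq_integrable_def mem_Collect_eq eq by (auto intro!: emeasure_lborel_cbox_finite)
  show "L2_norm lborel (indicator (cbox (0::'a::euclidean_space) (r *\<^sub>R One)) :: 'a \<Rightarrow> real) = sqrt (r ^ DIM('a))" if "r > 0"
    unfolding L2_norm_def eq using measure_cube[OF that, where 'a='a] by simp
qed

lemma Cc1_shift_sq_integrable:
  assumes "f \<in> Cc1" shows "(\<lambda>h. f (x + h)) \<in> sq_integrable lborel"
    "(LINT h|lborel. (f (x + h))\<^sup>2) = (LINT h|lborel. (f h)\<^sup>2)"
proof -
  note [measurable] = Cc1_integrable(5)[OF assms]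
  have "integrable lborel (\<lambda>h. (f (h + x))\<^sup>2)"
    using lborel_integrable_shift[OF sq_integrableD[OF Cc1_integrable(3)[OF assms]], of x] by simp
  then show "(\<lambda>h. f (x + h)) \<in> sq_integrable lborel"
    by (auto simp: sq_integrable_def add.commute)
  show "(LINT h|lborel. (f (x + h))\<^sup>2) = (LINT h|lborel. (f h)\<^sup>2)"
    using lborel_integral_shift[of "\<lambda>x. (f x)\<^sup>2" x] by (simp add: add.commute)
qed

lemma box_avg_integrable:
  assumes "f \<in> Cc1"
  shows "integrable lborel (\<lambda>h. indicator (cbox 0 (r *\<^sub>R One)) h * f (x + h))"
  by (intro sq_integrable_mult cube_sq_integrable Cc1_shift_sq_integrable assms)

lemma box_avg_diff:
  assumes "f \<in> Cc1" "g \<in> Cc1"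
  shows "box_avg r (\<lambda>x. f x - g x) x = box_avg r f x - box_avg r g x"
  unfolding box_avg_def using box_avg_integrable[OF assms(1)] box_avg_integrable[OF assms(2)]
  by (simp add: right_diff_distrib)

lemma box_avg_bound:
  fixes f :: "'a::euclidean_space \<Rightarrow> real"
  assumes "f \<in> Cc1" "r > 0"
  shows "\<bar>box_avg r f x\<bar> \<le> sqrt (r ^ DIM('a)) * L2_norm lborel f"
  using abs_integral_mult_le[OF cube_sq_integrable(1)[of r] Cc1_shift_sq_integrable(1)[OF assms(1), of x]]
    cube_sq_integrable(2)[OF assms(2), where 'a='a] Cc1_shift_sq_integrable(2)[OF assms(1), of x]
  by (simp add: box_avg_def L2_norm_def)

text \<open>Moving x translates f, so the shift estimate controls the change by the L2 norm of the
  gradient. Box averages of a family bounded in energy are therefore equi-Lipschitz, which is the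
  source of compactness below.\<close>

lemma box_avg_lipschitz:
  fixes f :: "'a::euclidean_space \<Rightarrow> real"
  assumes "f \<in> Cc1" "r > 0"
  shows "\<bar>box_avg r f x - box_avg r f y\<bar> \<le> sqrt (r ^ DIM('a)) * (norm (x - y) * L2_norm lborel (grad f))"
proof -
  note [measurable] = Cc1_integrable(5)[OF assms(1)]
  note s = Cc1_shift_sq_integrable(1)[OF assms(1)]
  have "box_avg r f x - box_avg r f y = (LINT h|lborel. indicator (cbox 0 (r *\<^sub>R One)) h * (f (x + h) - f (y + h)))"
    unfolding box_avg_def using box_avg_integrable[OF assms(1)] by (simp add: right_diff_distrib)
  also have "\<bar>\<dots>\<bar> \<le> sqrt (r ^ DIM('a)) * L2_norm lborel (\<lambda>h. f (x + h) - f (y + h))"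
    using abs_integral_mult_le[OF cube_sq_integrable(1)[of r] sq_integrable_diff[OF s[of x] s[of y]]]
      cube_sq_integrable(2)[OF assms(2), where 'a='a] by simp
  also have "L2_norm lborel (\<lambda>h. f (x + h) - f (y + h)) \<le> norm (x - y) * L2_norm lborel (grad f)"
  proof -
    have "(LINT h|lborel. (f (x + h) - f (y + h))\<^sup>2) = (LINT h|lborel. (f (h + (x - y)) - f h)\<^sup>2)"
      using lborel_integral_shift[of "\<lambda>z. (f (z + (x - y)) - f z)\<^sup>2" y] by (simp add: algebra_simps)
    also have "\<dots> \<le> (norm (x - y))\<^sup>2 * (LINT x|lborel. (norm (grad f x))\<^sup>2)"
      by (rule Cc1_shift_L2[OF assms(1)])
    finally have "sqrt (LINT h|lborel. (f (x + h) - f (y + h))\<^sup>2) \<le> sqrt ((norm (x - y))\<^sup>2 * (LINT x|lborel. (norm (grad f x))\<^sup>2))"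
      by (rule real_sqrt_le_mono)
    then show ?thesis by (simp add: L2_norm_def real_sqrt_mult)
  qed
  finally show ?thesis by (simp add: mult_left_mono assms(2) less_imp_le)
qed

lemma box_avg_measurable:
  fixes f :: "'a::euclidean_space \<Rightarrow> real"
  assumes "f \<in> Cc1" "r > 0" shows "box_avg r f \<in> borel_measurable borel"
proof (rule borel_measurable_continuous_onI)
  define M where "M = sqrt (r ^ DIM('a)) * L2_norm lborel (grad f)"
  have "M-lipschitz_on UNIV (box_avg r f)"
  proof (rule lipschitz_onI)
    show "dist (box_avg r f x) (box_avg r f y) \<le> M * dist x y" for x y
      using box_avg_lipschitz[OF assms, of x y] by (simp add: dist_norm M_def mult_ac)
    show "0 \<le> M" using assms(2) by (simp add: M_def L2_norm_nonneg)
  qed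
  then show "continuous_on UNIV (box_avg r f)" by (rule lipschitz_on_continuous_on)
qed

context sobolev_domain
begin

text \<open>An inequality of Ehrling type: up to a gradient term that is small with r, the L2 norm
  is controlled by that of the box average, which has better compactness.\<close>

lemma test_box_avg_inequality:
  assumes \<phi>: "\<phi> \<in> test_functions \<Omega>" and r: "r > 0"
  shows "(L2_norm L\<Omega> \<phi>)\<^sup>2 \<le> (real DIM('a))\<^sup>2 * r\<^sup>2 * (L2_norm L\<Omega> (grad \<phi>))\<^sup>2 / 2
    + L2_norm L\<Omega> \<phi> * L2_norm L\<Omega> (box_avg r \<phi>) / r ^ DIM('a)"
    "box_avg r \<phi> \<in> sq_integrable L\<Omega>"
proof -
  note c = test_functions_Cc1[OF \<phi>]
  note [measurable] = Cc1_integrable(5)[OF c] box_avg_measurable[OF c r]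
  note L = test_functions_L2[OF \<phi> dom_sets]
  have m: "box_avg r \<phi> \<in> borel_measurable L\<Omega>"
    by (rule borel_measurable_lebesgue_on[OF box_avg_measurable[OF c r]])
  have "integrable L\<Omega> (\<lambda>x. (norm (box_avg r \<phi> x))\<^sup>2)"
  proof (rule integrable_const_bound)
    show "AE x in L\<Omega>. norm ((norm (box_avg r \<phi> x))\<^sup>2) \<le> (sqrt (r ^ DIM('a)) * L2_norm lborel \<phi>)\<^sup>2"
      using box_avg_bound[OF c r] by (intro AE_I2) (simp add: abs_le_square_iff[symmetric] abs_mult L2_norm_nonneg r less_imp_le)
  qed (use m in measurable)
  then show A: "box_avg r \<phi> \<in> sq_integrable L\<Omega>" using m by (simp add: sq_integrable_def)
  have "(LINT x|lborel. \<phi> x * box_avg r \<phi> x) = (LINT x|L\<Omega>. \<phi> x * box_avg r \<phi> x)"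
    by (rule lebesgue_on_supported(1)[symmetric, OF dom_sets]) (use test_functions_outside(1)[OF \<phi>] in auto)
  also have "\<dots> \<le> L2_norm L\<Omega> \<phi> * L2_norm L\<Omega> (box_avg r \<phi>)"
    using abs_integral_mult_le[OF L(1) A] by linarith
  finally have "r ^ DIM('a) * (L2_norm L\<Omega> \<phi>)\<^sup>2 \<le>
      r ^ DIM('a) * ((real DIM('a))\<^sup>2 * r\<^sup>2 * (L2_norm L\<Omega> (grad \<phi>))\<^sup>2 / 2) + L2_norm L\<Omega> \<phi> * L2_norm L\<Omega> (box_avg r \<phi>)"
    using Cc1_average_inequality[OF c r] L(3,4) by (simp add: L2_norm_sq box_avg_def mult.assoc)
  also have "\<dots> = r ^ DIM('a) * ((real DIM('a))\<^sup>2 * r\<^sup>2 * (L2_norm L\<Omega> (grad \<phi>))\<^sup>2 / 2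
    + L2_norm L\<Omega> \<phi> * L2_norm L\<Omega> (box_avg r \<phi>) / r ^ DIM('a))"
    using r by (simp add: distrib_left)
  finally show "(L2_norm L\<Omega> \<phi>)\<^sup>2 \<le> (real DIM('a))\<^sup>2 * r\<^sup>2 * (L2_norm L\<Omega> (grad \<phi>))\<^sup>2 / 2
    + L2_norm L\<Omega> \<phi> * L2_norm L\<Omega> (box_avg r \<phi>) / r ^ DIM('a)"
    by (rule mult_left_le_imp_le) (use r in simp)
qed

text \<open>The averages at the scales \<rho> k are bounded and equi-Lipschitz. One subsequence
  converges for all k on a countable dense set, hence at every point, hence in L2 by dominated
  convergence on the bounded domain. Then \<open>test_box_avg_inequality\<close>, applied to
  differences, makes the functions themselves Cauchy.\<close>

lemma Rellich_test:
  assumes \<phi>: "\<And>n. \<phi> n \<in> test_functions \<Omega>" and B: "\<And>n. L2_norm L\<Omega> (grad (\<phi> n)) \<le> B"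
  shows "\<exists>r::nat\<Rightarrow>nat. \<exists>u\<in>sq_integrable L\<Omega>. strict_mono r \<and> (\<lambda>n. L2_norm L\<Omega> (\<lambda>x. \<phi> (r n) x - u x)) \<longlonglongrightarrow> 0"
proof -
  note c = test_functions_Cc1[OF \<phi>]
  note L = test_functions_L2[OF \<phi> dom_sets]
  have B0: "B \<ge> 0" using B[of 0] L2_norm_nonneg[of L\<Omega> "grad (\<phi> 0)"] by linarith
  define P where "P = sqrt poincare_const * B"
  have P0: "P \<ge> 0" using B0 poincare_const_pos by (simp add: P_def)
  have P: "L2_norm L\<Omega> (\<phi> n) \<le> P" for n
  proof (rule power2_le_imp_le)
    have "(L2_norm L\<Omega> (\<phi> n))\<^sup>2 \<le> poincare_const * (L2_norm L\<Omega> (grad (\<phi> n)))\<^sup>2" by (rule Poincare_test[OF \<phi>])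
    also have "\<dots> \<le> poincare_const * B\<^sup>2"
      using B[of n] poincare_const_pos by (intro mult_left_mono power_mono L2_norm_nonneg) auto
    finally show "(L2_norm L\<Omega> (\<phi> n))\<^sup>2 \<le> P\<^sup>2" using poincare_const_pos by (simp add: P_def power_mult_distrib)
  qed (rule P0)
  have eqL: "L2_norm lborel (\<phi> n) = L2_norm L\<Omega> (\<phi> n)" "L2_norm lborel (grad (\<phi> n)) = L2_norm L\<Omega> (grad (\<phi> n))" for n
    using L(3,4)[of n] by (simp_all add: L2_norm_def)
  define \<rho> where "\<rho> k = 1 / real (Suc k)" for k
  have \<rho>: "\<rho> k > 0" "\<rho> k \<le> 1" for k by (auto simp: \<rho>_def)
  have \<rho>N: "sqrt (\<rho> k ^ DIM('a)) \<le> 1" for k using \<rho>[of k] by (simp add: power_le_one less_imp_le)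
  obtain T :: "'a set" where T: "countable T" "\<And>U. open U \<Longrightarrow> U \<noteq> {} \<Longrightarrow> \<exists>d\<in>T. d \<in> U"
    by (rule countable_dense_setE) blast
  have ab: "\<bar>box_avg (\<rho> k) (\<phi> n) x\<bar> \<le> P" for k n x
  proof -
    have "\<bar>box_avg (\<rho> k) (\<phi> n) x\<bar> \<le> sqrt (\<rho> k ^ DIM('a)) * L2_norm L\<Omega> (\<phi> n)"
      using box_avg_bound[OF c \<rho>(1)] by (simp add: eqL)
    also have "\<dots> \<le> 1 * P" by (intro mult_mono \<rho>N P L2_norm_nonneg) auto
    finally show ?thesis by simp
  qed
  have al: "\<bar>box_avg (\<rho> k) (\<phi> n) x - box_avg (\<rho> k) (\<phi> n) y\<bar> \<le> norm (x - y) * B" for k n x y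
  proof -
    have "\<bar>box_avg (\<rho> k) (\<phi> n) x - box_avg (\<rho> k) (\<phi> n) y\<bar> \<le> sqrt (\<rho> k ^ DIM('a)) * (norm (x - y) * L2_norm L\<Omega> (grad (\<phi> n)))"
      using box_avg_lipschitz[OF c \<rho>(1)] by (simp add: eqL)
    also have "\<dots> \<le> 1 * (norm (x - y) * B)" by (intro mult_mono \<rho>N B) (auto simp: L2_norm_nonneg)
    finally show ?thesis by simp
  qed
  \<comment> \<open>Scale and point form one countable index set, so that a single diagonal
    subsequence serves all scales.\<close>
  have "countable (UNIV \<times> T :: (nat \<times> 'a) set)" using T(1) by auto
  then obtain r where r: "strict_mono r" "\<And>z. z \<in> UNIV \<times> T \<Longrightarrow> \<exists>l. (\<lambda>n. box_avg (\<rho> (fst z)) (\<phi> (r n)) (snd z)) \<longlonglongrightarrow> l"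
    by (rule function_convergent_subsequence[where f="\<lambda>n z. box_avg (\<rho> (fst z)) (\<phi> n) (snd z)" and M=P])
      (use ab in auto)
  have conv: "convergent (\<lambda>n. box_avg (\<rho> k) (\<phi> (r n)) x)" for k x
  proof (rule Cauchy_convergent, rule metric_CauchyI)
    fix e :: real assume e: "e > 0"
    \<comment> \<open>B + 1 instead of B, since B may be 0.\<close>
    define d where "d = e / (3 * (B + 1))"
    have d: "d > 0" using e B0 by (simp add: d_def)
    obtain y where y: "y \<in> T" "y \<in> ball x d" using T(2)[of "ball x d"] d by auto
    have dB: "norm (x - y) * B \<le> e / 3"
    proof -
      have "norm (x - y) * B \<le> d * (B + 1)" using y(2) B0 d by (intro mult_mono) (auto simp: dist_norm)
      also have "\<dots> = e / 3" using B0 by (simp add: d_def field_simps)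
      finally show ?thesis .
    qed
    have "Cauchy (\<lambda>n. box_avg (\<rho> k) (\<phi> (r n)) y)"
      using r(2)[of "(k, y)"] y(1) by (auto simp: LIMSEQ_imp_Cauchy)
    then obtain M where M: "\<And>m n. m \<ge> M \<Longrightarrow> n \<ge> M \<Longrightarrow> dist (box_avg (\<rho> k) (\<phi> (r m)) y) (box_avg (\<rho> k) (\<phi> (r n)) y) < e / 3"
      using metric_CauchyD[of _ "e / 3"] e by (metis divide_pos_pos zero_less_numeral)
    have "dist (box_avg (\<rho> k) (\<phi> (r m)) x) (box_avg (\<rho> k) (\<phi> (r n)) x) < e" if "m \<ge> M" "n \<ge> M" for m n
      using M[OF that] al[of k "r m" x y] al[of k "r n" x y] dB unfolding dist_real_def by linarith
    then show "\<exists>M. \<forall>m\<ge>M. \<forall>n\<ge>M. dist (box_avg (\<rho> k) (\<phi> (r m)) x) (box_avg (\<rho> k) (\<phi> (r n)) x) < e" by blast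
  qed
  define \<alpha> where "\<alpha> k x = lim (\<lambda>n. box_avg (\<rho> k) (\<phi> (r n)) x)" for k x
  have lim: "(\<lambda>n. box_avg (\<rho> k) (\<phi> (r n)) x) \<longlonglongrightarrow> \<alpha> k x" for k x
    using conv by (simp add: \<alpha>_def convergent_LIMSEQ_iff)
  have mA: "box_avg (\<rho> k) (\<phi> n) \<in> borel_measurable L\<Omega>" for k n
    by (rule borel_measurable_lebesgue_on[OF box_avg_measurable[OF c \<rho>(1)]])
  note LA = test_box_avg_inequality(2)[OF \<phi> \<rho>(1)]
  have m\<alpha>: "\<alpha> k \<in> borel_measurable L\<Omega>" for k
    by (rule borel_measurable_LIMSEQ_real[OF lim mA])
  have \<alpha>P: "\<bar>\<alpha> k x\<bar> \<le> P" for k x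
    by (rule LIMSEQ_le_const2[OF tendsto_rabs[OF lim]]) (use ab in auto)
  have L\<alpha>: "\<alpha> k \<in> sq_integrable L\<Omega>" for k
  proof -
    have "integrable L\<Omega> (\<lambda>x. (norm (\<alpha> k x))\<^sup>2)"
    proof (rule integrable_const_bound)
      show "AE x in L\<Omega>. norm ((norm (\<alpha> k x))\<^sup>2) \<le> P\<^sup>2"
        using \<alpha>P[of k] P0 by (intro AE_I2) (simp add: abs_le_square_iff[symmetric])
    qed (use m\<alpha> in measurable)
    then show ?thesis using m\<alpha> by (simp add: sq_integrable_def)
  qed
  have Alim: "(\<lambda>n. L2_norm L\<Omega> (\<lambda>x. box_avg (\<rho> k) (\<phi> (r n)) x - \<alpha> k x)) \<longlonglongrightarrow> 0" for k
  proof -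
    have "(\<lambda>n. LINT x|L\<Omega>. (norm (box_avg (\<rho> k) (\<phi> (r n)) x - \<alpha> k x))\<^sup>2) \<longlonglongrightarrow> (LINT x|L\<Omega>. 0)"
    proof (rule integral_dominated_convergence[where w="\<lambda>x. (2 * P)\<^sup>2"])
      show "AE x in L\<Omega>. (\<lambda>n. (norm (box_avg (\<rho> k) (\<phi> (r n)) x - \<alpha> k x))\<^sup>2) \<longlonglongrightarrow> 0"
        using lim[of k] by (intro AE_I2) (auto intro!: tendsto_eq_intros LIM_zero)
      show "AE x in L\<Omega>. norm ((norm (box_avg (\<rho> k) (\<phi> (r n)) x - \<alpha> k x))\<^sup>2) \<le> (2 * P)\<^sup>2" for n
      proof (rule AE_I2)
        fix x
        have "\<bar>box_avg (\<rho> k) (\<phi> (r n)) x - \<alpha> k x\<bar> \<le> 2 * P" using ab[of k "r n" x] \<alpha>P[of k x] by linarith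
        then show "norm ((norm (box_avg (\<rho> k) (\<phi> (r n)) x - \<alpha> k x))\<^sup>2) \<le> (2 * P)\<^sup>2"
          using power_mono[of "\<bar>box_avg (\<rho> k) (\<phi> (r n)) x - \<alpha> k x\<bar>" "2 * P" 2] by simp
      qed
    qed (auto intro!: borel_measurable_power borel_measurable_norm borel_measurable_diff mA m\<alpha>)
    then have "(\<lambda>n. sqrt (LINT x|L\<Omega>. (norm (box_avg (\<rho> k) (\<phi> (r n)) x - \<alpha> k x))\<^sup>2)) \<longlonglongrightarrow> sqrt 0"
      by (intro tendsto_real_sqrt) simp
    then show ?thesis by (simp add: L2_norm_def)
  qed
  have cauchy: "\<exists>N. \<forall>i\<ge>N. \<forall>j\<ge>N. L2_norm L\<Omega> (\<lambda>x. \<phi> (r i) x - \<phi> (r j) x) < e" if e: "e > 0" for e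
  proof -
    \<comment> \<open>The scale is fixed first: k makes the gradient term small for all pairs at
      once, because differences have gradient norm at most 2 B. Only then is N chosen, for this
      k.\<close>
    have "(\<lambda>k. (real DIM('a))\<^sup>2 * (\<rho> k)\<^sup>2 * (2 * B)\<^sup>2 / 2) \<longlonglongrightarrow> (real DIM('a))\<^sup>2 * 0\<^sup>2 * (2 * B)\<^sup>2 / 2"
      unfolding \<rho>_def by (intro tendsto_intros LIMSEQ_Suc lim_1_over_n) auto
    then have "(\<lambda>k. (real DIM('a))\<^sup>2 * (\<rho> k)\<^sup>2 * (2 * B)\<^sup>2 / 2) \<longlonglongrightarrow> 0" by simp
    then have "\<forall>\<^sub>F k in sequentially. (real DIM('a))\<^sup>2 * (\<rho> k)\<^sup>2 * (2 * B)\<^sup>2 / 2 < e\<^sup>2 / 2"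
      by (rule order_tendstoD(2)) (use e in simp)
    then obtain k where k: "(real DIM('a))\<^sup>2 * (\<rho> k)\<^sup>2 * (2 * B)\<^sup>2 / 2 < e\<^sup>2 / 2"
      using eventually_happens'[OF sequentially_bot] by blast
    define Q where "Q = P + 1"
    have Q: "Q > 0" "P \<le> Q" using P0 by (auto simp: Q_def)
    \<comment> \<open>Chosen so that (2 Q) (2 \<delta>) / \<rho> k ^ N = e^2 / 2, where N is the
      dimension.\<close>
    define \<delta> where "\<delta> = e\<^sup>2 / 2 * \<rho> k ^ DIM('a) / (4 * Q)"
    have \<delta>: "\<delta> > 0" using e \<rho>[of k] Q by (simp add: \<delta>_def)
    obtain N where N: "\<And>n. n \<ge> N \<Longrightarrow> L2_norm L\<Omega> (\<lambda>x. box_avg (\<rho> k) (\<phi> (r n)) x - \<alpha> k x) < \<delta>"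
      using order_tendstoD(2)[OF Alim[of k] \<delta>] by (auto simp: eventually_sequentially)
    have "L2_norm L\<Omega> (\<lambda>x. \<phi> (r i) x - \<phi> (r j) x) < e" if ij: "i \<ge> N" "j \<ge> N" for i j
    proof -
      define w where "w x = \<phi> (r i) x - \<phi> (r j) x" for x
      have w: "w \<in> test_functions \<Omega>" unfolding w_def by (intro test_functions_diff \<phi>)
      have gw: "grad w = (\<lambda>x. grad (\<phi> (r i)) x - grad (\<phi> (r j)) x)"
        unfolding w_def using Cc1_diff(2)[OF c c] by blast
      have "L2_norm L\<Omega> (grad w) \<le> L2_norm L\<Omega> (grad (\<phi> (r i))) + L2_norm L\<Omega> (grad (\<phi> (r j)))"
        using L2_norm_triangle[OF L(2) sq_integrable_scaleR[OF L(2)], of "r i" "-1" "r j"] L2_norm_scaleR[of L\<Omega> "-1" "grad (\<phi> (r j))"]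
        by (simp add: gw)
      then have g2: "(L2_norm L\<Omega> (grad w))\<^sup>2 \<le> (2 * B)\<^sup>2"
        using B[of "r i"] B[of "r j"] by (intro power_mono L2_norm_nonneg) linarith
      have w2: "L2_norm L\<Omega> w \<le> 2 * P"
        using L2_norm_triangle[OF L(1) sq_integrable_scaleR[OF L(1)], of "r i" "-1" "r j"] L2_norm_scaleR[of L\<Omega> "-1" "\<phi> (r j)"]
          P[of "r i"] P[of "r j"] by (simp add: w_def[abs_def])
      have A2: "L2_norm L\<Omega> (box_avg (\<rho> k) w) \<le> 2 * \<delta>"
      proof -
        have "box_avg (\<rho> k) w = (\<lambda>x. box_avg (\<rho> k) (\<phi> (r i)) x - box_avg (\<rho> k) (\<phi> (r j)) x)"
          unfolding w_def using box_avg_diff[OF c c] by blast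
        then have "L2_norm L\<Omega> (box_avg (\<rho> k) w) \<le> L2_norm L\<Omega> (\<lambda>x. box_avg (\<rho> k) (\<phi> (r i)) x - \<alpha> k x) + L2_norm L\<Omega> (\<lambda>x. \<alpha> k x - box_avg (\<rho> k) (\<phi> (r j)) x)"
          using L2_norm_triangle_diff[OF LA L\<alpha> LA] by simp
        then show ?thesis using N[OF ij(1)] N[OF ij(2)] L2_norm_diff_commute[of L\<Omega> "\<alpha> k" "box_avg (\<rho> k) (\<phi> (r j))"] by simp
      qed
      have "(L2_norm L\<Omega> w)\<^sup>2 \<le> (real DIM('a))\<^sup>2 * (\<rho> k)\<^sup>2 * (L2_norm L\<Omega> (grad w))\<^sup>2 / 2
        + L2_norm L\<Omega> w * L2_norm L\<Omega> (box_avg (\<rho> k) w) / \<rho> k ^ DIM('a)"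
        by (rule test_box_avg_inequality(1)[OF w \<rho>(1)])
      also have "(real DIM('a))\<^sup>2 * (\<rho> k)\<^sup>2 * (L2_norm L\<Omega> (grad w))\<^sup>2 / 2 \<le> (real DIM('a))\<^sup>2 * (\<rho> k)\<^sup>2 * (2 * B)\<^sup>2 / 2"
        using g2 by (intro divide_right_mono mult_left_mono) auto
      also have "L2_norm L\<Omega> w * L2_norm L\<Omega> (box_avg (\<rho> k) w) / \<rho> k ^ DIM('a) \<le> (2 * Q) * (2 * \<delta>) / \<rho> k ^ DIM('a)"
        using w2 A2 Q \<delta> \<rho>[of k] by (intro divide_right_mono mult_mono) (auto simp: L2_norm_nonneg)
      also have "(2 * Q) * (2 * \<delta>) / \<rho> k ^ DIM('a) = e\<^sup>2 / 2"
        using \<rho>(1)[of k] Q by (simp add: \<delta>_def)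
      finally have "(L2_norm L\<Omega> w)\<^sup>2 < e\<^sup>2" using k by linarith
      then have "L2_norm L\<Omega> w < e" by (rule power2_less_imp_less) (use e in simp)
      then show ?thesis by (simp add: w_def[abs_def])
    qed
    then show ?thesis by blast
  qed
  from L2_complete[OF L(1) cauchy] r(1) show ?thesis by blast
qed

end

context sobolev_domain
begin

text \<open>The gradients need not converge. But the sets of test functions within distance
  \<open>1 / (n + 1)\<close> of \<open>u\<close> are convex and decreasing, so by the parallelogram law test functions
  of almost minimal gradient norm in them form a Cauchy sequence.\<close>

lemma H10_closed:
  assumes u: "u \<in> sq_integrable L\<Omega>" and \<phi>: "\<And>n. \<phi> n \<in> test_functions \<Omega>"
    and B: "\<And>n. L2_norm L\<Omega> (grad (\<phi> n)) \<le> B"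
    and lim: "(\<lambda>n. L2_norm L\<Omega> (\<lambda>x. \<phi> n x - u x)) \<longlonglongrightarrow> 0"
  shows "u \<in> H10 \<Omega>"
proof -
  define \<epsilon> where "\<epsilon> n = 1 / real (Suc n)" for n
  have \<epsilon>: "\<epsilon> n > 0" for n by (simp add: \<epsilon>_def)
  have \<epsilon>mono: "\<epsilon> m \<le> \<epsilon> n" if "n \<le> m" for m n using that by (simp add: \<epsilon>_def frac_le)
  have \<epsilon>0: "\<epsilon> \<longlonglongrightarrow> 0" unfolding \<epsilon>_def by (intro LIMSEQ_Suc lim_1_over_n)
  define K where "K n = {\<psi> \<in> test_functions \<Omega>. L2_norm L\<Omega> (\<lambda>x. \<psi> x - u x) \<le> \<epsilon> n}" for n
  define G where "G \<psi> = (L2_norm L\<Omega> (grad \<psi>))\<^sup>2" for \<psi>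
  define d where "d n = (INF \<psi>\<in>K n. G \<psi>)" for n
  have G0: "G \<psi> \<ge> 0" for \<psi> by (simp add: G_def)
  have bdd: "bdd_below (G ` K n)" for n by (rule bdd_belowI2[of _ 0]) (rule G0)
  have inK: "\<exists>m. \<phi> m \<in> K n" for n
  proof -
    obtain m where "L2_norm L\<Omega> (\<lambda>x. \<phi> m x - u x) < \<epsilon> n"
      using order_tendstoD(2)[OF lim \<epsilon>[of n]] by (auto simp: eventually_sequentially)
    then have "\<phi> m \<in> K n" using \<phi> by (simp add: K_def)
    then show ?thesis by blast
  qed
  have Kne: "K n \<noteq> {}" for n using inK[of n] by blast
  have Ksub: "K m \<subseteq> K n" if "n \<le> m" for m n using \<epsilon>mono[OF that] by (auto simp: K_def)
  \<comment> \<open>The infimum grows as the sets shrink. Every \<open>K n\<close> contains some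
    \<phi> m, so d is also bounded by B^2 and converges.\<close>
  have dmono: "d n \<le> d m" if "n \<le> m" for m n
    unfolding d_def by (rule cINF_superset_mono[OF Kne bdd Ksub[OF that]]) simp
  have dB: "d n \<le> B\<^sup>2" for n
  proof -
    obtain m where "\<phi> m \<in> K n" using inK by blast
    then have "d n \<le> G (\<phi> m)" unfolding d_def by (rule cINF_lower[OF bdd])
    also have "\<dots> \<le> B\<^sup>2" unfolding G_def by (intro power_mono B L2_norm_nonneg)
    finally show ?thesis .
  qed
  have "incseq d" using dmono by (simp add: incseq_def)
  then obtain d' where d': "d \<longlonglongrightarrow> d'"
    by (rule incseq_convergent[of d "B\<^sup>2"]) (use dB in auto)
  have "\<exists>\<psi>. \<psi> \<in> K n \<and> G \<psi> < d n + \<epsilon> n" for n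
  proof -
    have "(INF \<psi>\<in>K n. G \<psi>) < d n + \<epsilon> n" using \<epsilon>[of n] by (simp add: d_def)
    then show ?thesis using cINF_less_iff[OF Kne bdd] by blast
  qed
  then obtain \<psi> where \<psi>: "\<And>n. \<psi> n \<in> K n" "\<And>n. G (\<psi> n) < d n + \<epsilon> n" by metis
  have t: "\<psi> n \<in> test_functions \<Omega>" for n using \<psi>(1) by (auto simp: K_def)
  note L = test_functions_L2(1,2)[OF t dom_sets]
  note c = test_functions_Cc1[OF t]
  have par: "(L2_norm L\<Omega> (\<lambda>x. grad (\<psi> n) x - grad (\<psi> m) x))\<^sup>2 \<le> 2 * (d m - d n) + 4 * \<epsilon> n" if nm: "n \<le> m" for n m
  proof -
    \<comment> \<open>The midpoint stays in \<open>K n\<close> by convexity, so its energy is at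
      least d n. In the parallelogram law only the excess of the two energies over d n then
      remains.\<close>
    define w where "w x = 1/2 * (\<psi> n x + \<psi> m x)" for x
    have wt: "w \<in> test_functions \<Omega>" unfolding w_def by (intro test_functions_cmult test_functions_add t)
    have "L2_norm L\<Omega> (\<lambda>x. w x - u x) \<le> \<epsilon> n"
    proof -
      have "(\<lambda>x. w x - u x) = (\<lambda>x. (1/2) *\<^sub>R ((\<psi> n x - u x) + (\<psi> m x - u x)))" by (auto simp: w_def field_simps)
      then have "L2_norm L\<Omega> (\<lambda>x. w x - u x) = 1/2 * L2_norm L\<Omega> (\<lambda>x. (\<psi> n x - u x) + (\<psi> m x - u x))"
        using L2_norm_scaleR[of L\<Omega> "1/2" "\<lambda>x. (\<psi> n x - u x) + (\<psi> m x - u x)"] by simp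
      also have "L2_norm L\<Omega> (\<lambda>x. (\<psi> n x - u x) + (\<psi> m x - u x)) \<le> L2_norm L\<Omega> (\<lambda>x. \<psi> n x - u x) + L2_norm L\<Omega> (\<lambda>x. \<psi> m x - u x)"
        by (intro L2_norm_triangle sq_integrable_diff L u)
      also have "\<dots> \<le> \<epsilon> n + \<epsilon> n" using \<psi>(1)[of n] \<psi>(1)[of m] \<epsilon>mono[OF nm] by (auto simp: K_def)
      finally show ?thesis by simp
    qed
    then have "w \<in> K n" using wt by (simp add: K_def)
    then have "d n \<le> G w" unfolding d_def by (rule cINF_lower[OF bdd])
    moreover have "grad w = (\<lambda>x. (1/2) *\<^sub>R (grad (\<psi> n) x + grad (\<psi> m) x))"
      unfolding w_def using Cc1_cmult(2)[OF Cc1_add(1)[OF c c], of "1/2" n m] Cc1_add(2)[OF c c, of n m] by auto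
    then have "G w = 1/4 * (LINT x|L\<Omega>. (norm (grad (\<psi> n) x + grad (\<psi> m) x))\<^sup>2)"
      using L2_norm_scaleR[of L\<Omega> "1/2" "\<lambda>x. grad (\<psi> n) x + grad (\<psi> m) x"]
      by (simp add: G_def power_divide L2_norm_sq)
    ultimately have "4 * d n \<le> (LINT x|L\<Omega>. (norm (grad (\<psi> n) x + grad (\<psi> m) x))\<^sup>2)" by simp
    then have "(L2_norm L\<Omega> (\<lambda>x. grad (\<psi> n) x - grad (\<psi> m) x))\<^sup>2 \<le> 2 * G (\<psi> n) + 2 * G (\<psi> m) - 4 * d n"
      using integral_norm_add_sq[OF L(2) L(2), of n m] integral_norm_diff_sq[OF L(2) L(2), of n m]
      by (simp add: L2_norm_sq G_def)
    also have "\<dots> \<le> 2 * (d m - d n) + 4 * \<epsilon> n" using \<psi>(2)[of n] \<psi>(2)[of m] \<epsilon>mono[OF nm] by simp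
    finally show ?thesis .
  qed
  have cauchy: "\<exists>N. \<forall>i\<ge>N. \<forall>j\<ge>N. L2_norm L\<Omega> (\<lambda>x. grad (\<psi> i) x - grad (\<psi> j) x) < e" if e: "e > 0" for e
  proof -
    have "(\<lambda>n. 2 * (d' - d n) + 4 * \<epsilon> n) \<longlonglongrightarrow> 2 * (d' - d') + 4 * 0" by (intro tendsto_intros d' \<epsilon>0)
    then have "(\<lambda>n. 2 * (d' - d n) + 4 * \<epsilon> n) \<longlonglongrightarrow> 0" by simp
    then have "\<forall>\<^sub>F n in sequentially. 2 * (d' - d n) + 4 * \<epsilon> n < e\<^sup>2"
      by (rule order_tendstoD(2)) (use e in simp)
    then obtain N where N: "\<And>n. n \<ge> N \<Longrightarrow> 2 * (d' - d n) + 4 * \<epsilon> n < e\<^sup>2"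
      by (auto simp: eventually_sequentially)
    have dd': "d n \<le> d'" for n by (rule incseq_le[OF \<open>incseq d\<close> d'])
    have lt: "L2_norm L\<Omega> (\<lambda>x. grad (\<psi> i) x - grad (\<psi> j) x) < e" if "N \<le> i" "i \<le> j" for i j
    proof -
      have "(L2_norm L\<Omega> (\<lambda>x. grad (\<psi> i) x - grad (\<psi> j) x))\<^sup>2 < e\<^sup>2"
        using par[OF that(2)] N[OF that(1)] dd'[of j] by (smt (verit))
      then show ?thesis by (rule power2_less_imp_less) (use e in simp)
    qed
    have "L2_norm L\<Omega> (\<lambda>x. grad (\<psi> i) x - grad (\<psi> j) x) < e" if "N \<le> i" "N \<le> j" for i j
      using lt[of i j] lt[of j i] that L2_norm_diff_commute[of L\<Omega> "grad (\<psi> i)" "grad (\<psi> j)"] by (cases "i \<le> j") auto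
    then show ?thesis by blast
  qed
  obtain H where H: "H \<in> sq_integrable L\<Omega>" "(\<lambda>n. L2_norm L\<Omega> (\<lambda>x. grad (\<psi> n) x - H x)) \<longlonglongrightarrow> 0"
    using L2_complete[OF L(2) cauchy] by blast
  have "(\<lambda>n. L2_norm L\<Omega> (\<lambda>x. \<psi> n x - u x)) \<longlonglongrightarrow> 0"
    by (rule tendsto_sandwich[OF _ _ tendsto_const \<epsilon>0]) (use \<psi>(1) in \<open>auto simp: K_def L2_norm_nonneg\<close>)
  then have "approximates \<psi> u H" using H t u by (simp add: approximates_def)
  then show ?thesis by (rule H10I)
qed

text \<open>The definition of the weak gradient of w is applied to the partial derivatives of
  \<psi>. Both derivatives then fall on \<psi>, and L2 convergence in w is enough for convergence of
  the form.\<close>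

lemma dirichlet_form_test:
  assumes w: "w \<in> H10 \<Omega>" and \<psi>: "\<psi> \<in> test_functions \<Omega>"
  shows "dirichlet_form \<Omega> w \<psi> = - (\<Sum>b\<in>Basis. LINT x|L\<Omega>. w x * (grad (\<lambda>x. grad \<psi> x \<bullet> b) x \<bullet> b))"
proof -
  note W = H10_L2[OF w]
  have hw: "has_weak_grad \<Omega> w (weak_grad \<Omega> w)" using w H1_weak_grad(2) by (auto simp: H10_def)
  note P = test_functions_L2[OF _ dom_sets]
  have tb: "(\<lambda>x. grad \<psi> x \<bullet> b) \<in> test_functions \<Omega>" if "b \<in> Basis" for b
    by (rule test_functions_partial[OF \<psi> that])
  have "dirichlet_form \<Omega> w \<psi> = (LINT x|L\<Omega>. weak_grad \<Omega> w x \<bullet> grad \<psi> x)"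
    unfolding dirichlet_form_def
    by (rule integral_cong_AE)
      (use test_H10(2)[OF \<psi>] W(2) H10_L2(2)[OF test_H10(1)[OF \<psi>]] P(2)[OF \<psi>] in \<open>auto dest!: sq_integrable_measurable\<close>)
  also have "\<dots> = (LINT x|L\<Omega>. (\<Sum>b\<in>Basis. (weak_grad \<Omega> w x \<bullet> b) * (grad \<psi> x \<bullet> b)))"
    by (intro Bochner_Integration.integral_cong refl euclidean_inner)
  also have "\<dots> = (\<Sum>b\<in>Basis. (LINT x|L\<Omega>. (weak_grad \<Omega> w x \<bullet> b) * (grad \<psi> x \<bullet> b)))"
    by (rule Bochner_Integration.integral_sum) (intro sq_integrable_mult sq_integrable_component W P(2)[OF \<psi>])
  also have "\<dots> = (\<Sum>b\<in>Basis. - (LINT x|L\<Omega>. w x * (grad (\<lambda>x. grad \<psi> x \<bullet> b) x \<bullet> b)))"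
  proof (rule sum.cong[OF refl])
    fix b :: 'a assume b: "b \<in> Basis"
    have eq: "(LINT x|L\<Omega>. w x *\<^sub>R grad (\<lambda>x. grad \<psi> x \<bullet> b) x) = - (LINT x|L\<Omega>. (grad \<psi> x \<bullet> b) *\<^sub>R weak_grad \<Omega> w x)"
      using hw tb[OF b] by (auto simp: has_weak_grad_def)
    have i1: "integrable L\<Omega> (\<lambda>x. w x *\<^sub>R grad (\<lambda>x. grad \<psi> x \<bullet> b) x)"
      by (intro sq_integrable_scaleR_fun W P(2)[OF tb[OF b]])
    have i2: "integrable L\<Omega> (\<lambda>x. (grad \<psi> x \<bullet> b) *\<^sub>R weak_grad \<Omega> w x)"
      by (intro sq_integrable_scaleR_fun W P(1)[OF tb[OF b]])
    have "(LINT x|L\<Omega>. (weak_grad \<Omega> w x \<bullet> b) * (grad \<psi> x \<bullet> b)) = (LINT x|L\<Omega>. (grad \<psi> x \<bullet> b) *\<^sub>R weak_grad \<Omega> w x) \<bullet> b"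
      using integral_inner_left[OF i2, of b] by (simp add: mult.commute)
    also have "\<dots> = - ((LINT x|L\<Omega>. w x *\<^sub>R grad (\<lambda>x. grad \<psi> x \<bullet> b) x) \<bullet> b)" by (simp add: eq)
    also have "\<dots> = - (LINT x|L\<Omega>. w x * (grad (\<lambda>x. grad \<psi> x \<bullet> b) x \<bullet> b))"
      using integral_inner_left[OF i1, of b] by simp
    finally show "(LINT x|L\<Omega>. (weak_grad \<Omega> w x \<bullet> b) * (grad \<psi> x \<bullet> b)) = - (LINT x|L\<Omega>. w x * (grad (\<lambda>x. grad \<psi> x \<bullet> b) x \<bullet> b))" .
  qed
  finally show ?thesis by (simp add: sum_negf)
qed

text \<open>Stands in for weak compactness of balls in a Hilbert space. Rellich and
  \<open>H10_closed\<close> give the limit v. Convergence of the form against test functions comes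
  from L2 convergence by \<open>dirichlet_form_test\<close>, and against all of \<open>H10\<close>
  by density and the uniform bound on gradients.\<close>

lemma H10_weak_compact:
  assumes u: "\<And>n. u n \<in> H10 \<Omega>" and B: "\<And>n. grad_norm (u n) \<le> B"
  obtains r :: "nat \<Rightarrow> nat" and v where "strict_mono r" "v \<in> H10 \<Omega>"
    "(\<lambda>n. L2_norm L\<Omega> (\<lambda>x. u (r n) x - v x)) \<longlonglongrightarrow> 0"
    "AE x in L\<Omega>. (\<lambda>n. u (r n) x) \<longlonglongrightarrow> v x"
    "\<And>w. w \<in> H10 \<Omega> \<Longrightarrow> (\<lambda>n. dirichlet_form \<Omega> (u (r n)) w) \<longlonglongrightarrow> dirichlet_form \<Omega> v w"
proof -
  define \<epsilon> where "\<epsilon> n = 1 / real (Suc n)" for n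
  have \<epsilon>: "\<epsilon> n > 0" "\<epsilon> n \<le> 1" for n by (auto simp: \<epsilon>_def)
  have \<epsilon>0: "\<epsilon> \<longlonglongrightarrow> 0" unfolding \<epsilon>_def by (intro LIMSEQ_Suc lim_1_over_n)
  \<comment> \<open>\<open>Rellich_test\<close> speaks of test functions, so each u n is replaced by
    one that is closer than 1/(n + 1) in L2 and in gradient norm.\<close>
  have "\<exists>\<phi>. \<phi> \<in> test_functions \<Omega> \<and> L2_norm L\<Omega> (\<lambda>x. \<phi> x - u n x) < \<epsilon> n \<and> grad_norm (\<lambda>x. \<phi> x - u n x) < \<epsilon> n" for n
    by (rule H10_approx[OF u \<epsilon>(1)[of n]]) blast
  then obtain \<phi> where \<phi>: "\<And>n. \<phi> n \<in> test_functions \<Omega>" "\<And>n. L2_norm L\<Omega> (\<lambda>x. \<phi> n x - u n x) < \<epsilon> n"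
    "\<And>n. grad_norm (\<lambda>x. \<phi> n x - u n x) < \<epsilon> n" by metis
  note uL = H10_L2(1)[OF u]
  note pL = test_functions_L2(1)[OF \<phi>(1) dom_sets]
  have gB: "L2_norm L\<Omega> (grad (\<phi> n)) \<le> B + 1" for n
  proof -
    have neg: "grad_norm (\<lambda>x. - 1 * u n x) = grad_norm (u n)"
      using dirichlet_energy_scale[OF u, of "-1" n] grad_norm_nonneg by (simp add: dirichlet_energy_eq)
    have "grad_norm (\<lambda>x. (\<phi> n x - u n x) - (- 1 * u n x)) \<le> grad_norm (\<lambda>x. \<phi> n x - u n x) + grad_norm (\<lambda>x. - 1 * u n x)"
      by (intro grad_norm_triangle H10_diff H10_scale test_H10 \<phi> u)
    then have "grad_norm (\<phi> n) \<le> grad_norm (\<lambda>x. \<phi> n x - u n x) + grad_norm (u n)" using neg by simp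
    then show ?thesis using \<phi>(3)[of n] \<epsilon>(2)[of n] B[of n] grad_norm_test[OF \<phi>(1)] by simp
  qed
  have "\<exists>r::nat\<Rightarrow>nat. \<exists>v\<in>sq_integrable L\<Omega>. strict_mono r \<and> (\<lambda>n. L2_norm L\<Omega> (\<lambda>x. \<phi> (r n) x - v x)) \<longlonglongrightarrow> 0"
    by (rule Rellich_test[OF \<phi>(1) gB])
  then obtain r1 v where r1: "strict_mono r1" "v \<in> sq_integrable L\<Omega>"
    "(\<lambda>n. L2_norm L\<Omega> (\<lambda>x. \<phi> (r1 n) x - v x)) \<longlonglongrightarrow> 0"
    by blast
  have v: "v \<in> H10 \<Omega>" by (rule H10_closed[OF r1(2) \<phi>(1) gB r1(3)])
  have lim1: "(\<lambda>n. L2_norm L\<Omega> (\<lambda>x. u (r1 n) x - v x)) \<longlonglongrightarrow> 0"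
  proof (rule Lim_null_comparison[OF always_eventually], rule allI)
    fix n
    have "L2_norm L\<Omega> (\<lambda>x. u (r1 n) x - v x) \<le> L2_norm L\<Omega> (\<lambda>x. u (r1 n) x - \<phi> (r1 n) x) + L2_norm L\<Omega> (\<lambda>x. \<phi> (r1 n) x - v x)"
      by (rule L2_norm_triangle_diff[OF uL pL r1(2)])
    then show "norm (L2_norm L\<Omega> (\<lambda>x. u (r1 n) x - v x)) \<le> \<epsilon> (r1 n) + L2_norm L\<Omega> (\<lambda>x. \<phi> (r1 n) x - v x)"
      using \<phi>(2)[of "r1 n"] L2_norm_diff_commute[of L\<Omega> "u (r1 n)" "\<phi> (r1 n)"] by (simp add: L2_norm_nonneg)
    show "(\<lambda>n. \<epsilon> (r1 n) + L2_norm L\<Omega> (\<lambda>x. \<phi> (r1 n) x - v x)) \<longlonglongrightarrow> 0"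
      using tendsto_add[OF LIMSEQ_subseq_LIMSEQ[OF \<epsilon>0 r1(1)] r1(3)] by (simp add: o_def)
  qed
  obtain r2 where r2: "strict_mono r2" "AE x in L\<Omega>. (\<lambda>n. u (r1 (r2 n)) x) \<longlonglongrightarrow> v x"
    using L2_AE_subseq[OF uL r1(2) lim1] by blast
  define r where "r = r1 \<circ> r2"
  have lim: "(\<lambda>n. L2_norm L\<Omega> (\<lambda>x. u (r n) x - v x)) \<longlonglongrightarrow> 0"
    using LIMSEQ_subseq_LIMSEQ[OF lim1 r2(1)] by (simp add: o_def r_def)
  have weak: "(\<lambda>n. dirichlet_form \<Omega> (u (r n)) w) \<longlonglongrightarrow> dirichlet_form \<Omega> v w" if w: "w \<in> H10 \<Omega>" for w
  proof (rule LIMSEQ_I)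
    fix e :: real assume e: "e > 0"
    \<comment> \<open>Bounds the gradient norm of every u (r n) - v; the summand 1 keeps it positive
      as a denominator.\<close>
    define C where "C = \<bar>B\<bar> + grad_norm v + 1"
    have C: "C > 0" using grad_norm_nonneg[of v] by (simp add: C_def)
    obtain \<psi> where \<psi>: "\<psi> \<in> test_functions \<Omega>" "grad_norm (\<lambda>x. \<psi> x - w x) < e / (2 * C)"
      using H10_approx[OF w, of "e / (2 * C)"] e C by (metis divide_pos_pos mult_pos_pos zero_less_numeral)
    have "(\<lambda>n. dirichlet_form \<Omega> (u (r n)) \<psi>) \<longlonglongrightarrow> dirichlet_form \<Omega> v \<psi>"
      unfolding dirichlet_form_test[OF u \<psi>(1)] dirichlet_form_test[OF v \<psi>(1)]
    proof (intro tendsto_minus tendsto_sum)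
      fix b :: 'a assume b: "b \<in> Basis"
      have "(\<lambda>x. grad (\<lambda>x. grad \<psi> x \<bullet> b) x \<bullet> b) \<in> sq_integrable L\<Omega>"
        by (intro sq_integrable_component test_functions_L2(2)[OF test_functions_partial[OF \<psi>(1) b] dom_sets])
      from L2_inner_tendsto[OF uL r1(2) this lim]
      show "(\<lambda>n. LINT x|L\<Omega>. u (r n) x * (grad (\<lambda>x. grad \<psi> x \<bullet> b) x \<bullet> b)) \<longlonglongrightarrow> (LINT x|L\<Omega>. v x * (grad (\<lambda>x. grad \<psi> x \<bullet> b) x \<bullet> b))"
        by (simp add: mult.commute)
    qed
    from LIMSEQ_D[OF this, of "e / 2"] e obtain N where
      N: "\<And>n. n \<ge> N \<Longrightarrow> \<bar>dirichlet_form \<Omega> (u (r n)) \<psi> - dirichlet_form \<Omega> v \<psi>\<bar> < e / 2" by auto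
    have "\<bar>dirichlet_form \<Omega> (u (r n)) w - dirichlet_form \<Omega> v w\<bar> < e" if n: "n \<ge> N" for n
    proof -
      define z where "z x = u (r n) x - v x" for x
      have z: "z \<in> H10 \<Omega>" unfolding z_def by (intro H10_diff u v)
      have zf: "dirichlet_form \<Omega> z y = dirichlet_form \<Omega> (u (r n)) y - dirichlet_form \<Omega> v y" if "y \<in> H10 \<Omega>" for y
        using dirichlet_form_add_scale[OF u v that, of "r n" "-1"] by (simp add: z_def[abs_def])
      have \<psi>H: "\<psi> \<in> H10 \<Omega>" by (rule test_H10(1)[OF \<psi>(1)])
      define y where "y x = \<psi> x - w x" for x
      have y: "y \<in> H10 \<Omega>" unfolding y_def by (intro H10_diff \<psi>H w)
      have "dirichlet_form \<Omega> y z = dirichlet_form \<Omega> \<psi> z - dirichlet_form \<Omega> w z"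
        using dirichlet_form_add_scale[OF \<psi>H w z, of "-1"] by (simp add: y_def[abs_def])
      then have eq: "dirichlet_form \<Omega> z w = dirichlet_form \<Omega> z \<psi> - dirichlet_form \<Omega> z y"
        using dirichlet_form_commute[of z] by simp
      have "grad_norm z \<le> C"
        using grad_norm_triangle[OF u v, of "r n"] B[of "r n"] by (simp add: z_def[abs_def] C_def)
      then have "grad_norm z * grad_norm y \<le> C * (e / (2 * C))"
        using \<psi>(2) C grad_norm_nonneg by (intro mult_mono) (auto simp: y_def[abs_def])
      then have "\<bar>dirichlet_form \<Omega> z y\<bar> \<le> e / 2" using abs_dirichlet_form_le[OF z y] C by simp
      moreover have "\<bar>dirichlet_form \<Omega> z \<psi>\<bar> < e / 2" using N[OF n] zf[OF \<psi>H] by simp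
      ultimately show ?thesis using eq zf[OF w] by simp
    qed
    then show "\<exists>no. \<forall>n\<ge>no. norm (dirichlet_form \<Omega> (u (r n)) w - dirichlet_form \<Omega> v w) < e" by auto
  qed
  show ?thesis
  proof (rule that[OF _ v lim _ weak])
    show "strict_mono r" unfolding r_def using r1(1) r2(1) by (rule strict_mono_o)
    show "AE x in L\<Omega>. (\<lambda>n. u (r n) x) \<longlonglongrightarrow> v x" using r2(2) by (simp add: r_def)
  qed
qed

end

subsection \<open>Minimization\<close>

text \<open>Each share z / s of s = x + y is at most 1, so its q-th power is at most the share
  itself; the two shares add up to 1.\<close>

lemma powr_superadditive:
  fixes x y q :: real
  assumes "x \<ge> 0" "y \<ge> 0" "q \<ge> 1"
  shows "x powr q + y powr q \<le> (x + y) powr q"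
proof (cases "x + y = 0")
  case True
  then have "x = 0" "y = 0" using assms by auto
  then show ?thesis by simp
next
  case False
  define s where "s = x + y"
  have s: "s > 0" using False assms by (simp add: s_def)
  have "z powr q \<le> s powr q * (z / s)" if "0 \<le> z" "z \<le> s" for z
  proof -
    have "z powr q = s powr q * (z / s) powr q" using that s by (simp add: powr_divide)
    also have "(z / s) powr q \<le> (z / s) powr 1" using that s assms(3) by (intro powr_mono') auto
    finally show ?thesis using that s by (simp add: mult_left_mono)
  qed
  from this[of x] this[of y] have "x powr q + y powr q \<le> s powr q * (x / s) + s powr q * (y / s)"
    using assms by (auto simp: s_def)
  also have "\<dots> = s powr q * ((x + y) / s)" by (simp add: add_divide_distrib distrib_left)
  finally show ?thesis using s by (simp add: s_def)
qed

text \<open>If |b| <= \<delta> |a|, adding b costs at most the factor (1 + \<delta>)^p = 1 +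
  \<epsilon>. Otherwise |a| is at most |b| / \<delta>, and everything is charged to b.\<close>

lemma powr_add_le:
  fixes p \<epsilon> :: real
  assumes "p > 0" "\<epsilon> > 0"
  obtains C where "C \<ge> 0" "\<And>a b. \<bar>a + b\<bar> powr p \<le> (1 + \<epsilon>) * \<bar>a\<bar> powr p + C * \<bar>b\<bar> powr p"
proof -
  define \<delta> where "\<delta> = (1 + \<epsilon>) powr (1 / p) - 1"
  have "1 < (1 + \<epsilon>) powr (1 / p)" using assms by (intro gr_one_powr) auto
  then have \<delta>: "\<delta> > 0" by (simp add: \<delta>_def)
  have \<delta>p: "(1 + \<delta>) powr p = 1 + \<epsilon>" using assms by (simp add: \<delta>_def powr_powr)
  define C where "C = (1 / \<delta> + 1) powr p"
  have "\<bar>a + b\<bar> powr p \<le> (1 + \<epsilon>) * \<bar>a\<bar> powr p + C * \<bar>b\<bar> powr p" for a b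
  proof (cases "\<bar>b\<bar> \<le> \<delta> * \<bar>a\<bar>")
    case True
    then have "\<bar>a + b\<bar> \<le> (1 + \<delta>) * \<bar>a\<bar>" by (simp add: distrib_right)
    then have "\<bar>a + b\<bar> powr p \<le> ((1 + \<delta>) * \<bar>a\<bar>) powr p" using assms by (intro powr_mono2) auto
    also have "\<dots> = (1 + \<epsilon>) * \<bar>a\<bar> powr p" using \<delta> by (simp add: powr_mult \<delta>p)
    finally show ?thesis by (simp add: C_def add_increasing2)
  next
    case False
    then have "\<bar>a\<bar> \<le> 1 / \<delta> * \<bar>b\<bar>" using \<delta> by (simp add: field_simps)
    then have "\<bar>a + b\<bar> \<le> (1 / \<delta> + 1) * \<bar>b\<bar>" by (simp add: distrib_right)
    then have "\<bar>a + b\<bar> powr p \<le> ((1 / \<delta> + 1) * \<bar>b\<bar>) powr p" using assms by (intro powr_mono2) auto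
    also have "\<dots> = C * \<bar>b\<bar> powr p" using \<delta> by (simp add: powr_mult C_def)
    finally show ?thesis using assms by (simp add: add_increasing)
  qed
  moreover have "C \<ge> 0" by (simp add: C_def)
  ultimately show ?thesis using that by blast
qed

section \<open>The Rayleigh quotient and the Brezis-Lieb inequality\<close>

context sobolev_domain
begin

definition pow_int :: "('a \<Rightarrow> real) \<Rightarrow> real" where
  "pow_int u = (LINT x|L\<Omega>. \<bar>u x\<bar> powr p)"

definition sq_int :: "('a \<Rightarrow> real) \<Rightarrow> real" where
  "sq_int u = (LINT x|L\<Omega>. (u x)\<^sup>2)"

lemma sq_int_eq: "sq_int u = (L2_norm L\<Omega> u)\<^sup>2"
  by (simp add: sq_int_def L2_norm_sq)

lemma sq_int_nonneg: "0 \<le> sq_int u"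
  by (simp add: sq_int_eq)

lemma sq_int_scale: "sq_int (\<lambda>x. c * u x) = c\<^sup>2 * sq_int u"
  using L2_norm_scaleR[of L\<Omega> c u] by (simp add: sq_int_eq power_mult_distrib)

lemma sq_int_add_scale:
  assumes "u \<in> H10 \<Omega>" "v \<in> H10 \<Omega>"
  shows "sq_int (\<lambda>x. u x + c * v x) = sq_int u + 2 * c * (LINT x|L\<Omega>. u x * v x) + c\<^sup>2 * sq_int v"
proof -
  have "sq_int (\<lambda>x. u x + c * v x) = sq_int u + 2 * (LINT x|L\<Omega>. u x * (c * v x)) + sq_int (\<lambda>x. c * v x)"
    using integral_norm_add_sq[OF H10_L2(1)[OF assms(1)] sq_integrable_cmult[OF H10_L2(1)[OF assms(2)], of c]]
    by (simp add: sq_int_def mult.commute)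
  also have "(LINT x|L\<Omega>. u x * (c * v x)) = c * (LINT x|L\<Omega>. u x * v x)"
    using integral_mult_right_zero[of L\<Omega> c "\<lambda>x. u x * v x"] by (simp add: mult_ac)
  finally show ?thesis by (simp add: sq_int_scale)
qed

lemma sq_int_tendsto:
  assumes "\<And>n. u n \<in> H10 \<Omega>" "v \<in> H10 \<Omega>" "(\<lambda>n. L2_norm L\<Omega> (\<lambda>x. u n x - v x)) \<longlonglongrightarrow> 0"
  shows "(\<lambda>n. sq_int (u n)) \<longlonglongrightarrow> sq_int v"
  unfolding sq_int_eq by (intro tendsto_power L2_norm_tendsto H10_L2 assms)

text \<open>For a minimizing sequence normalized in L2, the constraint survives because the L2
  convergence is strong, and the energy can only drop in the limit.\<close>

lemma Rayleigh_minimizer: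
  obtains \<phi> where "\<phi> \<in> H10 \<Omega>" "sq_int \<phi> = 1"
    "\<And>u. u \<in> H10 \<Omega> \<Longrightarrow> dirichlet_energy \<Omega> \<phi> * sq_int u \<le> dirichlet_energy \<Omega> u"
proof -
  define A where "A = {u \<in> H10 \<Omega>. sq_int u = 1}"
  have nrm: "(\<lambda>x. 1 / sqrt (sq_int u) * u x) \<in> A" if "u \<in> H10 \<Omega>" "sq_int u > 0" for u
    using that H10_scale[of u "1 / sqrt (sq_int u)"] sq_int_scale[of "1 / sqrt (sq_int u)" u]
    by (simp add: A_def power_divide)
  obtain t where t: "t \<in> test_functions \<Omega>" "\<not> ae_eq_on \<Omega> t (\<lambda>x. 0)" using H10_nonzero_test .
  have tH: "t \<in> H10 \<Omega>" by (rule test_H10(1)[OF t(1)])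
  have "sq_int t \<noteq> 0" using t(2) ae_eq_zero_iff(1)[OF tH] by (simp add: sq_int_def)
  then have "sq_int t > 0" using sq_int_nonneg[of t] by linarith
  then have Ane: "A \<noteq> {}" using nrm[OF tH] by blast
  define \<Lambda> where "\<Lambda> = (INF u\<in>A. dirichlet_energy \<Omega> u)"
  have bdd: "bdd_below (dirichlet_energy \<Omega> ` A)" by (rule bdd_belowI2[of _ 0]) (rule dirichlet_energy_nonneg)
  have "\<exists>u. u \<in> A \<and> dirichlet_energy \<Omega> u < \<Lambda> + 1 / real (Suc n)" for n
  proof -
    have "(INF u\<in>A. dirichlet_energy \<Omega> u) < \<Lambda> + 1 / real (Suc n)" by (simp add: \<Lambda>_def)
    then show ?thesis using cINF_less_iff[OF Ane bdd] by blast
  qed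
  then obtain u where u: "\<And>n. u n \<in> A" "\<And>n. dirichlet_energy \<Omega> (u n) < \<Lambda> + 1 / real (Suc n)" by metis
  have uH: "u n \<in> H10 \<Omega>" "sq_int (u n) = 1" for n using u(1) by (auto simp: A_def)
  have gB: "grad_norm (u n) \<le> sqrt (\<Lambda> + 1)" for n
  proof (rule real_le_rsqrt)
    have "1 / real (Suc n) \<le> 1" by simp
    then show "(grad_norm (u n))\<^sup>2 \<le> \<Lambda> + 1" using u(2)[of n] unfolding dirichlet_energy_eq by linarith
  qed
  obtain r v where r: "strict_mono r" "v \<in> H10 \<Omega>" "(\<lambda>n. L2_norm L\<Omega> (\<lambda>x. u (r n) x - v x)) \<longlonglongrightarrow> 0"
    "\<And>w. w \<in> H10 \<Omega> \<Longrightarrow> (\<lambda>n. dirichlet_form \<Omega> (u (r n)) w) \<longlonglongrightarrow> dirichlet_form \<Omega> v w"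
    by (rule H10_weak_compact[of u, OF uH(1) gB]) blast
  have "(\<lambda>n. sq_int (u (r n))) \<longlonglongrightarrow> sq_int v" by (rule sq_int_tendsto[OF uH(1) r(2,3)])
  then have v1: "sq_int v = 1" unfolding uH(2) by (simp add: LIMSEQ_const_iff)
  \<comment> \<open>Lower semicontinuity: since u n - v has nonnegative energy, twice the form of u
    n and v, minus the energy of v, is at most the energy of u n, and it converges to the energy of
    v.\<close>
  have ev: "dirichlet_energy \<Omega> v \<le> \<Lambda>"
  proof (rule LIMSEQ_le)
    show "(\<lambda>n. 2 * dirichlet_form \<Omega> (u (r n)) v - dirichlet_energy \<Omega> v) \<longlonglongrightarrow> dirichlet_energy \<Omega> v"
      using tendsto_diff[OF tendsto_mult_left[OF r(4)[OF r(2)], of 2] tendsto_const[of "dirichlet_energy \<Omega> v"]]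
      by (simp add: dirichlet_energy_form)
    have "(\<lambda>n. \<Lambda> + 1 / real (Suc (r n))) \<longlonglongrightarrow> \<Lambda> + 0"
      using LIMSEQ_subseq_LIMSEQ[OF LIMSEQ_Suc[OF lim_1_over_n] r(1)] by (intro tendsto_intros) (simp add: o_def)
    then show "(\<lambda>n. \<Lambda> + 1 / real (Suc (r n))) \<longlonglongrightarrow> \<Lambda>" by simp
    have "2 * dirichlet_form \<Omega> (u (r n)) v - dirichlet_energy \<Omega> v \<le> \<Lambda> + 1 / real (Suc (r n))" for n
      using dirichlet_energy_nonneg[of "\<lambda>x. u (r n) x + -1 * v x"] dirichlet_energy_add_scale[OF uH(1) r(2), of "r n" "-1"] u(2)[of "r n"]
      by simp
    then show "\<exists>N. \<forall>n\<ge>N. 2 * dirichlet_form \<Omega> (u (r n)) v - dirichlet_energy \<Omega> v \<le> \<Lambda> + 1 / real (Suc (r n))" by blast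
  qed
  have "dirichlet_energy \<Omega> v * sq_int w \<le> dirichlet_energy \<Omega> w" if w: "w \<in> H10 \<Omega>" for w
  proof (cases "sq_int w = 0")
    case False
    then have pos: "sq_int w > 0" using sq_int_nonneg[of w] by linarith
    have "dirichlet_energy \<Omega> v \<le> \<Lambda>" by (rule ev)
    also have "\<dots> \<le> dirichlet_energy \<Omega> (\<lambda>x. 1 / sqrt (sq_int w) * w x)"
      unfolding \<Lambda>_def by (rule cINF_lower[OF bdd nrm[OF w pos]])
    also have "\<dots> = dirichlet_energy \<Omega> w / sq_int w"
      using pos dirichlet_energy_scale[OF w, of "1 / sqrt (sq_int w)"] by (simp add: power_divide)
    finally show ?thesis using pos by (simp add: field_simps)
  qed (simp add: dirichlet_energy_nonneg)
  with r(2) v1 show ?thesis by (rule that)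
qed

text \<open>The Rayleigh minimizer solves the eigenvalue equation. Testing the equation of any other
  eigenfunction with itself shows that its eigenvalue is at least as large, as \<open>LEAST\<close>
  requires.\<close>

lemma first_eigenfunction:
  obtains \<phi> where "\<phi> \<in> H10 \<Omega>" "sq_int \<phi> = 1" "dirichlet_energy \<Omega> \<phi> = first_dirichlet_eigenvalue \<Omega>"
proof -
  obtain \<phi> where \<phi>: "\<phi> \<in> H10 \<Omega>" "sq_int \<phi> = 1"
    and min: "\<And>u. u \<in> H10 \<Omega> \<Longrightarrow> dirichlet_energy \<Omega> \<phi> * sq_int u \<le> dirichlet_energy \<Omega> u"
    by (rule Rayleigh_minimizer) blast
  define \<Lambda> where "\<Lambda> = dirichlet_energy \<Omega> \<phi>"
  have eig: "dirichlet_form \<Omega> \<phi> v = \<Lambda> * (LINT x|L\<Omega>. \<phi> x * v x)" if v: "v \<in> H10 \<Omega>" for v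
  proof -
    define B where "B = dirichlet_form \<Omega> \<phi> v - \<Lambda> * (LINT x|L\<Omega>. \<phi> x * v x)"
    define C where "C = dirichlet_energy \<Omega> v - \<Lambda> * sq_int v"
    \<comment> \<open>2 t B + t^2 C is the defect of the Rayleigh inequality at \<phi> + t v. It
      vanishes at t = 0 and is never negative, so B = 0.\<close>
    have "B\<^sup>2 \<le> 0 * C"
    proof (rule discriminant_bound)
      fix t :: real
      show "0 \<le> 0 + 2 * t * B + t\<^sup>2 * C"
        using min[OF H10_add_scale(1)[OF \<phi>(1) v], of t] dirichlet_energy_add_scale[OF \<phi>(1) v, of t]
          sq_int_add_scale[OF \<phi>(1) v, of t] \<phi>(2)
        by (simp add: \<Lambda>_def[symmetric] B_def C_def algebra_simps)
      show "0 \<le> C" using min[OF v] by (simp add: C_def \<Lambda>_def)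
    qed
    then show ?thesis by (simp add: B_def)
  qed
  have nz: "\<not> ae_eq_on \<Omega> \<phi> (\<lambda>x. 0)" using \<phi> ae_eq_zero_iff(1)[OF \<phi>(1)] by (simp add: sq_int_def)
  have "first_dirichlet_eigenvalue \<Omega> = \<Lambda>"
    unfolding first_dirichlet_eigenvalue_def
  proof (rule Least_equality)
    show "dirichlet_eigenvalue \<Omega> \<Lambda>"
      using \<phi>(1) nz eig by (auto simp: dirichlet_eigenvalue_def H10_nonzero_def)
    fix \<mu> assume "dirichlet_eigenvalue \<Omega> \<mu>"
    then obtain u where u: "u \<in> H10 \<Omega>" "\<not> ae_eq_on \<Omega> u (\<lambda>x. 0)"
      "dirichlet_form \<Omega> u u = \<mu> * (LINT x|L\<Omega>. u x * u x)"
      by (auto simp: dirichlet_eigenvalue_def H10_nonzero_def)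
    have "dirichlet_energy \<Omega> u = \<mu> * sq_int u"
      using u(3) by (simp add: dirichlet_energy_form sq_int_def power2_eq_square)
    then have "\<Lambda> * sq_int u \<le> \<mu> * sq_int u" using min[OF u(1)] by (simp add: \<Lambda>_def)
    moreover have "sq_int u > 0"
      using u(2) ae_eq_zero_iff(1)[OF u(1)] sq_int_nonneg[of u] by (simp add: sq_int_def less_le)
    ultimately show "\<Lambda> \<le> \<mu>" by simp
  qed
  then show ?thesis using that[OF \<phi>] by (simp add: \<Lambda>_def)
qed

text \<open>Only one side of the Brezis-Lieb splitting, up to a factor 1 + \<epsilon>, is needed for
  lower semicontinuity. By \<open>powr_add_le\<close> the positive part of |u n|^p - (1 +
  \<epsilon>) |u n - v|^p is dominated by C |v|^p; it tends to |v|^p almost everywhere, and its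
  integral serves as I.\<close>

lemma Brezis_Lieb_upper:
  assumes u: "\<And>n. u n \<in> H10 \<Omega>" and v: "v \<in> H10 \<Omega>"
    and lim: "AE x in L\<Omega>. (\<lambda>n. u n x) \<longlonglongrightarrow> v x" and e: "\<epsilon> > 0"
  obtains I where "I \<longlonglongrightarrow> pow_int v" "\<And>n. pow_int (u n) \<le> (1 + \<epsilon>) * pow_int (\<lambda>x. u n x - v x) + I n"
proof -
  have p0: "p > 0" using p_gt_2 by simp
  obtain C where C: "C \<ge> 0" "\<And>a b. \<bar>a + b\<bar> powr p \<le> (1 + \<epsilon>) * \<bar>a\<bar> powr p + C * \<bar>b\<bar> powr p"
    by (rule powr_add_le[OF p0 e]) blast
  define f where "f n x = \<bar>u n x\<bar> powr p - (1 + \<epsilon>) * \<bar>u n x - v x\<bar> powr p" for n x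
  define g where "g n x = max 0 (f n x)" for n x
  note [measurable] = u[THEN H10_L2(1), THEN sq_integrable_measurable] v[THEN H10_L2(1), THEN sq_integrable_measurable]
  note iu = H10_powr_integrable[OF u] and iv = H10_powr_integrable[OF v] and iw = H10_powr_integrable[OF H10_diff[OF u v]]
  have if': "integrable L\<Omega> (f n)" for n
    unfolding f_def by (intro Bochner_Integration.integrable_diff integrable_mult_right iu iw)
  have ig: "integrable L\<Omega> (g n)" for n
    unfolding g_def by (intro integrable_max if') simp
  have gC: "g n x \<le> C * \<bar>v x\<bar> powr p" for n x
    using C(1) C(2)[of "u n x - v x" "v x"] by (simp add: g_def f_def)
  have "(\<lambda>n. LINT x|L\<Omega>. g n x) \<longlonglongrightarrow> (LINT x|L\<Omega>. \<bar>v x\<bar> powr p)"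
  proof (rule integral_dominated_convergence[where w="\<lambda>x. C * \<bar>v x\<bar> powr p"])
    show "AE x in L\<Omega>. (\<lambda>n. g n x) \<longlonglongrightarrow> \<bar>v x\<bar> powr p"
      using lim
    proof eventually_elim
      fix x assume l: "(\<lambda>n. u n x) \<longlonglongrightarrow> v x"
      have "(\<lambda>n. g n x) \<longlonglongrightarrow> max 0 (\<bar>v x\<bar> powr p - (1 + \<epsilon>) * \<bar>v x - v x\<bar> powr p)"
        unfolding g_def f_def using p0 by (intro tendsto_intros l tendsto_powr2) auto
      then show "(\<lambda>n. g n x) \<longlonglongrightarrow> \<bar>v x\<bar> powr p" using p0 by simp
    qed
    show "AE x in L\<Omega>. norm (g n x) \<le> C * \<bar>v x\<bar> powr p" for n
      using gC by (intro AE_I2) (simp add: g_def)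
    show "g n \<in> borel_measurable L\<Omega>" for n using ig by (rule borel_measurable_integrable)
  qed (use iv in \<open>auto intro: borel_measurable_integrable\<close>)
  moreover have "pow_int (u n) \<le> (1 + \<epsilon>) * pow_int (\<lambda>x. u n x - v x) + (LINT x|L\<Omega>. g n x)" for n
  proof -
    have "(LINT x|L\<Omega>. f n x) \<le> (LINT x|L\<Omega>. g n x)"
      by (intro integral_mono if' ig) (simp add: g_def)
    moreover have "(LINT x|L\<Omega>. f n x) = pow_int (u n) - (1 + \<epsilon>) * pow_int (\<lambda>x. u n x - v x)"
      unfolding f_def pow_int_def using iu iw by simp
    ultimately show ?thesis by simp
  qed
  ultimately show ?thesis using that by (simp add: pow_int_def)
qed

end

section \<open>The Kirchhoff energy and its minimizer\<close>

locale kirchhoff_problem = sobolev_domain \<Omega> p for \<Omega> :: "'a::euclidean_space set" and p :: real +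
  fixes a \<eta> \<sigma> \<mu> :: real
  assumes a: "a \<ge> 0" and \<eta>: "\<eta> > 0" and \<sigma>: "1 < \<sigma>" and \<mu>: "\<mu> > 0"
    and above: "a * first_dirichlet_eigenvalue \<Omega> < \<mu>"
begin

abbreviation "q \<equiv> p / 2"

lemma q_gt_1: "q > 1"
  using p_gt_2 by simp

definition K :: real where "K = S powr (- q)"

lemma K_nonneg: "K \<ge> 0"
  by (simp add: K_def)

lemma pow_int_le: "u \<in> H10 \<Omega> \<Longrightarrow> pow_int u \<le> K * dirichlet_energy \<Omega> u powr q"
  using Sobolev_S by (simp add: pow_int_def K_def)

definition energy :: "('a \<Rightarrow> real) \<Rightarrow> real" where
  "energy u = a / 2 * dirichlet_energy \<Omega> u + (K * dirichlet_energy \<Omega> u powr q - pow_int u) / p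
     + \<eta> / (2 * \<sigma>) * dirichlet_energy \<Omega> u powr \<sigma> - \<mu> / 2 * sq_int u"

lemma energy_lower:
  assumes "u \<in> H10 \<Omega>"
  shows "\<eta> / (2 * \<sigma>) * dirichlet_energy \<Omega> u powr \<sigma> - \<mu> / 2 * poincare_const * dirichlet_energy \<Omega> u \<le> energy u"
proof -
  have "0 \<le> a / 2 * dirichlet_energy \<Omega> u" using a dirichlet_energy_nonneg by simp
  moreover have "0 \<le> (K * dirichlet_energy \<Omega> u powr q - pow_int u) / p" using pow_int_le[OF assms] p_gt_2 by simp
  moreover have "\<mu> / 2 * sq_int u \<le> \<mu> / 2 * (poincare_const * dirichlet_energy \<Omega> u)"
    using Poincare[OF assms] \<mu> by (intro mult_left_mono) (auto simp: sq_int_def)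
  ultimately show ?thesis by (simp add: energy_def mult.assoc)
qed

text \<open>The positive zero of the lower bound in \<open>energy_lower\<close>, viewed as a
  function of the Dirichlet energy; beyond it \<sigma> > 1 makes that bound positive.\<close>

definition R :: real where "R = (\<mu> * poincare_const * \<sigma> / \<eta>) powr (1 / (\<sigma> - 1))"

lemma R_nonneg: "R \<ge> 0"
  by (simp add: R_def)

lemma dirichlet_energy_le_R:
  assumes "u \<in> H10 \<Omega>" "energy u \<le> 0"
  shows "dirichlet_energy \<Omega> u \<le> R"
proof (cases "dirichlet_energy \<Omega> u = 0")
  case False
  define t where "t = dirichlet_energy \<Omega> u"
  have t: "t > 0" using False dirichlet_energy_nonneg[of u] by (simp add: t_def)
  have "\<eta> / (2 * \<sigma>) * t powr \<sigma> \<le> \<mu> / 2 * poincare_const * t" using energy_lower[OF assms(1)] assms(2) by (simp add: t_def)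
  moreover have "t powr \<sigma> = t powr (\<sigma> - 1) * t" using t by (simp add: powr_diff)
  ultimately have "(\<eta> / (2 * \<sigma>) * t powr (\<sigma> - 1)) * t \<le> (\<mu> / 2 * poincare_const) * t" by (simp add: mult.assoc)
  then have "\<eta> / (2 * \<sigma>) * t powr (\<sigma> - 1) \<le> \<mu> / 2 * poincare_const" using t by (rule mult_right_le_imp_le)
  then have "t powr (\<sigma> - 1) \<le> \<mu> * poincare_const * \<sigma> / \<eta>" using \<eta> \<sigma> by (simp add: field_simps)
  then have "(t powr (\<sigma> - 1)) powr (1 / (\<sigma> - 1)) \<le> R" unfolding R_def using \<sigma> by (intro powr_mono2) auto
  then show ?thesis using t \<sigma> by (simp add: powr_powr t_def)
qed (simp add: R_nonneg)

lemma energy_bounded_below: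
  assumes "u \<in> H10 \<Omega>" shows "- (\<mu> / 2 * poincare_const * R) \<le> energy u"
proof (cases "energy u \<le> 0")
  case True
  have "0 \<le> \<eta> / (2 * \<sigma>) * dirichlet_energy \<Omega> u powr \<sigma>" using \<eta> \<sigma> by simp
  moreover have "\<mu> / 2 * poincare_const * dirichlet_energy \<Omega> u \<le> \<mu> / 2 * poincare_const * R"
    using dirichlet_energy_le_R[OF assms True] \<mu> poincare_const_pos by (intro mult_left_mono) auto
  ultimately show ?thesis using energy_lower[OF assms] by linarith
next
  case False
  have "0 \<le> \<mu> / 2 * poincare_const * R" using \<mu> poincare_const_pos R_nonneg by simp
  then show ?thesis using False by linarith
qed

lemma energy_negative: "\<exists>u\<in>H10 \<Omega>. energy u < 0"
proof -
  obtain \<phi> where \<phi>: "\<phi> \<in> H10 \<Omega>" "sq_int \<phi> = 1" "dirichlet_energy \<Omega> \<phi> = first_dirichlet_eigenvalue \<Omega>"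
    using first_eigenfunction .
  define \<Lambda> where "\<Lambda> = dirichlet_energy \<Omega> \<phi>"
  have \<Lambda>: "\<Lambda> \<ge> 0" "a * \<Lambda> < \<mu>" using dirichlet_energy_nonneg[of \<phi>] above \<phi>(3) by (auto simp: \<Lambda>_def)
  \<comment> \<open>Once t^2 is taken out, the other powers of t have the positive exponents p - 2
    and 2 \<sigma> - 2, so for small t the sign is that of a \<Lambda> - \<mu>.\<close>
  have scaled: "energy (\<lambda>x. t * \<phi> x) = t\<^sup>2 * ((a * \<Lambda> - \<mu>) / 2 + (K * \<Lambda> powr q - pow_int \<phi>) / p * t powr (p - 2)
      + \<eta> / (2 * \<sigma>) * \<Lambda> powr \<sigma> * t powr (2 * \<sigma> - 2))" if t: "t > 0" for t
  proof -
    have e: "dirichlet_energy \<Omega> (\<lambda>x. t * \<phi> x) = t\<^sup>2 * \<Lambda>" by (simp add: dirichlet_energy_scale[OF \<phi>(1)] \<Lambda>_def)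
    have s: "sq_int (\<lambda>x. t * \<phi> x) = t\<^sup>2" by (simp add: sq_int_scale \<phi>(2))
    have P: "pow_int (\<lambda>x. t * \<phi> x) = t powr p * pow_int \<phi>"
      unfolding pow_int_def using t by (simp add: abs_mult powr_mult)
    have t2: "t\<^sup>2 = t powr 2" using t by (simp add: powr_numeral)
    have pw: "(t\<^sup>2 * \<Lambda>) powr s = t\<^sup>2 * (t powr (2 * s - 2) * \<Lambda> powr s)" for s
    proof -
      have "t\<^sup>2 powr s = t powr (2 * s)" unfolding t2 by (simp only: powr_powr)
      also have "\<dots> = t\<^sup>2 * t powr (2 * s - 2)" unfolding t2 by (simp only: powr_add[symmetric]) simp
      finally show ?thesis using t \<Lambda>(1) by (simp add: powr_mult)
    qed
    have tp: "t powr p = t\<^sup>2 * t powr (p - 2)" unfolding t2 by (simp only: powr_add[symmetric]) simp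
    show ?thesis
      unfolding energy_def e s P pw tp by (simp add: algebra_simps diff_divide_distrib add_divide_distrib)
  qed
  define h where "h t = (a * \<Lambda> - \<mu>) / 2 + (K * \<Lambda> powr q - pow_int \<phi>) / p * t powr (p - 2)
      + \<eta> / (2 * \<sigma>) * \<Lambda> powr \<sigma> * t powr (2 * \<sigma> - 2)" for t
  have pw0: "((\<lambda>t. t powr s) \<longlongrightarrow> 0) (at_right 0)" if "s > 0" for s :: real
  proof -
    have "((\<lambda>t. t powr s) \<longlongrightarrow> 0 powr s) (at_right 0)"
      by (rule tendsto_powr2[OF tendsto_ident_at tendsto_const])
        (use that in \<open>auto intro: eventually_mono[OF eventually_at_right_less]\<close>)
    then show ?thesis by simp
  qed
  have "(h \<longlongrightarrow> (a * \<Lambda> - \<mu>) / 2 + (K * \<Lambda> powr q - pow_int \<phi>) / p * 0 + \<eta> / (2 * \<sigma>) * \<Lambda> powr \<sigma> * 0) (at_right 0)"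
    unfolding h_def using p_gt_2 \<sigma> by (intro tendsto_intros pw0) auto
  then have "(h \<longlongrightarrow> (a * \<Lambda> - \<mu>) / 2) (at_right 0)" by simp
  then have "\<forall>\<^sub>F t in at_right 0. h t < 0" by (rule order_tendstoD(2)) (use \<Lambda> in simp)
  moreover have "\<forall>\<^sub>F t in at_right 0. 0 < (t::real)" by (rule eventually_at_right_less)
  ultimately have "\<forall>\<^sub>F t in at_right 0. h t < 0 \<and> 0 < t" by eventually_elim auto
  then obtain t where t: "h t < 0" "0 < t" using eventually_happens'[OF trivial_limit_at_right_real] by blast
  then have "energy (\<lambda>x. t * \<phi> x) < 0" using scaled[OF t(2)] by (simp add: h_def mult_pos_neg)
  then show ?thesis using H10_scale[OF \<phi>(1)] by blast
qed

lemma minimizer_exists: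
  obtains v where "v \<in> H10 \<Omega>" "energy v < 0" "\<And>w. w \<in> H10 \<Omega> \<Longrightarrow> energy v \<le> energy w"
proof -
  define m where "m = (INF u\<in>H10 \<Omega>. energy u)"
  have ne: "H10 \<Omega> \<noteq> {}" using H10_zero by blast
  have bdd: "bdd_below (energy ` H10 \<Omega>)" by (rule bdd_belowI2[OF energy_bounded_below])
  have mle: "m \<le> energy w" if "w \<in> H10 \<Omega>" for w unfolding m_def by (rule cINF_lower[OF bdd that])
  obtain u0 where u0: "u0 \<in> H10 \<Omega>" "energy u0 < 0" using energy_negative by blast
  then have m0: "m < 0" using mle by fastforce
  \<comment> \<open>The cap at 0 keeps the whole sequence in the range where
    \<open>dirichlet_energy_le_R\<close> applies.\<close>
  have "\<exists>u. u \<in> H10 \<Omega> \<and> energy u < min 0 (m + 1 / real (Suc n))" for n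
  proof -
    have "(INF u\<in>H10 \<Omega>. energy u) < min 0 (m + 1 / real (Suc n))" using m0 by (simp add: m_def)
    then show ?thesis using cINF_less_iff[OF ne bdd] by blast
  qed
  then obtain u where u: "\<And>n. u n \<in> H10 \<Omega>" "\<And>n. energy (u n) < min 0 (m + 1 / real (Suc n))" by metis
  have eR: "dirichlet_energy \<Omega> (u n) \<le> R" for n
    using dirichlet_energy_le_R[OF u(1), of n] u(2)[of n] by simp
  have gB: "grad_norm (u n) \<le> sqrt R" for n
    using eR[of n] by (intro real_le_rsqrt) (simp add: dirichlet_energy_eq)
  obtain r v where r: "strict_mono r" and v: "v \<in> H10 \<Omega>" and r2: "(\<lambda>n. L2_norm L\<Omega> (\<lambda>x. u (r n) x - v x)) \<longlonglongrightarrow> 0"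
    "AE x in L\<Omega>. (\<lambda>n. u (r n) x) \<longlonglongrightarrow> v x"
    "\<And>w. w \<in> H10 \<Omega> \<Longrightarrow> (\<lambda>n. dirichlet_form \<Omega> (u (r n)) w) \<longlonglongrightarrow> dirichlet_form \<Omega> v w"
    by (rule H10_weak_compact[of u, OF u(1) gB]) blast
  \<comment> \<open>Weak convergence does not fix the limit of the Dirichlet energies; a further
    subsequence makes them converge to some D. The surplus d over the energy of v is the limit of
    the energies of y n - v.\<close>
  have "seq_compact {0..R}" using compact_imp_seq_compact[OF compact_Icc] .
  moreover have "\<forall>n. dirichlet_energy \<Omega> (u (r n)) \<in> {0..R}" using eR dirichlet_energy_nonneg by simp
  ultimately obtain D r' where "strict_mono r'" "((\<lambda>n. dirichlet_energy \<Omega> (u (r n))) \<circ> r') \<longlonglongrightarrow> D"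
    by (rule seq_compactE)
  then have D: "strict_mono r'" "(\<lambda>n. dirichlet_energy \<Omega> (u (r (r' n)))) \<longlonglongrightarrow> D" by (simp_all add: o_def)
  define y where "y n = u (r (r' n))" for n
  have yH: "y n \<in> H10 \<Omega>" for n by (simp add: y_def u(1))
  have yD: "(\<lambda>n. dirichlet_energy \<Omega> (y n)) \<longlonglongrightarrow> D" using D(2) by (simp add: y_def)
  have yL: "(\<lambda>n. sq_int (y n)) \<longlonglongrightarrow> sq_int v"
    using LIMSEQ_subseq_LIMSEQ[OF sq_int_tendsto[OF u(1) v r2(1)] D(1)] by (simp add: o_def y_def)
  have yAE: "AE x in L\<Omega>. (\<lambda>n. y n x) \<longlonglongrightarrow> v x"
    using r2(2) by eventually_elim (use LIMSEQ_subseq_LIMSEQ[OF _ D(1)] in \<open>force simp: o_def y_def\<close>)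
  have yw: "(\<lambda>n. dirichlet_form \<Omega> (y n) v) \<longlonglongrightarrow> dirichlet_energy \<Omega> v"
    using LIMSEQ_subseq_LIMSEQ[OF r2(3)[OF v] D(1)] by (simp add: o_def y_def dirichlet_energy_form)
  define d where "d = D - dirichlet_energy \<Omega> v"
  have yd: "(\<lambda>n. dirichlet_energy \<Omega> (\<lambda>x. y n x - v x)) \<longlonglongrightarrow> d"
  proof -
    have "(\<lambda>n. dirichlet_energy \<Omega> (y n) - 2 * dirichlet_form \<Omega> (y n) v + dirichlet_energy \<Omega> v) \<longlonglongrightarrow>
      D - 2 * dirichlet_energy \<Omega> v + dirichlet_energy \<Omega> v" by (intro tendsto_intros yD yw)
    then show ?thesis using dirichlet_energy_add_scale[OF yH v, of _ "-1"] by (simp add: d_def)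
  qed
  have d0: "d \<ge> 0" by (rule LIMSEQ_le_const[OF yd]) (use dirichlet_energy_nonneg in auto)
  have ev0: "dirichlet_energy \<Omega> v \<ge> 0" by (rule dirichlet_energy_nonneg)
  have D0: "D \<ge> 0" using d0 ev0 by (simp add: d_def)
  have eps: "a / 2 * D + (K * D powr q - ((1 + \<epsilon>) * (K * d powr q) + pow_int v)) / p + \<eta> / (2 * \<sigma>) * D powr \<sigma> - \<mu> / 2 * sq_int v \<le> m"
    if \<epsilon>: "\<epsilon> > 0" for \<epsilon>
  proof -
    obtain I where I: "I \<longlonglongrightarrow> pow_int v" "\<And>n. pow_int (y n) \<le> (1 + \<epsilon>) * pow_int (\<lambda>x. y n x - v x) + I n"
      by (rule Brezis_Lieb_upper[OF yH v yAE \<epsilon>]) blast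
    \<comment> \<open>This is \<open>energy (y n)\<close> with \<open>pow_int (y n)\<close> replaced
      by its upper bound from Brezis-Lieb and from the Sobolev inequality for y n - v. It lies below
      the energy, and each of its terms converges.\<close>
    define F where "F n = a / 2 * dirichlet_energy \<Omega> (y n) + (K * dirichlet_energy \<Omega> (y n) powr q
       - ((1 + \<epsilon>) * (K * dirichlet_energy \<Omega> (\<lambda>x. y n x - v x) powr q) + I n)) / p
       + \<eta> / (2 * \<sigma>) * dirichlet_energy \<Omega> (y n) powr \<sigma> - \<mu> / 2 * sq_int (y n)" for n
    show ?thesis
    proof (rule LIMSEQ_le)
      show "F \<longlonglongrightarrow> a / 2 * D + (K * D powr q - ((1 + \<epsilon>) * (K * d powr q) + pow_int v)) / p + \<eta> / (2 * \<sigma>) * D powr \<sigma> - \<mu> / 2 * sq_int v"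
        unfolding F_def using p_gt_2 q_gt_1 \<sigma> \<eta>
        by (intro tendsto_intros tendsto_powr2 yD yd yL I(1)) (auto simp: dirichlet_energy_nonneg)
      have "(\<lambda>n. m + 1 / real (Suc ((r \<circ> r') n))) \<longlonglongrightarrow> m + 0"
        using LIMSEQ_subseq_LIMSEQ[OF LIMSEQ_Suc[OF lim_1_over_n] strict_mono_o[OF r D(1)]]
        by (intro tendsto_intros) (simp add: o_def)
      then show "(\<lambda>n. m + 1 / real (Suc ((r \<circ> r') n))) \<longlonglongrightarrow> m" by simp
      have "F n \<le> m + 1 / real (Suc ((r \<circ> r') n))" for n
      proof -
        have "pow_int (y n) \<le> (1 + \<epsilon>) * (K * dirichlet_energy \<Omega> (\<lambda>x. y n x - v x) powr q) + I n"
        proof -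
          have "(1 + \<epsilon>) * pow_int (\<lambda>x. y n x - v x) \<le> (1 + \<epsilon>) * (K * dirichlet_energy \<Omega> (\<lambda>x. y n x - v x) powr q)"
            by (intro mult_left_mono pow_int_le H10_diff yH v) (use \<epsilon> in simp)
          then show ?thesis using I(2)[of n] by linarith
        qed
        then have "F n \<le> energy (y n)"
          unfolding F_def energy_def using p_gt_2 by (intro diff_right_mono add_mono order_refl divide_right_mono) auto
        also have "\<dots> \<le> m + 1 / real (Suc ((r \<circ> r') n))" using u(2)[of "r (r' n)"] by (simp add: y_def)
        finally show ?thesis .
      qed
      then show "\<exists>N. \<forall>n\<ge>N. F n \<le> m + 1 / real (Suc ((r \<circ> r') n))" by blast
    qed
  qed
  have "a / 2 * D + (K * D powr q - (K * d powr q + pow_int v)) / p + \<eta> / (2 * \<sigma>) * D powr \<sigma> - \<mu> / 2 * sq_int v \<le> m"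
  proof (rule tendsto_upperbound)
    have "((\<lambda>\<epsilon>. a / 2 * D + (K * D powr q - ((1 + \<epsilon>) * (K * d powr q) + pow_int v)) / p + \<eta> / (2 * \<sigma>) * D powr \<sigma> - \<mu> / 2 * sq_int v)
      \<longlongrightarrow> a / 2 * D + (K * D powr q - ((1 + 0) * (K * d powr q) + pow_int v)) / p + \<eta> / (2 * \<sigma>) * D powr \<sigma> - \<mu> / 2 * sq_int v) (at_right 0)"
      using p_gt_2 by (intro tendsto_intros) auto
    then show "((\<lambda>\<epsilon>. a / 2 * D + (K * D powr q - ((1 + \<epsilon>) * (K * d powr q) + pow_int v)) / p + \<eta> / (2 * \<sigma>) * D powr \<sigma> - \<mu> / 2 * sq_int v)
      \<longlongrightarrow> a / 2 * D + (K * D powr q - (K * d powr q + pow_int v)) / p + \<eta> / (2 * \<sigma>) * D powr \<sigma> - \<mu> / 2 * sq_int v) (at_right 0)" by simp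
    show "\<forall>\<^sub>F \<epsilon> in at_right 0. a / 2 * D + (K * D powr q - ((1 + \<epsilon>) * (K * d powr q) + pow_int v)) / p + \<eta> / (2 * \<sigma>) * D powr \<sigma> - \<mu> / 2 * sq_int v \<le> m"
      using eventually_at_right_less by eventually_elim (rule eps)
  qed simp
  \<comment> \<open>Superadditivity for D = (energy of v) + d returns the subtracted K d^q in full,
    because the same K stands before the energy term and in the Sobolev inequality. The other terms
    are monotone in D.\<close>
  moreover have "energy v \<le> a / 2 * D + (K * D powr q - (K * d powr q + pow_int v)) / p + \<eta> / (2 * \<sigma>) * D powr \<sigma> - \<mu> / 2 * sq_int v"
  proof -
    have De: "D = dirichlet_energy \<Omega> v + d" by (simp add: d_def)
    have 1: "dirichlet_energy \<Omega> v \<le> D" using d0 by (simp add: De)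
    have "dirichlet_energy \<Omega> v powr q + d powr q \<le> D powr q"
      unfolding De using ev0 d0 q_gt_1 by (intro powr_superadditive) auto
    then have "K * (dirichlet_energy \<Omega> v powr q + d powr q) \<le> K * D powr q" using K_nonneg by (rule mult_left_mono)
    then have 2: "K * dirichlet_energy \<Omega> v powr q - pow_int v \<le> K * D powr q - (K * d powr q + pow_int v)"
      by (simp add: distrib_left)
    have 3: "dirichlet_energy \<Omega> v powr \<sigma> \<le> D powr \<sigma>" using 1 ev0 \<sigma> by (intro powr_mono2) auto
    show ?thesis unfolding energy_def
      using a \<eta> \<sigma> p_gt_2 by (intro diff_right_mono add_mono mult_left_mono divide_right_mono 1 2 3) auto
  qed
  ultimately have vm: "energy v \<le> m" by linarith
  show ?thesis
  proof (rule that[OF v])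
    show "energy v < 0" using vm m0 by linarith
    show "energy v \<le> energy w" if "w \<in> H10 \<Omega>" for w using vm mle[OF that] by linarith
  qed
qed

end

subsection \<open>The Euler-Lagrange equation\<close>

text \<open>Away from 0 this is the usual power rule on each half line. At 0 the difference quotient
  has size |h|^(p-1), which tends to 0 since p > 1.\<close>

lemma abs_powr_has_derivative:
  fixes p s :: real
  assumes "p > 1"
  shows "((\<lambda>s. \<bar>s\<bar> powr p) has_real_derivative p * (\<bar>s\<bar> powr (p - 2) * s)) (at s)"
proof -
  consider "s < 0" | "s = 0" | "s > 0" by linarith
  then show ?thesis
  proof cases
    case 1
    have "((\<lambda>s. (- s) powr p) has_real_derivative p * ((- s) powr (p - 1)) * (- 1)) (at s)"
      by (rule DERIV_chain2[OF has_real_derivative_powr]) (use 1 in \<open>auto intro!: derivative_eq_intros\<close>)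
    moreover have "(- s) powr (p - 1) = (- s) powr (p - 2) * (- s)"
    proof -
      have "(- s) powr (p - 1) = (- s) powr ((p - 2) + 1)" by simp
      also have "\<dots> = (- s) powr (p - 2) * (- s)" using 1 by (simp only: powr_add) simp
      finally show ?thesis .
    qed
    ultimately have "((\<lambda>s. (- s) powr p) has_real_derivative p * (\<bar>s\<bar> powr (p - 2) * s)) (at s)" using 1 by simp
    then show ?thesis
      by (rule has_field_derivative_transform_within_open[of _ _ _ "{..<0}"]) (use 1 in auto)
  next
    case 2
    have "((\<lambda>h. (\<bar>0 + h\<bar> powr p - \<bar>0\<bar> powr p) / h) \<longlongrightarrow> 0) (at 0)"
    proof (rule Lim_null_comparison)
      have "((\<lambda>h. \<bar>h\<bar> powr (p - 1)) \<longlongrightarrow> \<bar>0\<bar> powr (p - 1)) (at (0::real))"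
        using assms by (intro tendsto_powr2 tendsto_intros) auto
      then show "((\<lambda>h. \<bar>h\<bar> powr (p - 1)) \<longlongrightarrow> 0) (at (0::real))" by simp
      show "\<forall>\<^sub>F h in at 0. norm ((\<bar>0 + h\<bar> powr p - \<bar>0\<bar> powr p) / h) \<le> \<bar>h\<bar> powr (p - 1)"
        using assms by (intro always_eventually) (auto simp: powr_diff)
    qed
    then show ?thesis using 2 by (simp add: DERIV_def)
  next
    case 3
    have "s powr (p - 1) = s powr ((p - 2) + 1)" by simp
    also have "\<dots> = s powr (p - 2) * s" using 3 by (simp only: powr_add) simp
    finally have "((\<lambda>s. s powr p) has_real_derivative p * (\<bar>s\<bar> powr (p - 2) * s)) (at s)"
      using has_real_derivative_powr[OF 3, of p] 3 by simp
    then show ?thesis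
      by (rule has_field_derivative_transform_within_open[of _ _ _ "{0<..}"]) (use 3 in auto)
  qed
qed

text \<open>Mean value theorem on [-m, m] with m = |x| + |y|, an interval that contains both points
  and on which the derivative is at most p m^(p-1).\<close>

lemma abs_powr_diff_le:
  fixes x y p :: real
  assumes "p > 1"
  shows "\<bar>\<bar>x + y\<bar> powr p - \<bar>x\<bar> powr p\<bar> \<le> p * (\<bar>x\<bar> + \<bar>y\<bar>) powr (p - 1) * \<bar>y\<bar>"
proof -
  define m where "m = \<bar>x\<bar> + \<bar>y\<bar>"
  have "norm (\<bar>x + y\<bar> powr p - \<bar>x\<bar> powr p) \<le> p * m powr (p - 1) * norm (x + y - x)"
  proof (rule field_differentiable_bound[of "{-m..m}" "\<lambda>s. \<bar>s\<bar> powr p" "\<lambda>s. p * (\<bar>s\<bar> powr (p - 2) * s)"])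
    show "((\<lambda>s. \<bar>s\<bar> powr p) has_field_derivative p * (\<bar>z\<bar> powr (p - 2) * z)) (at z within {- m..m})" for z
      using abs_powr_has_derivative[OF assms] by (rule has_field_derivative_at_within)
    show "norm (p * (\<bar>z\<bar> powr (p - 2) * z)) \<le> p * m powr (p - 1)" if "z \<in> {- m..m}" for z
    proof (cases "z = 0")
      case False
      have "\<bar>z\<bar> powr (p - 2) * \<bar>z\<bar> = \<bar>z\<bar> powr ((p - 2) + 1)" using False by (simp only: powr_add) simp
      also have "\<dots> = \<bar>z\<bar> powr (p - 1)" by simp
      also have "\<dots> \<le> m powr (p - 1)" using that assms by (intro powr_mono2) auto
      finally show ?thesis using assms by (simp add: abs_mult)
    qed (use assms in simp)
  qed (auto simp: m_def)
  then show ?thesis by (simp add: m_def)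
qed

context sobolev_domain
begin

lemma powr_weak_integrable:
  assumes "u \<in> H10 \<Omega>" "v \<in> H10 \<Omega>"
  shows "integrable L\<Omega> (\<lambda>x. (\<bar>u x\<bar> + \<bar>v x\<bar>) powr p)"
proof -
  have p0: "p > 0" using p_gt_2 by simp
  obtain C where C: "C \<ge> 0" "\<And>a b. \<bar>a + b\<bar> powr p \<le> (1 + 1) * \<bar>a\<bar> powr p + C * \<bar>b\<bar> powr p"
    by (rule powr_add_le[OF p0 zero_less_one]) blast
  note [measurable] = assms[THEN H10_L2(1), THEN sq_integrable_measurable]
  show ?thesis
  proof (rule Bochner_Integration.integrable_bound)
    show "integrable L\<Omega> (\<lambda>x. (1 + 1) * \<bar>u x\<bar> powr p + C * \<bar>v x\<bar> powr p)"
      by (intro Bochner_Integration.integrable_add integrable_mult_right H10_powr_integrable assms)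
    show "(\<lambda>x. (\<bar>u x\<bar> + \<bar>v x\<bar>) powr p) \<in> borel_measurable L\<Omega>" by measurable
    show "AE x in L\<Omega>. norm ((\<bar>u x\<bar> + \<bar>v x\<bar>) powr p) \<le> norm ((1 + 1) * \<bar>u x\<bar> powr p + C * \<bar>v x\<bar> powr p)"
      using C(2)[of "\<bar>u _\<bar>" "\<bar>v _\<bar>"] C(1) by (intro AE_I2) (simp add: abs_of_nonneg)
  qed
qed

text \<open>Differentiation under the integral along null sequences bounded by M. The quotients are
  at most p (|u| + M |v|)^(p-1) |v|, hence at most p/M times the p-th power of |u| + M |v|, which is
  integrable; this takes the place of Holder's inequality.\<close>

lemma pow_int_has_derivative:
  assumes u: "u \<in> H10 \<Omega>" and v: "v \<in> H10 \<Omega>"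
  shows "((\<lambda>t. pow_int (\<lambda>x. u x + t * v x)) has_real_derivative
    p * (LINT x|L\<Omega>. \<bar>u x\<bar> powr (p - 2) * u x * v x)) (at 0)"
proof -
  have p1: "p > 1" using p_gt_2 by simp
  note [measurable] = u[THEN H10_L2(1), THEN sq_integrable_measurable] v[THEN H10_L2(1), THEN sq_integrable_measurable]
  have "((\<lambda>h. (pow_int (\<lambda>x. u x + (0 + h) * v x) - pow_int (\<lambda>x. u x + 0 * v x)) / h) \<longlongrightarrow>
    (LINT x|L\<Omega>. p * (\<bar>u x\<bar> powr (p - 2) * u x * v x))) (at 0)"
    unfolding tendsto_at_iff_sequentially comp_def
  proof (intro allI impI)
    fix X :: "nat \<Rightarrow> real" assume X: "\<forall>i. X i \<in> UNIV - {0}" "X \<longlonglongrightarrow> 0"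
    have X0: "X i \<noteq> 0" for i using X(1) by auto
    obtain M where M: "M > 0" "\<And>i. \<bar>X i\<bar> \<le> M"
      using convergent_imp_Bseq[OF convergentI[OF X(2)]] by (auto simp: Bseq_def)
    define f where "f i x = (\<bar>u x + X i * v x\<bar> powr p - \<bar>u x\<bar> powr p) / X i" for i x
    note Mv = H10_scale[OF v, of M]
    have "(\<lambda>i. LINT x|L\<Omega>. f i x) \<longlonglongrightarrow> (LINT x|L\<Omega>. p * (\<bar>u x\<bar> powr (p - 2) * u x * v x))"
    proof (rule integral_dominated_convergence[where w="\<lambda>x. p / M * (\<bar>u x\<bar> + \<bar>M * v x\<bar>) powr p"])
      show "integrable L\<Omega> (\<lambda>x. p / M * (\<bar>u x\<bar> + \<bar>M * v x\<bar>) powr p)"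
        by (intro integrable_mult_right powr_weak_integrable u Mv)
      show "AE x in L\<Omega>. (\<lambda>i. f i x) \<longlonglongrightarrow> p * (\<bar>u x\<bar> powr (p - 2) * u x * v x)"
      proof (rule AE_I2)
        fix x
        have "((\<lambda>t. u x + t * v x) has_real_derivative v x) (at 0)" by (auto intro!: derivative_eq_intros)
        moreover have "((\<lambda>s. \<bar>s\<bar> powr p) has_real_derivative p * (\<bar>u x\<bar> powr (p - 2) * u x)) (at (u x + 0 * v x))"
          using abs_powr_has_derivative[OF p1, of "u x"] by simp
        ultimately have "((\<lambda>t. \<bar>u x + t * v x\<bar> powr p) has_real_derivative p * (\<bar>u x\<bar> powr (p - 2) * u x) * v x) (at 0)"
          by (rule DERIV_chain2[rotated])
        then have "((\<lambda>h. (\<bar>u x + h * v x\<bar> powr p - \<bar>u x\<bar> powr p) / h) \<longlongrightarrow> p * (\<bar>u x\<bar> powr (p - 2) * u x) * v x) (at 0)"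
          by (simp add: DERIV_def)
        then show "(\<lambda>i. f i x) \<longlonglongrightarrow> p * (\<bar>u x\<bar> powr (p - 2) * u x * v x)"
          unfolding tendsto_at_iff_sequentially comp_def f_def using X by (simp add: mult.assoc)
      qed
      show "AE x in L\<Omega>. norm (f i x) \<le> p / M * (\<bar>u x\<bar> + \<bar>M * v x\<bar>) powr p" for i
      proof (rule AE_I2)
        fix x
        define m where "m = \<bar>u x\<bar> + \<bar>M * v x\<bar>"
        have le: "\<bar>X i * v x\<bar> \<le> \<bar>M * v x\<bar>" using M(2)[of i] M(1) by (simp add: abs_mult mult_right_mono)
        have "\<bar>\<bar>u x + X i * v x\<bar> powr p - \<bar>u x\<bar> powr p\<bar> \<le> p * (\<bar>u x\<bar> + \<bar>X i * v x\<bar>) powr (p - 1) * \<bar>X i * v x\<bar>"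
          by (rule abs_powr_diff_le[OF p1])
        also have "\<dots> \<le> p * m powr (p - 1) * \<bar>X i * v x\<bar>"
          using le p1 by (intro mult_right_mono mult_left_mono powr_mono2) (auto simp: m_def)
        finally have "\<bar>f i x\<bar> \<le> p * m powr (p - 1) * \<bar>v x\<bar>"
          using X0[of i] by (simp add: f_def abs_mult field_simps)
        also have "\<dots> = p / M * (m powr (p - 1) * \<bar>M * v x\<bar>)" using M(1) by (simp add: abs_mult)
        also have "\<dots> \<le> p / M * (m powr (p - 1) * m)"
          using p1 M(1) by (intro mult_left_mono) (auto simp: m_def)
        also have "m powr (p - 1) * m = m powr p"
        proof (cases "m = 0")
          case False
          then have "m > 0" by (simp add: m_def add_nonneg_pos less_le)
          then have "m powr (p - 1) * m = m powr ((p - 1) + 1)" by (simp only: powr_add) simp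
          then show ?thesis by simp
        qed (use p1 in simp)
        finally show "norm (f i x) \<le> p / M * (\<bar>u x\<bar> + \<bar>M * v x\<bar>) powr p" by (simp add: m_def)
      qed
      show "(\<lambda>x. p * (\<bar>u x\<bar> powr (p - 2) * u x * v x)) \<in> borel_measurable L\<Omega>" by measurable
      show "f i \<in> borel_measurable L\<Omega>" for i unfolding f_def by measurable
    qed
    moreover have "(LINT x|L\<Omega>. f i x) = (pow_int (\<lambda>x. u x + (0 + X i) * v x) - pow_int (\<lambda>x. u x + 0 * v x)) / X i" for i
      unfolding f_def pow_int_def
      using H10_powr_integrable[OF u] H10_powr_integrable[OF H10_add_scale(1)[OF u v, of "X i"]] by simp
    ultimately show "(\<lambda>i. (pow_int (\<lambda>x. u x + (0 + X i) * v x) - pow_int (\<lambda>x. u x + 0 * v x)) / X i) \<longlonglongrightarrow>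
      (LINT x|L\<Omega>. p * (\<bar>u x\<bar> powr (p - 2) * u x * v x))" by simp
  qed
  then show ?thesis by (simp add: DERIV_def)
qed

end

context kirchhoff_problem
begin

text \<open>Fermat's rule at t = 0 for the energy of u + t v. The Dirichlet energy along this line
  is the quadratic polynomial g, so only the integral of |u + t v|^p needs differentiation under the
  integral.\<close>

lemma minimizer_solution:
  assumes u: "u \<in> H10 \<Omega>" and neg: "energy u < 0" and min: "\<And>w. w \<in> H10 \<Omega> \<Longrightarrow> energy u \<le> energy w"
  shows "nontrivial_weak_solution \<Omega> a \<eta> \<sigma> \<mu> u"
proof -
  define e where "e = dirichlet_energy \<Omega> u"
  \<comment> \<open>The powers of g are differentiated at g 0 = e, where the power rule asks for a
    positive base. By \<open>energy_lower\<close>, e = 0 would make the energy nonnegative.\<close>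
  have e: "e > 0"
  proof (rule ccontr)
    assume "\<not> e > 0"
    then have "e = 0" using dirichlet_energy_nonneg[of u] by (simp add: e_def)
    then show False using energy_lower[OF u] neg by (simp add: e_def)
  qed
  have p2: "p > 2" by (rule p_gt_2)
  have nz: "\<not> ae_eq_on \<Omega> u (\<lambda>x. 0)"
  proof
    assume "ae_eq_on \<Omega> u (\<lambda>x. 0)"
    then have "sq_int u = 0" "pow_int u = 0"
      using ae_eq_zero_iff[OF u] by (auto simp: sq_int_def pow_int_def)
    then have "energy u \<ge> 0" using a \<eta> \<sigma> p2 K_nonneg dirichlet_energy_nonneg[of u] by (simp add: energy_def)
    then show False using neg by simp
  qed
  have eq: "kirchhoff_coeff \<Omega> a \<eta> \<sigma> (dirichlet_energy \<Omega> u) * dirichlet_form \<Omega> u v =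
     \<mu> * (LINT x|L\<Omega>. u x * v x) + (LINT x|L\<Omega>. \<bar>u x\<bar> powr (crit_exp DIM('a) - 2) * u x * v x)"
    if v: "v \<in> H10 \<Omega>" for v
  proof -
    define B where "B = dirichlet_form \<Omega> u v"
    define J where "J = (LINT x|L\<Omega>. \<bar>u x\<bar> powr (p - 2) * u x * v x)"
    define L where "L = (LINT x|L\<Omega>. u x * v x)"
    define g where "g t = e + 2 * t * B + t\<^sup>2 * dirichlet_energy \<Omega> v" for t
    have g0: "g 0 = e" by (simp add: g_def)
    have dg: "(g has_real_derivative 2 * B) (at 0)"
      unfolding g_def by (auto intro!: derivative_eq_intros)
    have dgp: "((\<lambda>t. g t powr s) has_real_derivative s * e powr (s - 1) * (2 * B)) (at 0)" for s
      using DERIV_chain2[OF has_real_derivative_powr[of "g 0" s] dg] e by (simp add: g0)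
    have ds: "((\<lambda>t. sq_int u + 2 * t * L + t\<^sup>2 * sq_int v) has_real_derivative 2 * L) (at 0)"
      by (auto intro!: derivative_eq_intros)
    have "((\<lambda>t. a / 2 * g t + (K * g t powr q - pow_int (\<lambda>x. u x + t * v x)) / p
       + \<eta> / (2 * \<sigma>) * g t powr \<sigma> - \<mu> / 2 * (sq_int u + 2 * t * L + t\<^sup>2 * sq_int v)) has_real_derivative
       (a / 2 * (2 * B) + (K * (q * e powr (q - 1) * (2 * B)) - p * J) / p
       + \<eta> / (2 * \<sigma>) * (\<sigma> * e powr (\<sigma> - 1) * (2 * B)) - \<mu> / 2 * (2 * L))) (at 0)"
      unfolding J_def
      by (intro DERIV_diff DERIV_add DERIV_cmult DERIV_cdivide dg dgp ds pow_int_has_derivative u v)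
    moreover have "(\<lambda>t. a / 2 * g t + (K * g t powr q - pow_int (\<lambda>x. u x + t * v x)) / p
       + \<eta> / (2 * \<sigma>) * g t powr \<sigma> - \<mu> / 2 * (sq_int u + 2 * t * L + t\<^sup>2 * sq_int v)) = (\<lambda>t. energy (\<lambda>x. u x + t * v x))"
      unfolding energy_def dirichlet_energy_add_scale[OF u v] sq_int_add_scale[OF u v] g_def e_def B_def L_def by simp
    ultimately have der: "((\<lambda>t. energy (\<lambda>x. u x + t * v x)) has_real_derivative
       (a / 2 * (2 * B) + (K * (q * e powr (q - 1) * (2 * B)) - p * J) / p
       + \<eta> / (2 * \<sigma>) * (\<sigma> * e powr (\<sigma> - 1) * (2 * B)) - \<mu> / 2 * (2 * L))) (at 0)" by simp
    have "a / 2 * (2 * B) + (K * (q * e powr (q - 1) * (2 * B)) - p * J) / p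
       + \<eta> / (2 * \<sigma>) * (\<sigma> * e powr (\<sigma> - 1) * (2 * B)) - \<mu> / 2 * (2 * L) = 0"
      by (rule DERIV_local_min[OF der zero_less_one]) (use min[OF H10_add_scale(1)[OF u v]] in simp)
    \<comment> \<open>The normalizations 1/p and 1/(2 \<sigma>) in \<open>energy\<close> cancel
      here: 2 q = p, and the outer 2 \<sigma> meets \<sigma> times 2.\<close>
    moreover have "(K * (q * e powr (q - 1) * (2 * B)) - p * J) / p = K * e powr (q - 1) * B - J"
      using p2 by (simp add: diff_divide_distrib)
    moreover have "\<eta> / (2 * \<sigma>) * (\<sigma> * e powr (\<sigma> - 1) * (2 * B)) = \<eta> * e powr (\<sigma> - 1) * B"
      using \<sigma> by simp
    ultimately have "(a + K * e powr (q - 1) + \<eta> * e powr (\<sigma> - 1)) * B = \<mu> * L + J"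
      by (simp only: distrib_right)
    then show ?thesis
      unfolding kirchhoff_coeff_def p_eq[symmetric] by (simp add: K_def S_def e_def B_def L_def J_def)
  qed
  show ?thesis
    unfolding nontrivial_weak_solution_def weak_solution_def using u eq nz by blast
qed

lemma energy_uminus: "u \<in> H10 \<Omega> \<Longrightarrow> energy (\<lambda>x. - u x) = energy u"
  using dirichlet_energy_scale[of u "-1"] sq_int_scale[of "-1" u] by (simp add: energy_def pow_int_def)

lemma two_solutions:
  "\<exists>u v. nontrivial_weak_solution \<Omega> a \<eta> \<sigma> \<mu> u \<and> nontrivial_weak_solution \<Omega> a \<eta> \<sigma> \<mu> v \<and> \<not> ae_eq_on \<Omega> u v"
proof -
  obtain u where u: "u \<in> H10 \<Omega>" "energy u < 0" "\<And>w. w \<in> H10 \<Omega> \<Longrightarrow> energy u \<le> energy w"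
    by (rule minimizer_exists) blast
  have 1: "nontrivial_weak_solution \<Omega> a \<eta> \<sigma> \<mu> u" by (rule minimizer_solution[OF u])
  have "(\<lambda>x. - u x) \<in> H10 \<Omega>" using H10_scale[OF u(1), of "-1"] by simp
  then have 2: "nontrivial_weak_solution \<Omega> a \<eta> \<sigma> \<mu> (\<lambda>x. - u x)"
    using u energy_uminus[OF u(1)] by (intro minimizer_solution) auto
  \<comment> \<open>Equality of u and - u almost everywhere would force u = 0 almost
    everywhere.\<close>
  have "\<not> ae_eq_on \<Omega> u (\<lambda>x. - u x)"
    using 1 by (auto simp: nontrivial_weak_solution_def ae_eq_on_def eq_neg_iff_add_eq_0)
  with 1 2 show ?thesis by blast
qed

end

theorem theorem1p13:
  fixes \<Omega> :: "'a::euclidean_space set" and \<eta> \<sigma> :: real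
  assumes "DIM('a) \<ge> 3"
    and "open \<Omega>" and "connected \<Omega>" and "bounded \<Omega>" and "\<Omega> \<noteq> {}"
    and "\<eta> > 0" and "1 < \<sigma>" and "\<sigma> < crit_exp DIM('a) / 2"
  shows "(\<forall>\<mu>>0. \<exists>u. nontrivial_weak_solution \<Omega> 0 \<eta> \<sigma> \<mu> u) \<and>
    (\<forall>a>0. \<forall>\<mu>>a * first_dirichlet_eigenvalue \<Omega>. \<exists>u v.
       nontrivial_weak_solution \<Omega> a \<eta> \<sigma> \<mu> u \<and>
       nontrivial_weak_solution \<Omega> a \<eta> \<sigma> \<mu> v \<and> \<not> ae_eq_on \<Omega> u v)"
proof -
  interpret sobolev_domain \<Omega> "crit_exp DIM('a)"
    by unfold_locales (use assms in auto)
  \<comment> \<open>It is the Dirichlet energy of the first eigenfunction.\<close>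
  have "first_dirichlet_eigenvalue \<Omega> \<ge> 0"
    by (rule first_eigenfunction) (metis dirichlet_energy_nonneg)
  \<comment> \<open>This covers both parts at once: for a = 0 the condition involving the first
    eigenvalue reads 0 < \<mu>.\<close>
  then have *: "\<exists>u v. nontrivial_weak_solution \<Omega> a \<eta> \<sigma> \<mu> u \<and> nontrivial_weak_solution \<Omega> a \<eta> \<sigma> \<mu> v \<and> \<not> ae_eq_on \<Omega> u v"
    if "a \<ge> 0" "\<mu> > 0" "a * first_dirichlet_eigenvalue \<Omega> < \<mu>" for a \<mu>
  proof -
    interpret kirchhoff_problem \<Omega> "crit_exp DIM('a)" a \<eta> \<sigma> \<mu>
      by unfold_locales (use assms that in auto)
    show ?thesis by (rule two_solutions)
  qed
  show ?thesis
  proof (intro conjI allI impI)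
    fix \<mu> :: real assume "\<mu> > 0"
    then show "\<exists>u. nontrivial_weak_solution \<Omega> 0 \<eta> \<sigma> \<mu> u" using *[of 0 \<mu>] by auto
  next
    fix a \<mu> :: real assume "a > 0" "a * first_dirichlet_eigenvalue \<Omega> < \<mu>"
    moreover from this have "\<mu> > 0" using \<open>first_dirichlet_eigenvalue \<Omega> \<ge> 0\<close>
      by (meson less_eq_real_def mult_nonneg_nonneg order_le_less_trans)
    ultimately show "\<exists>u v. nontrivial_weak_solution \<Omega> a \<eta> \<sigma> \<mu> u \<and>
       nontrivial_weak_solution \<Omega> a \<eta> \<sigma> \<mu> v \<and> \<not> ae_eq_on \<Omega> u v" by (intro *) auto
  qed
qed

end
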